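(* Assume that the shift $\theta$ preserves $\mathbb{P}$ and is ergodic, and that there exist constants $\beta\in[1,\infty)$, $(\varepsilon_-,\varepsilon_+)\in(0,\infty)^2$ and a probability measure $\nu$ on $(\mathsf{X},\mathcal{X})$ such that $$\frac{G(\omega,x)}{G(\omega',x')}\le\beta\quad\forall(\omega,\omega',x,x')\in\Omega^2\times\mathsf{X}^2,\qquad \varepsilon_-\nu(\cdot)\le M(\omega,x,\cdot)\le\varepsilon_+\nu(\cdot)\quad\forall(\omega,x)\in\Omega\times\mathsf{X}.$$ Let $N\ge1$ be fixed arbitrarily and let $\widetilde{\mathbf{M}}$ belong to $\mathbb{M}$. Then the following are equivalent: (1) $\Upsilon_N(\widetilde{\mathbf{M}})=0$. (2) For $\mathbb{P}$-almost all $\omega\in\Omega$ there exists $A_\omega\in\mathcal{X}^{\otimes N}$ such that $\nu^{\otimes N}(A_\omega^c)=0$ and, for any $x\in A_\omega$, $$\widetilde{\mathbf{M}}^\omega(x,B)=\frac{\int_B\mathbf{M}^\omega(x,dx')\,\mathbf{h}^{\theta\omega}(x')}{\int_{\mathsf{X}^N}\mathbf{M}^\omega(x,dz)\,\mathbf{h}^{\theta\omega}(z)}\quad\text{for all }B\in\mathcal{X}^{\otimes N}.$$ (3) For $\mathbb{P}$-almost all $\omega\in\Omega$, $\sup_n\widetilde{\mathcal{V}}^\omega_{n,N}<\infty$.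
   Context: Let $(\mathsf{X},\mathcal{X})$ and $(\mathsf{Y},\mathcal{Y})$ be measurable spaces, $\Omega=\mathsf{Y}^{\mathbb{Z}}$, $\mathcal{F}=\mathcal{Y}^{\otimes\mathbb{Z}}$, $\mathbb{P}$ a probability measure on $(\Omega,\mathcal{F})$, and $\theta:\Omega\to\Omega$ the shift, $(\theta\omega)(n)=\omega(n+1)$, with iterates $\theta^n$ ($n\in\mathbb{Z}$). Let $\mu_0$ be a probability measure on $(\mathsf{X},\mathcal{X})$. Let $M:\Omega\times\mathsf{X}\times\mathcal{X}\to[0,1]$ be such that $M(\omega,x,\cdot)$ is a probability measure for each $(\omega,x)$ and $M(\cdot,\cdot,A)$ is $\mathcal{F}\otimes\mathcal{X}$-measurable for each $A\in\mathcal{X}$. Let $G:\Omega\times\mathsf{X}\to\mathbb{R}_+$ be $\mathcal{F}\otimes\mathcal{X}$-measurable, strictly positive and bounded. For functions and kernels a superscript $\omega$ denotes the $\omega$-section, e.g. $G^\omega(x)=G(\omega,x)$, $M^\omega(x,A)=M(\omega,x,A)$. For fixed $\omega$, $\mathsf{E}^\omega$ denotes expectation under the law of the time-inhomogeneous Markov chain $(X_n)_{n\ge0}$ on $\mathsf{X}$ with $X_0\sim\mu_0$ and $X_n\mid X_{n-1}=x\sim M^{\theta^{n-1}\omega}(x,\cdot)$, $n\ge1$. Let $Q^\omega(x,dx')=G^\omega(x)M^\omega(x,dx')$, acting on bounded measurable functions by $Q^\omega(\varphi)(x)=\int Q^\omega(x,dx')\varphi(x')$ and on measures by $\mu Q^\omega(\cdot)=\int\mu(dx)Q^\omega(x,\cdot)$;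 $Q_0^\omega=\mathrm{Id}$, $Q_n^\omega=Q_{n-1}^\omega Q^{\theta^{n-1}\omega}$; and $\Phi_n^\omega(\mu)=\mu Q_n^\omega/\mu Q_n^\omega(1)$ for probability measures $\mu$. Under the two-sided bounds on $G$ and $M$ in the claim, the limit $$h(\omega,x)=\lim_{n\to\infty}\frac{Q_n^\omega(1)(x)}{\Phi_n^{\theta^{-n}\omega}(\mu)Q_n^\omega(1)}$$ exists for all $(\omega,x)\in\Omega\times\mathsf{X}$ and every probability measure $\mu$ on $\mathsf{X}$, does not depend on $\mu$, and defines an $\mathcal{F}\otimes\mathcal{X}$-measurable function. For $x=(x^1,\dots,x^N),z=(z^1,\dots,z^N)\in\mathsf{X}^N$ put $$\mathbf{M}(\omega,x,dz)=\prod_{i=1}^N\frac{\sum_{j=1}^N G(\omega,x^j)M(\omega,x^j,dz^i)}{\sum_{j=1}^N G(\omega,x^j)},\quad \mathbf{G}(\omega,x)=\frac1N\sum_{i=1}^N G(\omega,x^i),\quad \mathbf{h}(\omega,x)=\frac1N\sum_{i=1}^N h(\omega,x^i).$$ $\mathbb{M}$ is the class of Markov kernels $\widetilde{\mathbf{M}}:\Omega\times\mathsf{X}^N\times\mathcal{X}^{\otimes N}\to[0,1]$ (probability measures in the last argument, jointly measurable in the first two) for which there exist $(\widetilde\varepsilon_-,\widetilde\varepsilon_+)\in(0,\infty)^2$ and a probability measure $\widetilde\nu$ on $(\mathsf{X}^N,\mathcal{X}^{\otimes N})$ with $\widetilde\varepsilon_-\widetilde\nu(\cdot)\le\widetilde{\mathbf{M}}(\omega,x,\cdot)\le\widetilde\varepsilon_+\widetilde\nu(\cdot)$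 for all $(\omega,x)\in\Omega\times\mathsf{X}^N$, $\nu^{\otimes N}\ll\widetilde\nu$ and $\int(d\nu^{\otimes N}/d\widetilde\nu)^2\,d\widetilde\nu<\infty$, where $\nu$ is the probability measure in the hypotheses of the claim. For $\widetilde{\mathbf{M}}\in\mathbb{M}$ write $\phi^\omega(x,x')=\frac{d\mathbf{M}^\omega(x,\cdot)}{d\widetilde{\mathbf{M}}^\omega(x,\cdot)}(x')$ (a version of the Radon–Nikodym derivative jointly measurable in $(\omega,x,x')$). For fixed $\omega$, $\widetilde{\mathsf{E}}_N^\omega$ denotes expectation under the law of the $\mathsf{X}^N$-valued Markov chain $(\zeta_n)_{n\ge0}$ with $\zeta_0\sim\mu_0^{\otimes N}$ and $\zeta_n\mid\zeta_{n-1}\sim\widetilde{\mathbf{M}}^{\theta^{n-1}\omega}(\zeta_{n-1},\cdot)$. Put $$\widetilde{\mathcal{V}}^\omega_{n,N}=\frac{\widetilde{\mathsf{E}}_N^\omega\left[\prod_{p=0}^{n-1}\mathbf{G}^{\theta^p\omega}(\zeta_p)^2\,\phi^{\theta^p\omega}(\zeta_p,\zeta_{p+1})^2\right]}{\mathsf{E}^\omega\left[\prod_{p=0}^{n-1}G^{\theta^p\omega}(X_p)\right]^2}.$$ Under the hypotheses of the claim there is a constant $\Upsilon_N(\widetilde{\mathbf{M}})\in[0,\infty)$, independent of $\mu_0$, such that $\frac1n\log\widetilde{\mathcal{V}}^\omega_{n,N}\to\Upsilon_N(\widetilde{\mathbf{M}})$ as $n\to\infty$ for $\mathbb{P}$-almost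 all $\omega$; this defines $\Upsilon_N(\widetilde{\mathbf{M}})$. *)

theory Defs
  imports "HOL-Probability.Probability"
begin

definition seq_shift :: "(int \<Rightarrow> 'y) \<Rightarrow> int \<Rightarrow> 'y" where
  "seq_shift \<omega> = (\<lambda>n. \<omega> (n + 1))"

definition shift_pow :: "int \<Rightarrow> (int \<Rightarrow> 'y) \<Rightarrow> int \<Rightarrow> 'y" where
  "shift_pow k \<omega> = (\<lambda>n. \<omega> (n + k))"

lemma shift_pow_of_nat: "shift_pow (int n) = seq_shift ^^ n"
proof (induction n)
  case 0
  show ?case by (simp add: shift_pow_def fun_eq_iff)
next
  case (Suc n)
  show ?case unfolding funpow.simps Suc.IH[symmetric]
    by (auto simp: shift_pow_def seq_shift_def fun_eq_iff algebra_simps)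
qed

lemma shift_pow_add: "shift_pow (k + l) \<omega> = shift_pow k (shift_pow l \<omega>)"
  by (simp add: shift_pow_def fun_eq_iff algebra_simps)

definition measure_preserving :: "('a \<Rightarrow> 'a) \<Rightarrow> 'a measure \<Rightarrow> bool" where
  "measure_preserving T P \<longleftrightarrow> T \<in> measurable P P \<and> distr P P T = P"

definition ergodic :: "('a \<Rightarrow> 'a) \<Rightarrow> 'a measure \<Rightarrow> bool" where
  "ergodic T P \<longleftrightarrow>
     (\<forall>A\<in>sets P. T -` A \<inter> space P = A \<longrightarrow> measure P A = 0 \<or> measure P A = 1)"

text \<open>
  \<open>K n\<close> is the transition kernel from time \<open>n\<close> to time \<open>n + 1\<close>.  The law lives on the path
  space \<open>PiM UNIV (\<lambda>_. S)\<close> and is the Ionescu-Tulcea measure; the lemma after the definition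
  verifies that the Ionescu-Tulcea theorem applies.
\<close>

definition chain_kernel ::
  "'a measure \<Rightarrow> (nat \<Rightarrow> 'a \<Rightarrow> 'a measure) \<Rightarrow> nat \<Rightarrow> (nat \<Rightarrow> 'a) \<Rightarrow> 'a measure" where
  "chain_kernel \<mu>0 K i x = (case i of 0 \<Rightarrow> \<mu>0 | Suc n \<Rightarrow> K n (x n))"

definition markov_law ::
  "'a measure \<Rightarrow> 'a measure \<Rightarrow> (nat \<Rightarrow> 'a \<Rightarrow> 'a measure) \<Rightarrow> (nat \<Rightarrow> 'a) measure" where
  "markov_law S \<mu>0 K =
     projective_family.lim UNIV (Ionescu_Tulcea.CI (chain_kernel \<mu>0 K) (\<lambda>_. S)) (\<lambda>_. S)"

lemma Ionescu_Tulcea_chain_kernel: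
  assumes "\<mu>0 \<in> space (prob_algebra S)" and K: "\<And>n. K n \<in> measurable S (prob_algebra S)"
  shows "Ionescu_Tulcea (chain_kernel \<mu>0 K) (\<lambda>_. S)"
proof (rule Ionescu_Tulcea.intro)
  fix i
  have \<mu>0: "\<mu>0 \<in> space (subprob_algebra S)"
    using assms(1) by (auto simp: space_prob_algebra space_subprob_algebra prob_space_imp_subprob_space)
  show "chain_kernel \<mu>0 K i \<in> measurable (PiM {0..<i} (\<lambda>_. S)) (subprob_algebra S)"
  proof (cases i)
    case 0
    then show ?thesis using \<mu>0 by (simp add: chain_kernel_def[abs_def])
  next
    case (Suc n)
    have "(\<lambda>x. K n (x n)) \<in> measurable (PiM {0..<Suc n} (\<lambda>_. S)) (subprob_algebra S)"
      by (rule measurable_compose[OF _ measurable_prob_algebraD[OF K]]) simp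
    then show ?thesis using Suc by (simp add: chain_kernel_def[abs_def])
  qed
next
  fix i and x :: "nat \<Rightarrow> 'a" assume x: "x \<in> space (PiM {0..<i} (\<lambda>_. S))"
  show "prob_space (chain_kernel \<mu>0 K i x)"
  proof (cases i)
    case 0
    then show ?thesis using assms(1) by (simp add: chain_kernel_def space_prob_algebra)
  next
    case (Suc n)
    have "x n \<in> space S" using x Suc by (auto simp: space_PiM PiE_iff)
    then have "K n (x n) \<in> space (prob_algebra S)" using K by (rule measurable_space[rotated])
    then show ?thesis using Suc by (simp add: chain_kernel_def space_prob_algebra)
  qed
qed

text \<open>
  \<open>kernel_left \<mu> K\<close> is \<open>\<mu> K\<close>.  The Giry-monad bind is restricted to subprobability kernels, so it
  cannot be used for the unnormalised kernels below.
\<close>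

definition kernel_left :: "'x measure \<Rightarrow> ('x \<Rightarrow> 'x measure) \<Rightarrow> 'x measure" where
  "kernel_left \<mu> K = measure_of (space \<mu>) (sets \<mu>) (\<lambda>A. \<integral>\<^sup>+x. emeasure (K x) A \<partial>\<mu>)"

lemma emeasure_kernel_left:
  assumes "\<And>x. x \<in> space \<mu> \<Longrightarrow> sets (K x) = sets \<mu>"
    and "\<And>A. A \<in> sets \<mu> \<Longrightarrow> (\<lambda>x. emeasure (K x) A) \<in> borel_measurable \<mu>"
    and A: "A \<in> sets \<mu>"
  shows "emeasure (kernel_left \<mu> K) A = (\<integral>\<^sup>+x. emeasure (K x) A \<partial>\<mu>)"
proof (rule emeasure_measure_of[OF kernel_left_def])
  show "sets \<mu> \<subseteq> Pow (space \<mu>)" by (rule sets.space_closed)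
  show "A \<in> sets (kernel_left \<mu> K)" using A by (simp add: kernel_left_def)
  show "positive (sets (kernel_left \<mu> K)) (\<lambda>A. \<integral>\<^sup>+x. emeasure (K x) A \<partial>\<mu>)"
    by (simp add: positive_def)
  show "countably_additive (sets (kernel_left \<mu> K)) (\<lambda>A. \<integral>\<^sup>+x. emeasure (K x) A \<partial>\<mu>)"
  proof (rule countably_additiveI)
    fix B :: "nat \<Rightarrow> 'a set"
    assume "range B \<subseteq> sets (kernel_left \<mu> K)" and disj: "disjoint_family B"
    then have B: "B i \<in> sets \<mu>" for i by (auto simp: kernel_left_def)
    have "(\<Sum>i. \<integral>\<^sup>+x. emeasure (K x) (B i) \<partial>\<mu>) = (\<integral>\<^sup>+x. (\<Sum>i. emeasure (K x) (B i)) \<partial>\<mu>)"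
      using B assms(2) by (intro nn_integral_suminf[symmetric]) auto
    also have "\<dots> = (\<integral>\<^sup>+x. emeasure (K x) (\<Union>i. B i) \<partial>\<mu>)"
      using B assms(1) disj by (intro nn_integral_cong suminf_emeasure) auto
    finally show "(\<Sum>i. \<integral>\<^sup>+x. emeasure (K x) (B i) \<partial>\<mu>) = (\<integral>\<^sup>+x. emeasure (K x) (\<Union>i. B i) \<partial>\<mu>)" .
  qed
qed

definition kernel_right :: "('x \<Rightarrow> 'x measure) \<Rightarrow> ('x \<Rightarrow> real) \<Rightarrow> 'x \<Rightarrow> real" where
  "kernel_right K f x = (\<integral>x'. f x' \<partial>(K x))"

definition Q_kernel ::
  "((int \<Rightarrow> 'y) \<Rightarrow> 'x \<Rightarrow> real) \<Rightarrow> ((int \<Rightarrow> 'y) \<Rightarrow> 'x \<Rightarrow> 'x measure) \<Rightarrow>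
   (int \<Rightarrow> 'y) \<Rightarrow> 'x \<Rightarrow> 'x measure" where
  "Q_kernel G M \<omega> x = scale_measure (ennreal (G \<omega> x)) (M \<omega> x)"

primrec Q_iter ::
  "'x measure \<Rightarrow> ((int \<Rightarrow> 'y) \<Rightarrow> 'x \<Rightarrow> real) \<Rightarrow> ((int \<Rightarrow> 'y) \<Rightarrow> 'x \<Rightarrow> 'x measure) \<Rightarrow>
   nat \<Rightarrow> (int \<Rightarrow> 'y) \<Rightarrow> 'x \<Rightarrow> 'x measure" where
  "Q_iter X G M 0 \<omega> = return X"
| "Q_iter X G M (Suc n) \<omega> =
     (\<lambda>x. kernel_left (Q_iter X G M n \<omega> x) (Q_kernel G M (shift_pow (int n) \<omega>)))"

definition Phi ::
  "'x measure \<Rightarrow> ((int \<Rightarrow> 'y) \<Rightarrow> 'x \<Rightarrow> real) \<Rightarrow> ((int \<Rightarrow> 'y) \<Rightarrow> 'x \<Rightarrow> 'x measure) \<Rightarrow>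
   nat \<Rightarrow> (int \<Rightarrow> 'y) \<Rightarrow> 'x measure \<Rightarrow> 'x measure" where
  "Phi X G M n \<omega> \<mu> =
     (let \<mu>Q = kernel_left \<mu> (Q_iter X G M n \<omega>)
      in scale_measure (1 / emeasure \<mu>Q (space X)) \<mu>Q)"

definition h_ratio ::
  "'x measure \<Rightarrow> ((int \<Rightarrow> 'y) \<Rightarrow> 'x \<Rightarrow> real) \<Rightarrow> ((int \<Rightarrow> 'y) \<Rightarrow> 'x \<Rightarrow> 'x measure) \<Rightarrow>
   'x measure \<Rightarrow> (int \<Rightarrow> 'y) \<Rightarrow> 'x \<Rightarrow> nat \<Rightarrow> real" where
  "h_ratio X G M \<mu> \<omega> x n =
     kernel_right (Q_iter X G M n \<omega>) (\<lambda>_. 1) x /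
     (\<integral>x'. 1 \<partial>(kernel_left (Phi X G M n (shift_pow (- int n) \<omega>) \<mu>) (Q_iter X G M n \<omega>)))"

text \<open>
  The common value of the limits over all initial probability measures \<open>\<mu>\<close> on \<open>X\<close>.
\<close>

definition h_fun ::
  "'x measure \<Rightarrow> ((int \<Rightarrow> 'y) \<Rightarrow> 'x \<Rightarrow> real) \<Rightarrow> ((int \<Rightarrow> 'y) \<Rightarrow> 'x \<Rightarrow> 'x measure) \<Rightarrow>
   (int \<Rightarrow> 'y) \<Rightarrow> 'x \<Rightarrow> real" where
  "h_fun X G M \<omega> x = (THE c. \<forall>\<mu>\<in>space (prob_algebra X). h_ratio X G M \<mu> \<omega> x \<longlonglongrightarrow> c)"

text \<open>Points of \<open>X\<^sup>N\<close> are functions on \<open>{..<N}\<close>; the coordinates are numbered from 0.\<close>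

abbreviation power_measure :: "nat \<Rightarrow> 'x measure \<Rightarrow> (nat \<Rightarrow> 'x) measure" where
  "power_measure N \<mu> \<equiv> PiM {..<N} (\<lambda>_. \<mu>)"

definition mixture_kernel ::
  "'x measure \<Rightarrow> ((int \<Rightarrow> 'y) \<Rightarrow> 'x \<Rightarrow> real) \<Rightarrow> ((int \<Rightarrow> 'y) \<Rightarrow> 'x \<Rightarrow> 'x measure) \<Rightarrow>
   nat \<Rightarrow> (int \<Rightarrow> 'y) \<Rightarrow> (nat \<Rightarrow> 'x) \<Rightarrow> 'x measure" where
  "mixture_kernel X G M N \<omega> x = measure_of (space X) (sets X)
     (\<lambda>A. (\<Sum>j<N. ennreal (G \<omega> (x j)) * emeasure (M \<omega> (x j)) A) / (\<Sum>j<N. ennreal (G \<omega> (x j))))"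

definition bold_M ::
  "'x measure \<Rightarrow> ((int \<Rightarrow> 'y) \<Rightarrow> 'x \<Rightarrow> real) \<Rightarrow> ((int \<Rightarrow> 'y) \<Rightarrow> 'x \<Rightarrow> 'x measure) \<Rightarrow>
   nat \<Rightarrow> (int \<Rightarrow> 'y) \<Rightarrow> (nat \<Rightarrow> 'x) \<Rightarrow> (nat \<Rightarrow> 'x) measure" where
  "bold_M X G M N \<omega> x = power_measure N (mixture_kernel X G M N \<omega> x)"

definition bold_avg ::
  "((int \<Rightarrow> 'y) \<Rightarrow> 'x \<Rightarrow> real) \<Rightarrow> nat \<Rightarrow> (int \<Rightarrow> 'y) \<Rightarrow> (nat \<Rightarrow> 'x) \<Rightarrow> real" where
  "bold_avg f N \<omega> x = (1 / real N) * (\<Sum>i<N. f \<omega> (x i))"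

abbreviation bold_G ::
  "((int \<Rightarrow> 'y) \<Rightarrow> 'x \<Rightarrow> real) \<Rightarrow> nat \<Rightarrow> (int \<Rightarrow> 'y) \<Rightarrow> (nat \<Rightarrow> 'x) \<Rightarrow> real" where
  "bold_G G \<equiv> bold_avg G"

abbreviation bold_h ::
  "'x measure \<Rightarrow> ((int \<Rightarrow> 'y) \<Rightarrow> 'x \<Rightarrow> real) \<Rightarrow> ((int \<Rightarrow> 'y) \<Rightarrow> 'x \<Rightarrow> 'x measure) \<Rightarrow>
   nat \<Rightarrow> (int \<Rightarrow> 'y) \<Rightarrow> (nat \<Rightarrow> 'x) \<Rightarrow> real" where
  "bold_h X G M \<equiv> bold_avg (h_fun X G M)"

text \<open>
  Measurability into \<open>prob_algebra S\<close> says precisely that every value is a probability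
  measure on \<open>S\<close> and that every evaluation on a measurable set is jointly measurable.
\<close>

definition random_markov_kernel ::
  "'w measure \<Rightarrow> 'a measure \<Rightarrow> ('w \<Rightarrow> 'a \<Rightarrow> 'a measure) \<Rightarrow> bool" where
  "random_markov_kernel \<Omega> S K \<longleftrightarrow> (\<lambda>(\<omega>, x). K \<omega> x) \<in> measurable (\<Omega> \<Otimes>\<^sub>M S) (prob_algebra S)"

definition two_sided_bound ::
  "'w measure \<Rightarrow> 'a measure \<Rightarrow> ('w \<Rightarrow> 'a \<Rightarrow> 'a measure) \<Rightarrow> 'a measure \<Rightarrow> real \<Rightarrow> real \<Rightarrow> bool" where
  "two_sided_bound \<Omega> S K \<nu> l u \<longleftrightarrow>
     (\<forall>\<omega>\<in>space \<Omega>. \<forall>x\<in>space S. \<forall>A\<in>sets S.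
        l * measure \<nu> A \<le> measure (K \<omega> x) A \<and> measure (K \<omega> x) A \<le> u * measure \<nu> A)"

definition kernel_class ::
  "'w measure \<Rightarrow> 'x measure \<Rightarrow> 'x measure \<Rightarrow> nat \<Rightarrow>
   ('w \<Rightarrow> (nat \<Rightarrow> 'x) \<Rightarrow> (nat \<Rightarrow> 'x) measure) set" where
  "kernel_class \<Omega> X \<nu> N =
     {Mt. random_markov_kernel \<Omega> (power_measure N X) Mt \<and>
        (\<exists>l u. \<exists>\<nu>t\<in>space (prob_algebra (power_measure N X)).
           0 < l \<and> 0 < u \<and> two_sided_bound \<Omega> (power_measure N X) Mt \<nu>t l u \<and>
           absolutely_continuous \<nu>t (power_measure N \<nu>) \<and>
           (\<integral>\<^sup>+x. (RN_deriv \<nu>t (power_measure N \<nu>) x)\<^sup>2 \<partial>\<nu>t) < \<infinity>)}"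

definition density_version ::
  "'w measure \<Rightarrow> 'a measure \<Rightarrow> ('w \<Rightarrow> 'a \<Rightarrow> 'a measure) \<Rightarrow> ('w \<Rightarrow> 'a \<Rightarrow> 'a measure) \<Rightarrow>
   ('w \<Rightarrow> 'a \<Rightarrow> 'a \<Rightarrow> ennreal) \<Rightarrow> bool" where
  "density_version \<Omega> S K Kt \<phi> \<longleftrightarrow>
     (\<lambda>(\<omega>, x, x'). \<phi> \<omega> x x') \<in> borel_measurable (\<Omega> \<Otimes>\<^sub>M S \<Otimes>\<^sub>M S) \<and>
     (\<forall>\<omega>\<in>space \<Omega>. \<forall>x\<in>space S. density (Kt \<omega> x) (\<phi> \<omega> x) = K \<omega> x)"

definition V_tilde ::
  "'x measure \<Rightarrow> ((int \<Rightarrow> 'y) \<Rightarrow> 'x \<Rightarrow> real) \<Rightarrow> ((int \<Rightarrow> 'y) \<Rightarrow> 'x \<Rightarrow> 'x measure) \<Rightarrow> nat \<Rightarrow>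
   ((int \<Rightarrow> 'y) \<Rightarrow> (nat \<Rightarrow> 'x) \<Rightarrow> (nat \<Rightarrow> 'x) measure) \<Rightarrow>
   ((int \<Rightarrow> 'y) \<Rightarrow> (nat \<Rightarrow> 'x) \<Rightarrow> (nat \<Rightarrow> 'x) \<Rightarrow> ennreal) \<Rightarrow>
   'x measure \<Rightarrow> (int \<Rightarrow> 'y) \<Rightarrow> nat \<Rightarrow> ennreal" where
  "V_tilde X G M N Mt \<phi> \<mu>0 \<omega> n =
     (\<integral>\<^sup>+\<zeta>. (\<Prod>p<n. (ennreal (bold_G G N (shift_pow (int p) \<omega>) (\<zeta> p)))\<^sup>2 *
                   (\<phi> (shift_pow (int p) \<omega>) (\<zeta> p) (\<zeta> (Suc p)))\<^sup>2)
        \<partial>(markov_law (power_measure N X) (power_measure N \<mu>0) (\<lambda>p. Mt (shift_pow (int p) \<omega>)))) /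
     (\<integral>\<^sup>+x. (\<Prod>p<n. ennreal (G (shift_pow (int p) \<omega>) (x p)))
        \<partial>(markov_law X \<mu>0 (\<lambda>p. M (shift_pow (int p) \<omega>))))\<^sup>2"

text \<open>
  The constant rate that is common to all initial distributions.  Under the standing hypotheses
  \<open>V_tilde\<close> takes values in \<open>(0, \<infinity>)\<close>, so nothing is lost by passing to \<open>enn2real\<close>.
\<close>

definition Upsilon ::
  "(int \<Rightarrow> 'y) measure \<Rightarrow> 'x measure \<Rightarrow>
   ((int \<Rightarrow> 'y) \<Rightarrow> 'x \<Rightarrow> real) \<Rightarrow> ((int \<Rightarrow> 'y) \<Rightarrow> 'x \<Rightarrow> 'x measure) \<Rightarrow> nat \<Rightarrow>
   ((int \<Rightarrow> 'y) \<Rightarrow> (nat \<Rightarrow> 'x) \<Rightarrow> (nat \<Rightarrow> 'x) measure) \<Rightarrow>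
   ((int \<Rightarrow> 'y) \<Rightarrow> (nat \<Rightarrow> 'x) \<Rightarrow> (nat \<Rightarrow> 'x) \<Rightarrow> ennreal) \<Rightarrow> real" where
  "Upsilon P X G M N Mt \<phi> =
     (THE c. 0 \<le> c \<and> (\<forall>\<mu>0\<in>space (prob_algebra X). AE \<omega> in P.
        (\<lambda>n. (1 / real n) * ln (enn2real (V_tilde X G M N Mt \<phi> \<mu>0 \<omega> n))) \<longlonglongrightarrow> c))"

end

theory Submission
  imports Defs
begin

text \<open>
  Write \<open>w = G \<phi> h(\<theta>\<omega>, x') / (\<lambda> h)\<close> for the density, with respect to the importance kernel, of the
  \<open>h\<close>-transform of the bold kernel; the latter is the kernel in (2).  Since \<open>h\<close> is bounded above and
  below, the relative variance is, up to constants, \<open>U\<^sub>n(\<omega>, x) = E\<^sub>x [\<Prod>\<^sub>p w(\<zeta>\<^sub>p, \<zeta>\<^sub>p\<^sub>+\<^sub>1)\<^sup>2]\<close>.  The kernels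
  with density \<open>w\<^sup>2\<close> are uniformly comparable to one finite measure, so \<open>ln U\<^sub>n\<close> is almost
  additive along the shift; its growth rate \<open>c\<close> exists, and \<open>n c\<close> differs from the mean of
  \<open>ln U\<^sub>n\<close> by a bounded amount.  Jensen's inequality for the \<open>h\<close>-transformed chain bounds
  \<open>ln U\<^sub>n\<close> below by a sum of \<open>n\<close> relative entropies.  If \<open>c = 0\<close>, the mean relative entropy must
  therefore vanish, which is (2); under (2) the products are essentially 1, which gives (3); and (3)
  forces \<open>c = 0\<close>.
\<close>

section \<open>An ergodic theorem for almost additive sequences\<close>

text \<open>Numerator and denominator of the relative variance each carry an exponential factor of
  their own. Rewriting \<open>bG * \<phi>\<close> through \<open>h\<close> and the random eigenvalue
  \<open>eigval\<close> splits it off as a telescoping product, and what is left is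
  \<open>w\<close>. The function \<open>h\<close> itself comes from a Doeblin-type contraction of
  ratios of \<open>mass\<close> functions, uniform in the environment. Restarting the chain at time
  n from a fixed point instead of its random position costs at most the factor
  \<open>harnack_const\<close>, from above and from below. With such a two-sided bounded error,
  Birkhoff's theorem for bounded functions already yields the growth rate. The entropy lost in a
  step depends on the random position of the chain. Since \<open>bP\<close> dominates
  \<open>c0\<close> times \<open>nuN\<close>, its mean is at least \<open>c0\<close> times a
  function of the environment alone, whose integral the shift preserves. In (2) the kernel is
  prescribed only off a null set, which may contain the starting point. The weight \<open>w\<close>
  squared charges only what \<open>bP\<close> charges, and \<open>bP\<close> is absolutely
  continuous with respect to \<open>nuN\<close>, so exceptional points can matter in the first step
  only.\<close>

primrec max_partial_sum :: "('a \<Rightarrow> 'a) \<Rightarrow> ('a \<Rightarrow> real) \<Rightarrow> nat \<Rightarrow> 'a \<Rightarrow> real" where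
  "max_partial_sum T g 0 \<omega> = 0"
| "max_partial_sum T g (Suc n) \<omega> = max 0 (g \<omega> + max_partial_sum T g n (T \<omega>))"

lemma birkhoff_sum_Suc:
  "(\<Sum>i<Suc n. g ((T ^^ i) \<omega>)) = g \<omega> + (\<Sum>i<n. g ((T ^^ i) (T \<omega>)) :: real)"
  unfolding sum.lessThan_Suc_shift by (simp add: funpow_swap1)

lemma max_partial_sum_mono: "max_partial_sum T g n \<omega> \<le> max_partial_sum T g (Suc n) \<omega>"
proof (induction n arbitrary: \<omega>)
  case (Suc n)
  show ?case unfolding max_partial_sum.simps(2)[of T g "Suc n"] max_partial_sum.simps(2)[of T g n \<omega>]
    using Suc[of "T \<omega>"] by (intro max.mono) auto
qed simp

text \<open>The recursion produces the maximum of the Birkhoff sums of lengths 0 to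
  \<open>n\<close>, in a form that links time n + 1 at \<open>\<omega>\<close> to time n at
  \<open>T \<omega>\<close>.\<close>

lemma birkhoff_sum_le_max_partial_sum:
  "(\<Sum>i<n. g ((T ^^ i) \<omega>)) \<le> max_partial_sum T g n \<omega>"
proof (induction n arbitrary: \<omega>)
  case (Suc n)
  show ?case unfolding birkhoff_sum_Suc using Suc[of "T \<omega>"] by (simp add: max_def)
qed simp

lemma max_partial_sum_nonneg: "0 \<le> max_partial_sum T g n \<omega>"
  by (cases n) auto

locale ergodic_system = prob_space P for P :: "'a measure" +
  fixes T :: "'a \<Rightarrow> 'a"
  assumes preserving: "measure_preserving T P" and ergodic: "ergodic T P"
begin

lemma measurable_T[measurable]: "T \<in> measurable P P"
  using preserving by (simp add: measure_preserving_def)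

lemma measurable_funpow[measurable]: "T ^^ n \<in> measurable P P"
  by (induction n) (auto intro: measurable_comp simp: id_def)

lemma T_space: "\<omega> \<in> space P \<Longrightarrow> T \<omega> \<in> space P"
  using measurable_space[OF measurable_T] .

lemma funpow_space: "\<omega> \<in> space P \<Longrightarrow> (T ^^ n) \<omega> \<in> space P"
  using measurable_space[OF measurable_funpow] .

lemma integral_T:
  fixes f :: "'a \<Rightarrow> real"
  assumes "f \<in> borel_measurable P"
  shows "(\<integral>\<omega>. f (T \<omega>) \<partial>P) = (\<integral>\<omega>. f \<omega> \<partial>P)"
  using integral_distr[OF measurable_T assms] preserving by (simp add: measure_preserving_def)

lemma AE_T: assumes "AE \<omega> in P. Q \<omega>" shows "AE \<omega> in P. Q (T \<omega>)"
proof -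
  obtain N where N: "N \<in> null_sets P" "{\<omega> \<in> space P. \<not> Q \<omega>} \<subseteq> N"
    using assms by (auto elim!: AE_E3)
  have "emeasure P (T -` N \<inter> space P) = emeasure (distr P P T) N"
    using N by (subst emeasure_distr) auto
  then have "T -` N \<inter> space P \<in> null_sets P"
    using preserving N by (auto simp: measure_preserving_def null_sets_def)
  then show ?thesis
    by (rule AE_I') (use N T_space in auto)
qed

lemma AE_funpow: assumes "AE \<omega> in P. Q \<omega>" shows "AE \<omega> in P. \<forall>n. Q ((T ^^ n) \<omega>)"
proof -
  have "AE \<omega> in P. Q ((T ^^ n) \<omega>)" for n
  proof (induction n)
    case (Suc n)
    show ?case using AE_T[OF Suc] unfolding funpow_Suc_right o_def .
  qed (use assms in simp)
  then show ?thesis by (simp add: AE_all_countable)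
qed

lemma measurable_birkhoff_sum[measurable]:
  assumes [measurable]: "f \<in> borel_measurable P"
  shows "(\<lambda>\<omega>. \<Sum>i<n. f ((T ^^ i) \<omega>) :: real) \<in> borel_measurable P"
  by measurable

lemma measurable_max_partial_sum[measurable]:
  assumes [measurable]: "g \<in> borel_measurable P"
  shows "max_partial_sum T g n \<in> borel_measurable P"
proof (induction n)
  case (Suc n)
  note [measurable] = this
  have "max_partial_sum T g (Suc n) = (\<lambda>\<omega>. max 0 (g \<omega> + max_partial_sum T g n (T \<omega>)))"
    by (simp add: fun_eq_iff)
  then show ?case by simp
qed (simp add: max_partial_sum.simps(1)[abs_def])

text \<open>If the sums were unbounded on a set of full measure, then \<open>M\<^sub>n\<^sub>+\<^sub>1 - M\<^sub>n \<circ> T\<close>, where \<open>M\<^sub>n\<close> is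
  the maximal partial sum, would decrease to \<open>g\<close>, although its integral is nonnegative.\<close>

lemma birkhoff_sum_bounded_above:
  fixes g :: "'a \<Rightarrow> real"
  assumes g[measurable]: "g \<in> borel_measurable P" and B: "\<And>\<omega>. \<omega> \<in> space P \<Longrightarrow> \<bar>g \<omega>\<bar> \<le> B"
    and neg: "(\<integral>\<omega>. g \<omega> \<partial>P) < 0"
  shows "AE \<omega> in P. \<exists>c. \<forall>n. (\<Sum>i<n. g ((T ^^ i) \<omega>)) \<le> c"
proof -
  define S where "S n \<omega> = (\<Sum>i<n. g ((T ^^ i) \<omega>))" for n \<omega>
  have S_Suc: "S (Suc n) \<omega> = g \<omega> + S n (T \<omega>)" for n \<omega>
    unfolding S_def by (rule birkhoff_sum_Suc)
  define A where "A = {\<omega> \<in> space P. \<forall>c::nat. \<exists>n. real c < S n \<omega>}"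
  have [measurable]: "S n \<in> borel_measurable P" for n
    unfolding S_def by measurable
  have A[measurable]: "A \<in> sets P" unfolding A_def by measurable
  have unbdd: "(\<forall>c::nat. \<exists>n. real c < S n \<omega>) \<longleftrightarrow> \<not> (\<exists>c. \<forall>n. S n \<omega> \<le> c)" for \<omega>
  proof
    assume *: "\<forall>c::nat. \<exists>n. real c < S n \<omega>"
    show "\<not> (\<exists>c. \<forall>n. S n \<omega> \<le> c)"
    proof
      assume "\<exists>c. \<forall>n. S n \<omega> \<le> c"
      then obtain c where c: "\<And>n. S n \<omega> \<le> c" by auto
      obtain k :: nat where "c \<le> real k" using real_arch_simple by blast
      with c * show False by (meson le_less_trans not_le)
    qed
  qed (metis not_le)
  have bdd_T: "(\<exists>c. \<forall>n. S n (T \<omega>) \<le> c) \<longleftrightarrow> (\<exists>c. \<forall>n. S n \<omega> \<le> c)" for \<omega>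
  proof
    assume "\<exists>c. \<forall>n. S n (T \<omega>) \<le> c"
    then obtain c where c: "\<And>n. S n (T \<omega>) \<le> c" by auto
    have "S n \<omega> \<le> max 0 (g \<omega> + c)" for n
      by (cases n) (use c[of "n - 1"] in \<open>auto simp: S_Suc S_def[of 0]\<close>)
    then show "\<exists>c. \<forall>n. S n \<omega> \<le> c" by blast
  next
    assume "\<exists>c. \<forall>n. S n \<omega> \<le> c"
    then obtain c where c: "\<And>n. S n \<omega> \<le> c" by auto
    have "S n (T \<omega>) \<le> c - g \<omega>" for n using c[of "Suc n"] by (simp add: S_Suc)
    then show "\<exists>c. \<forall>n. S n (T \<omega>) \<le> c" by blast
  qed
  \<comment> \<open>Passing from \<open>\<omega>\<close> to \<open>T \<omega>\<close> removes a
    single summand, so unboundedness is invariant exactly and not merely up to a null set, as the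
    definition of \<open>ergodic\<close> demands.\<close>
  have "T -` A \<inter> space P = A"
    unfolding A_def unbdd using bdd_T T_space by blast
  then consider "prob A = 0" | "prob A = 1"
    using ergodic A unfolding ergodic_def by blast
  then show ?thesis
  proof cases
    case 1
    then have "AE \<omega> in P. \<omega> \<notin> A"
      using A by (simp add: prob_eq_0)
    with AE_space show ?thesis
      by eventually_elim (use unbdd in \<open>auto simp: A_def S_def[symmetric]\<close>)
  next
    case 2
    then have AA: "AE \<omega> in P. \<omega> \<in> A" by (simp add: prob_eq_1)
    define m where "m = max_partial_sum T g"
    have [measurable]: "m n \<in> borel_measurable P" for n unfolding m_def by measurable
    have m_bound: "\<omega> \<in> space P \<Longrightarrow> \<bar>m n \<omega>\<bar> \<le> real n * B" for n \<omega>
    proof (induction n arbitrary: \<omega>)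
      case (Suc n)
      show ?case using Suc.IH[OF T_space[OF Suc.prems]] B[OF Suc.prems] max_partial_sum_nonneg[of T g n "T \<omega>"]
        by (auto simp: m_def max_def algebra_simps)
    qed (simp add: m_def)
    have int: "integrable P (m n)" for n
      by (rule integrable_const_bound[of _ "real n * B"]) (auto simp: m_bound)
    have intT: "integrable P (\<lambda>\<omega>. m n (T \<omega>))" for n
      by (rule integrable_const_bound[of _ "real n * B"]) (auto simp: m_bound T_space)
    define d where "d n \<omega> = m (Suc n) \<omega> - m n (T \<omega>)" for n \<omega>
    \<comment> \<open>Thus \<open>d n\<close> lies above \<open>g\<close> and coincides with it as
      soon as \<open>m n (T \<omega>)\<close> reaches \<open>- g \<omega>\<close>.\<close>
    have d_eq: "d n \<omega> = max (- m n (T \<omega>)) (g \<omega>)" for n \<omega>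
      by (auto simp: d_def m_def max_def)
    have "0 \<le> (\<integral>\<omega>. d n \<omega> \<partial>P)" for n
    proof -
      have "(\<integral>\<omega>. d n \<omega> \<partial>P) = (\<integral>\<omega>. m (Suc n) \<omega> \<partial>P) - (\<integral>\<omega>. m n (T \<omega>) \<partial>P)"
        unfolding d_def using int intT by simp
      also have "\<dots> = (\<integral>\<omega>. m (Suc n) \<omega> \<partial>P) - (\<integral>\<omega>. m n \<omega> \<partial>P)" by (simp add: integral_T)
      also have "\<dots> \<ge> 0" using int by (simp add: integral_mono m_def del: max_partial_sum.simps add: max_partial_sum_mono)
      finally show ?thesis .
    qed
    moreover have "(\<lambda>n. \<integral>\<omega>. d n \<omega> \<partial>P) \<longlonglongrightarrow> (\<integral>\<omega>. g \<omega> \<partial>P)"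
    proof (rule integral_dominated_convergence[where w="\<lambda>_. B"])
      show "AE \<omega> in P. (\<lambda>n. d n \<omega>) \<longlonglongrightarrow> g \<omega>"
        using AE_T[OF AA]
      proof eventually_elim
        case (elim \<omega>)
        then have "\<not> (\<exists>c. \<forall>n. S n (T \<omega>) \<le> c)" unfolding A_def unbdd by simp
        \<comment> \<open>Unboundedness is used at \<open>T \<omega>\<close>: some partial sum there
          exceeds \<open>- g \<omega>\<close>, and from that time on \<open>d\<close> has reached
          its limit.\<close>
        then obtain n where n: "- g \<omega> < S n (T \<omega>)" using not_le by blast
        have "eventually (\<lambda>k. d k \<omega> = g \<omega>) sequentially"
          unfolding eventually_sequentially
        proof (intro exI[of _ n] allI impI)
          fix k assume "n \<le> k"
          then have "m n (T \<omega>) \<le> m k (T \<omega>)"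
            unfolding m_def by (rule lift_Suc_mono_le[of "\<lambda>k. max_partial_sum T g k (T \<omega>)", rotated]) (rule max_partial_sum_mono)
          moreover have "S n (T \<omega>) \<le> m n (T \<omega>)"
            unfolding S_def m_def by (rule birkhoff_sum_le_max_partial_sum)
          ultimately show "d k \<omega> = g \<omega>" using n by (simp add: d_eq max_def)
        qed
        then show ?case by (rule tendsto_eventually)
      qed
      show "AE \<omega> in P. norm (d n \<omega>) \<le> B" for n
      proof (rule AE_I2)
        fix \<omega> assume "\<omega> \<in> space P"
        then show "norm (d n \<omega>) \<le> B"
          using B[of \<omega>] max_partial_sum_nonneg[of T g n "T \<omega>"] by (auto simp: d_eq m_def max_def)
      qed
    qed (simp_all add: d_def[abs_def])
    ultimately have "0 \<le> (\<integral>\<omega>. g \<omega> \<partial>P)" by (intro LIMSEQ_le_const) auto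
    then show ?thesis using neg by simp
  qed
qed

text \<open>Subtracting the mean plus e/2 makes the integral negative, so the modified sums are
  bounded by a random constant c. The other e/2 absorbs c / n.\<close>

lemma birkhoff_average_upper:
  fixes f :: "'a \<Rightarrow> real"
  assumes f[measurable]: "f \<in> borel_measurable P" and B: "\<And>\<omega>. \<omega> \<in> space P \<Longrightarrow> \<bar>f \<omega>\<bar> \<le> B"
    and "0 < e"
  shows "AE \<omega> in P. \<forall>\<^sub>F n in sequentially. (\<Sum>i<n. f ((T ^^ i) \<omega>)) / n \<le> (\<integral>\<omega>. f \<omega> \<partial>P) + e"
proof -
  define I where "I = (\<integral>\<omega>. f \<omega> \<partial>P)"
  have int: "integrable P f" by (rule integrable_const_bound[of _ B]) (auto simp: B)
  have "AE \<omega> in P. \<exists>c. \<forall>n. (\<Sum>i<n. (\<lambda>\<omega>. f \<omega> - I - e/2) ((T ^^ i) \<omega>)) \<le> c"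
  proof (rule birkhoff_sum_bounded_above)
    show "\<bar>f \<omega> - I - e/2\<bar> \<le> B + \<bar>I\<bar> + e" if "\<omega> \<in> space P" for \<omega> using B[OF that] \<open>0 < e\<close> by auto
    show "(\<integral>\<omega>. f \<omega> - I - e/2 \<partial>P) < 0"
      using int \<open>0 < e\<close> by (simp add: I_def[symmetric] prob_space)
  qed simp
  then show ?thesis
  proof eventually_elim
    case (elim \<omega>)
    then obtain c where c: "\<And>n. (\<Sum>i<n. f ((T ^^ i) \<omega>)) \<le> c + n * (I + e/2)"
      by (auto simp: sum_subtractf algebra_simps)
    obtain n0 :: nat where n0: "2 * \<bar>c\<bar> / e \<le> n0" using real_arch_simple by blast
    have "(\<Sum>i<n. f ((T ^^ i) \<omega>)) / n \<le> I + e" if "n \<ge> Suc n0" for n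
    proof -
      have "2 * \<bar>c\<bar> / e \<le> n" using n0 that by linarith
      then have "c \<le> n * (e/2)" using \<open>0 < e\<close> by (simp add: field_simps) 
      then show ?thesis using c[of n] that by (simp add: field_simps)
    qed
    then show ?case unfolding I_def eventually_sequentially by blast
  qed
qed

text \<open>The upper estimate is applied to \<open>f\<close> and to its negative, with tolerances 1
  / (j + 1) so that only countably many null sets are discarded.\<close>

theorem birkhoff_bounded:
  fixes f :: "'a \<Rightarrow> real"
  assumes f[measurable]: "f \<in> borel_measurable P" and B: "\<And>\<omega>. \<omega> \<in> space P \<Longrightarrow> \<bar>f \<omega>\<bar> \<le> B"
  shows "AE \<omega> in P. (\<lambda>n. (\<Sum>i<n. f ((T ^^ i) \<omega>)) / n) \<longlonglongrightarrow> (\<integral>\<omega>. f \<omega> \<partial>P)"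
proof -
  let ?I = "\<integral>\<omega>. f \<omega> \<partial>P"
  have "AE \<omega> in P. \<forall>j. (\<forall>\<^sub>F n in sequentially. (\<Sum>i<n. f ((T ^^ i) \<omega>)) / n \<le> ?I + 1 / Suc j)
      \<and> (\<forall>\<^sub>F n in sequentially. (\<Sum>i<n. - f ((T ^^ i) \<omega>)) / n \<le> (\<integral>\<omega>. - f \<omega> \<partial>P) + 1 / Suc j)"
    unfolding AE_all_countable
    by (intro allI AE_conjI birkhoff_average_upper[where f=f and B=B] birkhoff_average_upper[where f="\<lambda>\<omega>. - f \<omega>" and B=B]) (auto simp: B)
  then show ?thesis
  proof eventually_elim
    case (elim \<omega>)
    show ?case
    proof (rule tendstoI)
      fix e :: real assume "0 < e"
      then obtain j where j: "1 / Suc j < e" using nat_approx_posE by (metis)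
      from elim[rule_format, of j, THEN conjunct1] elim[rule_format, of j, THEN conjunct2]
      show "\<forall>\<^sub>F n in sequentially. dist ((\<Sum>i<n. f ((T ^^ i) \<omega>)) / n) ?I < e"
        by eventually_elim (use j in \<open>auto simp: dist_real_def abs_real_def sum_negf simp del: of_nat_Suc\<close>)
    qed
  qed
qed

text \<open>The averages of \<open>a k\<close> along an orbit telescope, since
  \<open>a k (T\<^sup>p \<omega>) \<approx> a (p + k) \<omega> - a p \<omega>\<close>.\<close>

lemma almost_additive_average:
  fixes a :: "nat \<Rightarrow> 'a \<Rightarrow> real"
  assumes B: "\<And>n \<omega>. \<omega> \<in> space P \<Longrightarrow> \<bar>a n \<omega>\<bar> \<le> B n"
    and C: "\<And>n m \<omega>. \<omega> \<in> space P \<Longrightarrow> \<bar>a (n + m) \<omega> - a n \<omega> - a m ((T ^^ n) \<omega>)\<bar> \<le> C"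
    and \<omega>: "\<omega> \<in> space P"
  shows "\<bar>(\<Sum>p<n. a k ((T ^^ p) \<omega>)) - k * a n \<omega>\<bar> \<le> n * C + (\<Sum>j<k. C + 2 * B j)"
proof -
  \<comment> \<open>Both sides are the sum of the increments
    \<open>a (p + j + 1) \<omega> - a (p + j) \<omega>\<close> over p < n and j < k, grouped in two
    ways.\<close>
  have tele: "(\<Sum>p<n. a (p + k) \<omega> - a p \<omega>) = (\<Sum>j<k. a (n + j) \<omega> - a j \<omega>)"
  proof (induction k)
    case (Suc k)
    have "(\<Sum>p<n. a (p + Suc k) \<omega> - a p \<omega>) = (\<Sum>p<n. a (p + k) \<omega> - a p \<omega>) + (\<Sum>p<n. a (Suc p + k) \<omega> - a (p + k) \<omega>)"
      by (simp add: sum.distrib[symmetric])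
    also have "(\<Sum>p<n. a (Suc p + k) \<omega> - a (p + k) \<omega>) = a (n + k) \<omega> - a k \<omega>"
      by (induction n) auto
    finally show ?case using Suc by simp
  qed simp
  have 1: "\<bar>(\<Sum>p<n. a k ((T ^^ p) \<omega>)) - (\<Sum>p<n. a (p + k) \<omega> - a p \<omega>)\<bar> \<le> n * C"
  proof -
    have step: "\<bar>a k ((T ^^ p) \<omega>) - (a (p + k) \<omega> - a p \<omega>)\<bar> \<le> C" for p
      using C[OF \<omega>, of p k] by linarith
    have "\<bar>(\<Sum>p<n. a k ((T ^^ p) \<omega>)) - (\<Sum>p<n. a (p + k) \<omega> - a p \<omega>)\<bar>
        \<le> (\<Sum>p<n. \<bar>a k ((T ^^ p) \<omega>) - (a (p + k) \<omega> - a p \<omega>)\<bar>)"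
      unfolding sum_subtractf[symmetric] by (rule sum_abs)
    also have "\<dots> \<le> (\<Sum>p<n. C)"
      by (intro sum_mono) (rule step)
    finally show ?thesis by simp
  qed
  \<comment> \<open>By almost additivity \<open>a (n + j) \<omega>\<close> is
    \<open>a n \<omega>\<close> up to C and one value of \<open>a j\<close>; the second
    \<open>B j\<close> pays for \<open>a j \<omega>\<close>. The bound does not involve n, hence
    vanishes after division by n.\<close>
  have 2: "\<bar>(\<Sum>j<k. a (n + j) \<omega> - a j \<omega>) - k * a n \<omega>\<bar> \<le> (\<Sum>j<k. C + 2 * B j)"
  proof -
    have "\<bar>(\<Sum>j<k. a (n + j) \<omega> - a j \<omega>) - k * a n \<omega>\<bar> = \<bar>\<Sum>j<k. a (n + j) \<omega> - a j \<omega> - a n \<omega>\<bar>"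
      by (simp add: sum_subtractf)
    also have "\<dots> \<le> (\<Sum>j<k. \<bar>a (n + j) \<omega> - a j \<omega> - a n \<omega>\<bar>)" by (rule sum_abs)
    also have "\<dots> \<le> (\<Sum>j<k. C + 2 * B j)"
    proof (rule sum_mono)
      fix j
      show "\<bar>a (n + j) \<omega> - a j \<omega> - a n \<omega>\<bar> \<le> C + 2 * B j"
        using C[OF \<omega>, of n j] B[OF \<omega>, of j] B[OF funpow_space[OF \<omega>, of n], of j] by linarith
    qed
    finally show ?thesis .
  qed
  show ?thesis using 1 2 unfolding tele by linarith
qed

text \<open>After division by n, the telescoping estimate and Birkhoff's theorem for
  \<open>a k\<close> place \<open>k * (a n \<omega> / n)\<close> eventually within C + e of the mean
  of \<open>a k\<close>. So \<open>I k / k\<close> approximates every late value up to an error of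
  order 1 / k, which gives existence of the limit, its constancy and the bounded distance to the
  means at once.\<close>

theorem almost_additive_limit:
  fixes a :: "nat \<Rightarrow> 'a \<Rightarrow> real"
  assumes a[measurable]: "\<And>n. a n \<in> borel_measurable P"
    and B: "\<And>n \<omega>. \<omega> \<in> space P \<Longrightarrow> \<bar>a n \<omega>\<bar> \<le> B n"
    and C: "\<And>n m \<omega>. \<omega> \<in> space P \<Longrightarrow> \<bar>a (n + m) \<omega> - a n \<omega> - a m ((T ^^ n) \<omega>)\<bar> \<le> C"
  obtains c where "AE \<omega> in P. (\<lambda>n. a n \<omega> / n) \<longlonglongrightarrow> c"
    and "\<And>k. \<bar>k * c - (\<integral>\<omega>. a k \<omega> \<partial>P)\<bar> \<le> 2 * C"
proof -
  define I where "I k = (\<integral>\<omega>. a k \<omega> \<partial>P)" for k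
  obtain \<omega>1 where "\<omega>1 \<in> space P" using not_empty by blast
  then have C0: "0 \<le> C" using C[of \<omega>1 0 0] by linarith
  have "AE \<omega> in P. \<forall>k. (\<lambda>n. (\<Sum>i<n. a k ((T ^^ i) \<omega>)) / n) \<longlonglongrightarrow> I k"
    unfolding AE_all_countable I_def by (intro allI birkhoff_bounded) (auto intro: B)
  then have main: "AE \<omega> in P. \<forall>k. \<forall>e>0. \<forall>\<^sub>F n in sequentially. \<bar>k * (a n \<omega> / n) - I k\<bar> \<le> C + e"
  proof (rule AE_mp, intro AE_I2 impI allI)
    fix \<omega> k and e :: real
    assume \<omega>: "\<omega> \<in> space P" and lim: "\<forall>k. (\<lambda>n. (\<Sum>i<n. a k ((T ^^ i) \<omega>)) / n) \<longlonglongrightarrow> I k" and "e > 0"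
    define D where "D = (\<Sum>j<k. C + 2 * B j)"
    have "\<forall>\<^sub>F n in sequentially. dist ((\<Sum>i<n. a k ((T ^^ i) \<omega>)) / n) (I k) < e / 2"
      using lim \<open>e > 0\<close> by (intro tendstoD) auto
    moreover have "(\<lambda>n. D / real n) \<longlonglongrightarrow> 0" by (rule lim_const_over_n)
    then have "\<forall>\<^sub>F n in sequentially. dist (D / real n) 0 < e / 2" using \<open>e > 0\<close> by (intro tendstoD) auto
    moreover have "\<forall>\<^sub>F n in sequentially. (n::nat) > 0" by (rule eventually_gt_at_top)
    ultimately show "\<forall>\<^sub>F n in sequentially. \<bar>k * (a n \<omega> / n) - I k\<bar> \<le> C + e"
    proof eventually_elim
      case (elim n)
      have "\<bar>(\<Sum>p<n. a k ((T ^^ p) \<omega>)) - k * a n \<omega>\<bar> / n \<le> (n * C + D) / n"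
        unfolding D_def by (intro divide_right_mono almost_additive_average[OF B C \<omega>]) auto
      moreover have "\<bar>(\<Sum>p<n. a k ((T ^^ p) \<omega>)) - k * a n \<omega>\<bar> / n
          = \<bar>(\<Sum>p<n. a k ((T ^^ p) \<omega>)) / n - k * (a n \<omega> / n)\<bar>"
        using elim by (simp add: diff_divide_distrib[symmetric])
      moreover have "(n * C + D) / n = C + D / n" using elim by (simp add: field_simps)
      moreover have "\<bar>t - I k\<bar> \<le> C + e"
        if "\<bar>s - t\<bar> \<le> C + d" "\<bar>s - I k\<bar> < e / 2" "\<bar>d - 0\<bar> < e / 2" for s t d
        using that by linarith
      ultimately show ?case using elim(1,2) unfolding dist_real_def by metis
    qed
  qed
  \<comment> \<open>The means \<open>I k\<close> are numbers, so one typical point is enough to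
    compare them with each other.\<close>
  then have "\<exists>\<omega>\<in>space P. \<forall>k. \<forall>e>0. \<forall>\<^sub>F n in sequentially. \<bar>k * (a n \<omega> / n) - I k\<bar> \<le> C + e"
  proof -
    have "AE \<omega> in P. \<omega> \<in> space P \<and> (\<forall>k. \<forall>e>0. \<forall>\<^sub>F n in sequentially. \<bar>k * (a n \<omega> / n) - I k\<bar> \<le> C + e)"
      using main by auto
    from eventually_happens[OF this] show ?thesis using AE_False by (auto simp: ae_filter_eq_bot_iff emeasure_space_1)
  qed
  then obtain \<omega>0 where \<omega>0: "\<And>k e. 0 < e \<Longrightarrow> \<forall>\<^sub>F n in sequentially. \<bar>k * (a n \<omega>0 / n) - I k\<bar> \<le> C + e"
    by blast
  have close: "\<bar>I k / k - I j / j\<bar> \<le> 2 * C / k + 2 * C / j" if "0 < k" "0 < j" for k j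
  proof -
    have *: "\<bar>I k / k - I j / j\<bar> \<le> (C + e) / k + (C + e) / j" if "0 < e" for e
    proof -
      have "\<exists>n. \<bar>k * (a n \<omega>0 / n) - I k\<bar> \<le> C + e \<and> \<bar>j * (a n \<omega>0 / n) - I j\<bar> \<le> C + e"
        using eventually_happens[OF eventually_conj[OF \<omega>0[OF that, of k] \<omega>0[OF that, of j]]] by simp
      then obtain n where n: "\<bar>k * (a n \<omega>0 / n) - I k\<bar> \<le> C + e" "\<bar>j * (a n \<omega>0 / n) - I j\<bar> \<le> C + e" by auto
      have "\<bar>a n \<omega>0 / n - I i / i\<bar> \<le> (C + e) / i" if "0 < i" "\<bar>i * (a n \<omega>0 / n) - I i\<bar> \<le> C + e" for i :: nat
      proof -
        have "a n \<omega>0 / n - I i / i = (i * (a n \<omega>0 / n) - I i) / i" using that by (simp add: diff_divide_distrib)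
        then show ?thesis using that by (simp add: divide_right_mono)
      qed
      from this[OF \<open>0 < k\<close> n(1)] this[OF \<open>0 < j\<close> n(2)] show ?thesis by linarith
    qed
    have "\<bar>I k / k - I j / j\<bar> \<le> C / k + C / j"
    proof (rule field_le_epsilon)
      fix e :: real assume "0 < e"
      have "e/2 / k \<le> e/2" "e/2 / j \<le> e/2" using that \<open>0 < e\<close> by (auto simp: field_simps)
      with *[of "e/2"] \<open>0 < e\<close> show "\<bar>I k / k - I j / j\<bar> \<le> C / k + C / j + e"
        by (simp add: add_divide_distrib)
    qed
    moreover have "C / k \<le> 2 * C / k" "C / j \<le> 2 * C / j" using C0 by (auto simp: divide_right_mono)
    ultimately show ?thesis by linarith
  qed
  have "Cauchy (\<lambda>k. I (Suc k) / Suc k)"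
  proof (rule metric_CauchyI)
    fix e :: real assume "0 < e"
    obtain n0 :: nat where n0: "4 * C / e < n0" using reals_Archimedean2 by blast
    have "2 * C / Suc m < e / 2" if "m \<ge> n0" for m
    proof -
      have "4 * C / e < Suc m" using n0 that by linarith
      then show ?thesis using \<open>0 < e\<close> by (simp add: field_simps del: of_nat_Suc)
    qed
    note small = this
    have "dist (I (Suc m) / Suc m) (I (Suc n) / Suc n) < e" if "m \<ge> n0" "n \<ge> n0" for m n
      using close[of "Suc m" "Suc n"] small[OF that(1)] small[OF that(2)] unfolding dist_real_def by linarith
    then show "\<exists>M. \<forall>m\<ge>M. \<forall>n\<ge>M. dist (I (Suc m) / Suc m) (I (Suc n) / Suc n) < e" by blast
  qed
  then obtain c where c: "(\<lambda>k. I (Suc k) / Suc k) \<longlonglongrightarrow> c"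
    using Cauchy_convergent convergentD by blast
  then have c': "(\<lambda>k. I k / k) \<longlonglongrightarrow> c" by (rule LIMSEQ_imp_Suc)
  have ck: "\<bar>I k / k - c\<bar> \<le> 2 * C / k" if "0 < k" for k
  proof (rule LIMSEQ_le)
    show "(\<lambda>j. \<bar>I k / k - I j / j\<bar>) \<longlonglongrightarrow> \<bar>I k / k - c\<bar>" by (intro tendsto_intros c')
    have "(\<lambda>j. 2 * C / k + 2 * C / real j) \<longlonglongrightarrow> 2 * C / k + 0"
      by (intro tendsto_add tendsto_const lim_const_over_n)
    then show "(\<lambda>j. 2 * C / k + 2 * C / real j) \<longlonglongrightarrow> 2 * C / k" by simp
    show "\<exists>N. \<forall>n\<ge>N. \<bar>I k / k - I n / n\<bar> \<le> 2 * C / k + 2 * C / n"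
      using close[OF that] by (intro exI[of _ 1]) auto
  qed
  show thesis
  proof
    show "\<bar>k * c - (\<integral>\<omega>. a k \<omega> \<partial>P)\<bar> \<le> 2 * C" for k :: nat
    proof (cases "k = 0")
      case True
      have "\<bar>a 0 \<omega>\<bar> \<le> C" if "\<omega> \<in> space P" for \<omega> using C[OF that, of 0 0] by simp
      then have "\<bar>I 0\<bar> \<le> C"
        unfolding I_def using C0
        by (intro order.trans[OF integral_abs_bound] integral_le_const integrable_const_bound[where B=C]) auto
      then show ?thesis using True C0 by (simp add: I_def)
    next
      case False
      have "k * c - I k = k * (c - I k / k)" using False by (simp add: algebra_simps)
      then have "\<bar>k * c - I k\<bar> = k * \<bar>I k / k - c\<bar>" by (simp add: abs_mult abs_minus_commute)
      also have "\<dots> \<le> k * (2 * C / k)" using ck[of k] False by (intro mult_left_mono) auto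
      finally show ?thesis using False by (simp add: I_def)
    qed
    show "AE \<omega> in P. (\<lambda>n. a n \<omega> / n) \<longlonglongrightarrow> c"
      using main
    proof eventually_elim
      case (elim \<omega>)
      show ?case
      proof (rule tendstoI)
        fix e :: real assume "0 < e"
        \<comment> \<open>The tolerance in \<open>main\<close> can stay at 1, because the whole
          error C + 1 gets divided by k, which is chosen large here.\<close>
        obtain k :: nat where k: "6 * (C + 1) / e < k" using reals_Archimedean2 by blast
        have "0 \<le> 6 * (C + 1) / e" using C0 \<open>0 < e\<close> by simp
        then have k0: "0 < k" using k by linarith
        have *: "(C + 1) / k < e / 6" "2 * C / k \<le> e / 3"
          using k k0 C0 \<open>0 < e\<close> by (auto simp: field_simps)
        have "\<forall>\<^sub>F n in sequentially. \<bar>k * (a n \<omega> / n) - I k\<bar> \<le> C + 1" using elim by simp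
        then show "\<forall>\<^sub>F n in sequentially. dist (a n \<omega> / n) c < e"
        proof eventually_elim
          case (elim n)
          have "a n \<omega> / n - I k / k = (k * (a n \<omega> / n) - I k) / k" using k0 by (simp add: diff_divide_distrib)
          then have "\<bar>a n \<omega> / n - I k / k\<bar> \<le> (C + 1) / k" using elim k0 by (simp add: divide_right_mono)
          with ck[OF k0] * show ?case unfolding dist_real_def by linarith
        qed
      qed
    qed
  qed
qed

end

section \<open>Comparison of measures\<close>

lemma nn_integral_le_scaled:
  assumes "finite_measure \<mu>" "finite_measure \<nu>" and sets: "sets \<mu> = sets \<nu>" and c: "0 \<le> c"
    and le: "\<And>A. A \<in> sets \<nu> \<Longrightarrow> measure \<mu> A \<le> c * measure \<nu> A"
    and f: "f \<in> borel_measurable \<nu>"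
  shows "(\<integral>\<^sup>+x. f x \<partial>\<mu>) \<le> ennreal c * (\<integral>\<^sup>+x. f x \<partial>\<nu>)"
proof -
  interpret \<mu>: finite_measure \<mu> by fact
  interpret \<nu>: finite_measure \<nu> by fact
  have "\<mu> \<le> scale_measure (ennreal c) \<nu>"
    using le c sets by (simp add: le_measure \<mu>.emeasure_eq_measure \<nu>.emeasure_eq_measure ennreal_mult'[symmetric] ennreal_leI)
  then have "(\<integral>\<^sup>+x. f x \<partial>\<mu>) \<le> (\<integral>\<^sup>+x. f x \<partial>(scale_measure (ennreal c) \<nu>))"
    using sets by (intro nn_integral_mono_measure) auto
  then show ?thesis using f by (simp add: nn_integral_scale_measure)
qed

lemma nn_integral_ge_scaled:
  assumes "finite_measure \<mu>" "finite_measure \<nu>" and sets: "sets \<mu> = sets \<nu>" and c: "0 \<le> c"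
    and le: "\<And>A. A \<in> sets \<nu> \<Longrightarrow> c * measure \<nu> A \<le> measure \<mu> A"
    and f: "f \<in> borel_measurable \<nu>"
  shows "ennreal c * (\<integral>\<^sup>+x. f x \<partial>\<nu>) \<le> (\<integral>\<^sup>+x. f x \<partial>\<mu>)"
proof -
  interpret \<mu>: finite_measure \<mu> by fact
  interpret \<nu>: finite_measure \<nu> by fact
  have "scale_measure (ennreal c) \<nu> \<le> \<mu>"
    using le c sets by (simp add: le_measure \<mu>.emeasure_eq_measure \<nu>.emeasure_eq_measure ennreal_mult'[symmetric] ennreal_leI)
  then have "(\<integral>\<^sup>+x. f x \<partial>(scale_measure (ennreal c) \<nu>)) \<le> (\<integral>\<^sup>+x. f x \<partial>\<mu>)"
    using sets by (intro nn_integral_mono_measure) auto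
  then show ?thesis using f by (simp add: nn_integral_scale_measure)
qed

text \<open>The set where \<open>f\<close> is smaller than \<open>g\<close> is itself a test set. On
  it the integral of the difference is 0, where finiteness of the integral of \<open>f\<close>
  legitimates the subtraction in \<open>ennreal\<close>.\<close>

lemma AE_le_of_set_nn_integral_le:
  fixes f g :: "'a \<Rightarrow> ennreal"
  assumes [measurable]: "f \<in> borel_measurable N" "g \<in> borel_measurable N"
    and fin: "(\<integral>\<^sup>+x. f x \<partial>N) < \<infinity>"
    and le: "\<And>A. A \<in> sets N \<Longrightarrow> (\<integral>\<^sup>+x. g x * indicator A x \<partial>N) \<le> (\<integral>\<^sup>+x. f x * indicator A x \<partial>N)"
  shows "AE x in N. g x \<le> f x"
proof -
  define A where "A = {x \<in> space N. f x < g x}"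
  have A[measurable]: "A \<in> sets N" unfolding A_def by measurable
  have "(\<integral>\<^sup>+x. f x * indicator A x \<partial>N) \<le> (\<integral>\<^sup>+x. f x \<partial>N)"
    by (intro nn_integral_mono) (auto split: split_indicator)
  then have finA: "(\<integral>\<^sup>+x. f x * indicator A x \<partial>N) < \<infinity>" using fin by (rule le_less_trans)
  have "(\<integral>\<^sup>+x. g x * indicator A x - f x * indicator A x \<partial>N)
      = (\<integral>\<^sup>+x. g x * indicator A x \<partial>N) - (\<integral>\<^sup>+x. f x * indicator A x \<partial>N)"
    using finA by (intro nn_integral_diff) (auto simp: A_def split: split_indicator)
  also have "\<dots> = 0" using le[OF A] finA by (simp add: diff_eq_0_iff_ennreal less_top)
  finally have "AE x in N. g x * indicator A x - f x * indicator A x = 0"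
    by (subst (asm) nn_integral_0_iff_AE) auto
  with AE_space show ?thesis
  proof eventually_elim
    case (elim x)
    show ?case
    proof (rule ccontr)
      assume "\<not> g x \<le> f x"
      then have "x \<in> A" "f x < g x" using elim by (auto simp: A_def)
      then show False using elim(2) by (auto simp: diff_eq_0_iff_ennreal split: split_indicator_asm)
    qed
  qed
qed

text \<open>One coordinate is split off at a time by Tonelli's theorem, and each costs a factor
  \<open>c\<close>.\<close>

lemma nn_integral_PiM_le_scaled:
  assumes "prob_space \<mu>" "prob_space \<nu>" and sets: "sets \<mu> = sets \<nu>" and c: "0 \<le> c"
    and le: "\<And>A. A \<in> sets \<nu> \<Longrightarrow> measure \<mu> A \<le> c * measure \<nu> A"
    and I: "finite I" and f: "f \<in> borel_measurable (PiM I (\<lambda>_. \<nu>))"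
  shows "(\<integral>\<^sup>+x. f x \<partial>(PiM I (\<lambda>_. \<mu>))) \<le> ennreal (c ^ card I) * (\<integral>\<^sup>+x. f x \<partial>(PiM I (\<lambda>_. \<nu>)))"
  using I f
proof (induction I arbitrary: f)
  case empty
  then show ?case by (simp add: PiM_empty nn_integral_count_space_finite)
next
  case (insert i I)
  interpret \<mu>: prob_space \<mu> by fact
  interpret \<nu>: prob_space \<nu> by fact
  interpret M: product_sigma_finite "\<lambda>_. \<mu>" by standard
  interpret N: product_sigma_finite "\<lambda>_. \<nu>" by standard
  note [measurable_cong] = sets
  have f[measurable]: "f \<in> borel_measurable (PiM (insert i I) (\<lambda>_. \<nu>))" by fact
  have f': "f \<in> borel_measurable (PiM (insert i I) (\<lambda>_. \<mu>))" by measurable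
  have [measurable]: "(\<lambda>x. \<integral>\<^sup>+y. f (x(i := y)) \<partial>\<nu>) \<in> borel_measurable (PiM I (\<lambda>_. \<nu>))"
    by measurable
  have "(\<integral>\<^sup>+x. f x \<partial>(PiM (insert i I) (\<lambda>_. \<mu>))) = (\<integral>\<^sup>+x. \<integral>\<^sup>+y. f (x(i := y)) \<partial>\<mu> \<partial>(PiM I (\<lambda>_. \<mu>)))"
    using insert f' by (intro M.product_nn_integral_insert) auto
  also have "\<dots> \<le> (\<integral>\<^sup>+x. ennreal c * (\<integral>\<^sup>+y. f (x(i := y)) \<partial>\<nu>) \<partial>(PiM I (\<lambda>_. \<mu>)))"
  proof (rule nn_integral_mono)
    fix x assume "x \<in> space (PiM I (\<lambda>_. \<mu>))"
    then have [measurable]: "x \<in> space (PiM I (\<lambda>_. \<nu>))"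
      unfolding space_PiM sets_eq_imp_space_eq[OF sets] .
    have "(\<lambda>y. f (x(i := y))) \<in> borel_measurable \<nu>" by measurable
    then show "(\<integral>\<^sup>+y. f (x(i := y)) \<partial>\<mu>) \<le> ennreal c * (\<integral>\<^sup>+y. f (x(i := y)) \<partial>\<nu>)"
      by (intro nn_integral_le_scaled \<mu>.finite_measure_axioms \<nu>.finite_measure_axioms sets c le)
  qed
  also have "\<dots> \<le> ennreal (c ^ card I) * (\<integral>\<^sup>+x. ennreal c * (\<integral>\<^sup>+y. f (x(i := y)) \<partial>\<nu>) \<partial>(PiM I (\<lambda>_. \<nu>)))"
    by (rule insert.IH) measurable
  also have "\<dots> = ennreal (c ^ card (insert i I)) * (\<integral>\<^sup>+x. \<integral>\<^sup>+y. f (x(i := y)) \<partial>\<nu> \<partial>(PiM I (\<lambda>_. \<nu>)))"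
    using insert.hyps c by (simp add: nn_integral_cmult ennreal_mult mult_ac)
  also have "(\<integral>\<^sup>+x. \<integral>\<^sup>+y. f (x(i := y)) \<partial>\<nu> \<partial>(PiM I (\<lambda>_. \<nu>))) = (\<integral>\<^sup>+x. f x \<partial>(PiM (insert i I) (\<lambda>_. \<nu>)))"
    using insert f by (intro N.product_nn_integral_insert[symmetric]) auto
  finally show ?case .
qed

text \<open>This is the upper bound with the two measures exchanged and the constant
  \<open>1 / c\<close>.\<close>

lemma nn_integral_PiM_ge_scaled:
  assumes "prob_space \<mu>" "prob_space \<nu>" and sets: "sets \<mu> = sets \<nu>" and c: "0 < c"
    and le: "\<And>A. A \<in> sets \<nu> \<Longrightarrow> c * measure \<nu> A \<le> measure \<mu> A"
    and I: "finite I" and f: "f \<in> borel_measurable (PiM I (\<lambda>_. \<nu>))"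
  shows "ennreal (c ^ card I) * (\<integral>\<^sup>+x. f x \<partial>(PiM I (\<lambda>_. \<nu>))) \<le> (\<integral>\<^sup>+x. f x \<partial>(PiM I (\<lambda>_. \<mu>)))"
proof -
  have "sets (PiM I (\<lambda>_. \<nu>)) = sets (PiM I (\<lambda>_. \<mu>))" using sets by (intro sets_PiM_cong) auto
  then have f': "f \<in> borel_measurable (PiM I (\<lambda>_. \<mu>))" using f by (simp cong: measurable_cong_sets)
  have "(\<integral>\<^sup>+x. f x \<partial>(PiM I (\<lambda>_. \<nu>))) \<le> ennreal ((1 / c) ^ card I) * (\<integral>\<^sup>+x. f x \<partial>(PiM I (\<lambda>_. \<mu>)))"
    using assms f' by (intro nn_integral_PiM_le_scaled) (auto simp: field_simps)
  then have "ennreal (c ^ card I) * (\<integral>\<^sup>+x. f x \<partial>(PiM I (\<lambda>_. \<nu>)))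
      \<le> ennreal (c ^ card I) * (ennreal ((1 / c) ^ card I) * (\<integral>\<^sup>+x. f x \<partial>(PiM I (\<lambda>_. \<mu>))))"
    by (rule mult_left_mono) simp
  also have "\<dots> = (\<integral>\<^sup>+x. f x \<partial>(PiM I (\<lambda>_. \<mu>)))"
    using c by (simp add: mult.assoc[symmetric] ennreal_mult'[symmetric] power_mult_distrib[symmetric])
  finally show ?thesis .
qed

section \<open>Integrals over kernels and paths\<close>

text \<open>Both claims go through one induction over \<open>f\<close>, because the sum and limit
  steps of the formula rest on measurability of the inner integral. The kernels may have any
  mass.\<close>

lemma nn_integral_kernel_left_measurable:
  assumes K: "\<And>x. x \<in> space \<mu> \<Longrightarrow> sets (K x) = sets \<mu>"
    and meas: "\<And>A. A \<in> sets \<mu> \<Longrightarrow> (\<lambda>x. emeasure (K x) A) \<in> borel_measurable \<mu>"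
    and f: "f \<in> borel_measurable \<mu>"
  shows "(\<lambda>x. \<integral>\<^sup>+y. f y \<partial>(K x)) \<in> borel_measurable \<mu> \<and>
    (\<integral>\<^sup>+y. f y \<partial>(kernel_left \<mu> K)) = (\<integral>\<^sup>+x. \<integral>\<^sup>+y. f y \<partial>(K x) \<partial>\<mu>)"
proof -
  have sets[measurable_cong]: "sets (kernel_left \<mu> K) = sets \<mu>" by (simp add: kernel_left_def)
  have space: "x \<in> space \<mu> \<Longrightarrow> space (K x) = space \<mu>" for x using sets_eq_imp_space_eq[OF K] .
  have spaceL: "space (kernel_left \<mu> K) = space \<mu>" using sets by (rule sets_eq_imp_space_eq)
  have Km: "x \<in> space \<mu> \<Longrightarrow> u \<in> borel_measurable \<mu> \<Longrightarrow> u \<in> borel_measurable (K x)" for x and u :: "_ \<Rightarrow> ennreal"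
    using K by (simp cong: measurable_cong_sets)
  show ?thesis using f
  proof induction
    case (cong f g)
    have "(\<integral>\<^sup>+y. f y \<partial>(K x)) = (\<integral>\<^sup>+y. g y \<partial>(K x))" if "x \<in> space \<mu>" for x
      using cong(3) that by (intro nn_integral_cong) (simp add: space)
    moreover have "(\<integral>\<^sup>+y. f y \<partial>(kernel_left \<mu> K)) = (\<integral>\<^sup>+y. g y \<partial>(kernel_left \<mu> K))"
      using cong(3) by (intro nn_integral_cong) (simp add: spaceL)
    ultimately show ?case using cong(4)
      by (simp cong: measurable_cong nn_integral_cong)
  next
    case (set A)
    then have "(\<integral>\<^sup>+y. indicator A y \<partial>(K x)) = emeasure (K x) A" if "x \<in> space \<mu>" for x
      using K that by simp
    then show ?case using set meas emeasure_kernel_left[OF K meas set]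
      by (simp add: sets cong: measurable_cong nn_integral_cong)
  next
    case (mult u c)
    have "(\<integral>\<^sup>+y. c * u y \<partial>(K x)) = c * (\<integral>\<^sup>+y. u y \<partial>(K x))" if "x \<in> space \<mu>" for x
      by (intro nn_integral_cmult Km[OF that]) fact
    moreover have "(\<integral>\<^sup>+y. c * u y \<partial>(kernel_left \<mu> K)) = c * (\<integral>\<^sup>+y. u y \<partial>(kernel_left \<mu> K))"
      by (intro nn_integral_cmult) (use mult(2) in measurable)
    moreover have [measurable]: "(\<lambda>x. \<integral>\<^sup>+y. u y \<partial>(K x)) \<in> borel_measurable \<mu>" using mult(4) by simp
    ultimately show ?case using mult(4)
      by (simp add: nn_integral_cmult cong: measurable_cong nn_integral_cong)
  next
    case (add u v)
    have [measurable]: "u \<in> borel_measurable \<mu>" "v \<in> borel_measurable \<mu>" by fact+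
    have "(\<integral>\<^sup>+y. v y + u y \<partial>(K x)) = (\<integral>\<^sup>+y. v y \<partial>(K x)) + (\<integral>\<^sup>+y. u y \<partial>(K x))" if "x \<in> space \<mu>" for x
      by (intro nn_integral_add Km[OF that]) fact+
    moreover have "(\<integral>\<^sup>+y. v y + u y \<partial>(kernel_left \<mu> K)) = (\<integral>\<^sup>+y. v y \<partial>(kernel_left \<mu> K)) + (\<integral>\<^sup>+y. u y \<partial>(kernel_left \<mu> K))"
      by (intro nn_integral_add) measurable
    moreover have [measurable]: "(\<lambda>x. \<integral>\<^sup>+y. u y \<partial>(K x)) \<in> borel_measurable \<mu>"
      "(\<lambda>x. \<integral>\<^sup>+y. v y \<partial>(K x)) \<in> borel_measurable \<mu>" using add.IH by simp_all
    ultimately show ?case using add.IH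
      by (simp add: nn_integral_add cong: measurable_cong nn_integral_cong)
  next
    case (seq U)
    have 1: "(\<integral>\<^sup>+y. (SUP i. U i) y \<partial>(K x)) = (SUP i. \<integral>\<^sup>+y. U i y \<partial>(K x))" if "x \<in> space \<mu>" for x
      unfolding SUP_apply by (intro nn_integral_monotone_convergence_SUP Km[OF that] seq)
    have 2: "(\<integral>\<^sup>+y. (SUP i. U i) y \<partial>(kernel_left \<mu> K)) = (SUP i. \<integral>\<^sup>+y. U i y \<partial>(kernel_left \<mu> K))"
      unfolding SUP_apply by (intro nn_integral_monotone_convergence_SUP seq) (use seq(1) in measurable)
    have 3: "(\<integral>\<^sup>+x. (SUP i. \<integral>\<^sup>+y. U i y \<partial>(K x)) \<partial>\<mu>) = (SUP i. \<integral>\<^sup>+x. \<integral>\<^sup>+y. U i y \<partial>(K x) \<partial>\<mu>)"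
      using seq.IH \<open>incseq U\<close>
      by (intro nn_integral_monotone_convergence_SUP)
        (auto simp: incseq_def le_fun_def intro!: nn_integral_mono)
    have "(\<lambda>x. SUP i. \<integral>\<^sup>+y. U i y \<partial>(K x)) \<in> borel_measurable \<mu>"
      using seq.IH by (intro borel_measurable_SUP) auto
    then show ?case using seq.IH 1 2 3
      by (simp cong: measurable_cong nn_integral_cong)
  qed
qed

lemmas nn_integral_kernel_left = nn_integral_kernel_left_measurable[THEN conjunct2]

text \<open>The expectation of the product of \<open>F\<close> over the next n transitions of the
  chain that is in \<open>x\<close> at time p, obtained by conditioning on the first of them. It
  replaces integrals over path space by iterated kernel integrals; the argument p is there because
  the chain is inhomogeneous in time.\<close>

primrec path_integral ::
  "(nat \<Rightarrow> 'a \<Rightarrow> 'a measure) \<Rightarrow> (nat \<Rightarrow> 'a \<Rightarrow> 'a \<Rightarrow> ennreal) \<Rightarrow> nat \<Rightarrow> nat \<Rightarrow> 'a \<Rightarrow> ennreal" where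
  "path_integral K F 0 p x = 1"
| "path_integral K F (Suc n) p x = (\<integral>\<^sup>+y. F p x y * path_integral K F n (Suc p) y \<partial>(K p x))"

lemma measurable_path_integral:
  assumes K[measurable]: "\<And>p. K p \<in> measurable S (prob_algebra S)"
    and F[measurable]: "\<And>p. (\<lambda>(x, y). F p x y) \<in> borel_measurable (S \<Otimes>\<^sub>M S)"
  shows "path_integral K F n p \<in> borel_measurable S"
proof (induction n arbitrary: p)
  case 0
  show ?case by (simp add: path_integral.simps(1)[abs_def])
next
  case (Suc n)
  note [measurable] = Suc
  show ?case unfolding path_integral.simps(2)[abs_def]
    by (rule nn_integral_measurable_subprob_algebra2[where N=S, OF _ measurable_prob_algebraD[OF K]]) measurable
qed

lemma nn_integral_markov_law:
  assumes \<mu>0: "\<mu>0 \<in> space (prob_algebra S)"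
    and K: "\<And>p. K p \<in> measurable S (prob_algebra S)"
    and F[measurable]: "\<And>p. (\<lambda>(x, y). F p x y) \<in> borel_measurable (S \<Otimes>\<^sub>M S)"
  shows "(\<integral>\<^sup>+\<zeta>. (\<Prod>p<n. F p (\<zeta> p) (\<zeta> (Suc p))) \<partial>(markov_law S \<mu>0 K)) = (\<integral>\<^sup>+x. path_integral K F n 0 x \<partial>\<mu>0)"
proof -
  interpret IT: Ionescu_Tulcea "chain_kernel \<mu>0 K" "\<lambda>_. S"
    using \<mu>0 K by (rule Ionescu_Tulcea_chain_kernel)
  have Ks: "K p \<in> measurable S (subprob_algebra S)" for p using K by (rule measurable_prob_algebraD)
  let ?u = "\<lambda>_::nat. undefined :: 'a"
  let ?F = "\<lambda>n \<zeta>. \<Prod>p<n. F p (\<zeta> p) (\<zeta> (Suc p))"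
  have Fm[measurable]: "?F n \<in> borel_measurable (PiM {0..<Suc n} (\<lambda>_. S))" for n
  proof (rule borel_measurable_prod_ennreal)
    fix p assume "p \<in> {..<n}"
    then have [measurable]: "p \<in> {0..<Suc n}" "Suc p \<in> {0..<Suc n}" by auto
    show "(\<lambda>\<zeta>. F p (\<zeta> p) (\<zeta> (Suc p))) \<in> borel_measurable (PiM {0..<Suc n} (\<lambda>_. S))"
      using F[of p] by measurable
  qed
  have nn_Suc: "(\<integral>\<^sup>+\<zeta>. f \<zeta> \<partial>(IT.C 0 (Suc n) ?u)) = (\<integral>\<^sup>+\<zeta>. \<integral>\<^sup>+x. f (\<zeta>(n := x)) \<partial>(chain_kernel \<mu>0 K n \<zeta>) \<partial>(IT.C 0 n ?u))"
    if [measurable]: "f \<in> borel_measurable (PiM {0..<Suc n} (\<lambda>_. S))" for f n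
  proof -
    have s: "sets (IT.C 0 n ?u) = sets (PiM {0..<n} (\<lambda>_. S))" by (subst IT.sets_C) auto
    have "(\<integral>\<^sup>+\<zeta>. f \<zeta> \<partial>(IT.C 0 (Suc n) ?u)) = (\<integral>\<^sup>+\<zeta>. \<integral>\<^sup>+x. f x \<partial>(IT.eP n \<zeta>) \<partial>(IT.C 0 n ?u))"
      using IT.measurable_eP[of n] s by (simp add: nn_integral_bind[where B="PiM {0..<Suc n} (\<lambda>_. S)"] cong: measurable_cong_sets)
    also have "\<dots> = (\<integral>\<^sup>+\<zeta>. \<integral>\<^sup>+x. f (\<zeta>(n := x)) \<partial>(chain_kernel \<mu>0 K n \<zeta>) \<partial>(IT.C 0 n ?u))"
      by (intro nn_integral_cong IT.nn_integral_eP that) (use sets_eq_imp_space_eq[OF s] in auto)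
    finally show ?thesis .
  qed
  \<comment> \<open>The claim proved inside is stronger: m further steps are already integrated out
    into \<open>path_integral K F m n\<close>, so that induction on n can strip off the last
    coordinate. At m = 0 this extra factor is 1.\<close>
  have D: "(\<integral>\<^sup>+\<zeta>. ?F n \<zeta> * g (\<zeta> n) \<partial>(IT.C 0 (Suc n) ?u)) = (\<integral>\<^sup>+x. path_integral K F n 0 x \<partial>\<mu>0)"
    if "g = path_integral K F 0 n" for g n
  proof -
    have "(\<integral>\<^sup>+\<zeta>. ?F n \<zeta> * path_integral K F m n (\<zeta> n) \<partial>(IT.C 0 (Suc n) ?u))
        = (\<integral>\<^sup>+x. path_integral K F (n + m) 0 x \<partial>\<mu>0)" for m n
    proof (induction n arbitrary: m)
      case 0
      note [measurable] = measurable_path_integral[OF K F]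
      have "(\<integral>\<^sup>+\<zeta>. ?F 0 \<zeta> * path_integral K F m 0 (\<zeta> 0) \<partial>(IT.C 0 (Suc 0) ?u))
          = (\<integral>\<^sup>+\<zeta>. \<integral>\<^sup>+x. path_integral K F m 0 x \<partial>\<mu>0 \<partial>(IT.C 0 0 ?u))"
        by (subst nn_Suc) (auto simp: chain_kernel_def)
      also have "\<dots> = (\<integral>\<^sup>+x. path_integral K F m 0 x \<partial>\<mu>0)"
        by (simp add: nn_integral_return emeasure_return)
      finally show ?case by simp
    next
      case (Suc n)
      note [measurable] = measurable_path_integral[OF K F]
      have sC: "sets (IT.C 0 (Suc n) ?u) = sets (PiM {0..<Suc n} (\<lambda>_. S))" by (subst IT.sets_C) auto
      have "(\<integral>\<^sup>+\<zeta>. ?F (Suc n) \<zeta> * path_integral K F m (Suc n) (\<zeta> (Suc n)) \<partial>(IT.C 0 (Suc (Suc n)) ?u))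
          = (\<integral>\<^sup>+\<zeta>. \<integral>\<^sup>+x. ?F (Suc n) (\<zeta>(Suc n := x)) * path_integral K F m (Suc n) x \<partial>(K n (\<zeta> n)) \<partial>(IT.C 0 (Suc n) ?u))"
        by (subst nn_Suc) (auto simp: chain_kernel_def)
      also have "\<dots> = (\<integral>\<^sup>+\<zeta>. ?F n \<zeta> * path_integral K F (Suc m) n (\<zeta> n) \<partial>(IT.C 0 (Suc n) ?u))"
      proof (rule nn_integral_cong)
        fix \<zeta> assume "\<zeta> \<in> space (IT.C 0 (Suc n) ?u)"
        then have \<zeta>: "\<zeta> n \<in> space S" using sets_eq_imp_space_eq[OF sC] by (auto simp: space_PiM PiE_iff)
        have [measurable]: "F n (\<zeta> n) \<in> borel_measurable S"
          using measurable_compose[OF measurable_Pair1'[OF \<zeta>] F[of n]] by simp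
        have [measurable_cong]: "sets (K n (\<zeta> n)) = sets S"
          using subprob_measurableD(2)[OF Ks \<zeta>] .
        have "(\<integral>\<^sup>+x. ?F (Suc n) (\<zeta>(Suc n := x)) * path_integral K F m (Suc n) x \<partial>(K n (\<zeta> n)))
            = (\<integral>\<^sup>+x. ?F n \<zeta> * (F n (\<zeta> n) x * path_integral K F m (Suc n) x) \<partial>(K n (\<zeta> n)))"
          by (intro nn_integral_cong) (simp add: mult_ac)
        also have "\<dots> = ?F n \<zeta> * path_integral K F (Suc m) n (\<zeta> n)"
          by (simp add: nn_integral_cmult)
        finally show "(\<integral>\<^sup>+x. ?F (Suc n) (\<zeta>(Suc n := x)) * path_integral K F m (Suc n) x \<partial>(K n (\<zeta> n)))
            = ?F n \<zeta> * path_integral K F (Suc m) n (\<zeta> n)" .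
      qed
      also have "\<dots> = (\<integral>\<^sup>+x. path_integral K F (n + Suc m) 0 x \<partial>\<mu>0)" by (rule Suc)
      finally show ?case by (simp del: path_integral.simps)
    qed
    from this[where n=n and m=0] that show ?thesis by simp
  qed
  \<comment> \<open>The product reads the coordinates 0 to n only, and on these the projective limit
    has the law built from the initial law and n transitions.\<close>
  have CI: "IT.CI {0..<Suc n} = IT.C 0 (Suc n) ?u"
  proof (rule measure_eqI)
    have *: "sets (IT.C 0 (Suc n) ?u) = sets (PiM {0..<Suc n} (\<lambda>_. S))" by (subst IT.sets_C) auto
    show "sets (IT.CI {0..<Suc n}) = sets (IT.C 0 (Suc n) ?u)" unfolding * by (simp add: IT.CI_def)
    fix A assume "A \<in> sets (IT.CI {0..<Suc n})"
    then show "emeasure (IT.CI {0..<Suc n}) A = emeasure (IT.C 0 (Suc n) ?u) A"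
      by (subst IT.emeasure_CI[where n="Suc n"]) (auto simp: IT.CI_def prod_emb_id sets.sets_into_space space_PiM[symmetric])
  qed
  have "(\<integral>\<^sup>+\<zeta>. ?F n \<zeta> \<partial>(markov_law S \<mu>0 K)) = (\<integral>\<^sup>+\<zeta>. ?F n (restrict \<zeta> {0..<Suc n}) \<partial>IT.PF.lim)"
    unfolding markov_law_def by (intro nn_integral_cong prod.cong) auto
  also have "\<dots> = (\<integral>\<^sup>+\<zeta>. ?F n \<zeta> \<partial>(distr IT.PF.lim (PiM {0..<Suc n} (\<lambda>_. S)) (\<lambda>x. restrict x {0..<Suc n})))"
    by (rule nn_integral_distr[symmetric]) 
      (simp_all only: measurable_cong_sets[OF IT.PF.sets_lim refl] measurable_restrict_subset subset_UNIV
        measurable_distr_eq1 Fm)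
  also have "\<dots> = (\<integral>\<^sup>+\<zeta>. ?F n \<zeta> \<partial>(IT.C 0 (Suc n) ?u))"
    by (subst IT.distr_lim) (simp_all only: CI finite_atLeastLessThan)
  finally show ?thesis using D[OF refl, of n] by simp
qed

section \<open>An entropy inequality\<close>

text \<open>The quantity 1 / t - 1 + ln t is the gap in the inequality ln t >= 1 - 1 / t and
  vanishes only at t = 1. Integrated against the measure whose density is t it is at most the
  relative entropy. Truncation at 1 makes it bounded, hence always integrable; the value for
  nonpositive t is taken on a null set of that measure.\<close>

definition entropy_defect :: "real \<Rightarrow> real" where
  "entropy_defect t = (if t \<le> 0 then 0 else min 1 (1 / t - 1 + ln t))"

lemma entropy_defect_range: "0 \<le> entropy_defect t" "entropy_defect t \<le> 1"
proof -
  have "1 - 1 / t \<le> ln t" if "0 < t"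
    using ln_le_minus_one[of "1 / t"] that by (simp add: ln_div)
  then show "0 \<le> entropy_defect t" "entropy_defect t \<le> 1" by (auto simp: entropy_defect_def)
qed

lemma entropy_defect_eq_0: assumes "0 < t" "entropy_defect t = 0" shows "t = 1"
proof -
  have "ln (1 / t) = 1 / t - 1"
    using assms by (auto simp: entropy_defect_def ln_div min_def split: if_splits)
  then have "1 / t = 1" using assms by (intro ln_eq_minus_one) auto
  then show ?thesis by simp
qed

lemma measurable_entropy_defect[measurable]: "entropy_defect \<in> borel_measurable borel"
  unfolding entropy_defect_def[abs_def] by measurable

text \<open>Total mass 1 makes \<open>f\<close> finite almost everywhere, and the zeros of
  \<open>f\<close> have no mass under the density, so \<open>enn2real\<close> loses nothing
  there.\<close>

lemma AE_density_pos_finite: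
  assumes f[measurable]: "f \<in> borel_measurable K" and "prob_space (density K f)"
  shows "AE x in density K f. 0 < enn2real (f x) \<and> f x = ennreal (enn2real (f x))"
proof -
  interpret B: prob_space "density K f" by fact
  have "(\<integral>\<^sup>+x. f x \<partial>K) = 1"
    using B.emeasure_space_1 by (simp add: emeasure_density cong: nn_integral_cong)
  then have "AE x in K. f x \<noteq> \<infinity>" by (intro nn_integral_noteq_infinite) auto
  then show ?thesis
    by (auto simp: AE_density enn2real_positive_iff less_top)
qed

text \<open>The loss in Jensen's inequality for \<open>ln\<close> is bounded below through
  \<open>ln t = (1 / t - 1 + ln t) + 1 - 1 / t\<close>, in which \<open>1 / t\<close> has integral at most 1.\<close>

lemma nn_integral_square_density_ge:
  assumes f[measurable]: "f \<in> borel_measurable K" and w[measurable]: "w \<in> borel_measurable K"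
    and K: "prob_space K" and B: "prob_space (density K f)"
    and w1: "\<And>x. x \<in> space K \<Longrightarrow> 1 \<le> w x \<and> w x \<le> W"
  shows "ennreal (exp ((\<integral>x. entropy_defect (enn2real (f x)) \<partial>density K f) + (\<integral>x. ln (w x) \<partial>density K f)))
    \<le> (\<integral>\<^sup>+x. (f x)\<^sup>2 * ennreal (w x) \<partial>K)"
proof -
  interpret K: prob_space K by fact
  interpret B: prob_space "density K f" by fact
  define t where "t x = enn2real (f x)" for x
  have [measurable]: "t \<in> borel_measurable K" unfolding t_def by measurable
  have t: "AE x in density K f. 0 < t x \<and> f x = ennreal (t x)"
    unfolding t_def by (rule AE_density_pos_finite[OF f B])
  have "(\<integral>\<^sup>+x. ennreal (1 / t x) \<partial>density K f) = (\<integral>\<^sup>+x. f x * ennreal (1 / t x) \<partial>K)"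
    by (simp add: nn_integral_density)
  also have "\<dots> \<le> (\<integral>\<^sup>+x. 1 \<partial>K)"
  proof (rule nn_integral_mono)
    fix x
    show "f x * ennreal (1 / t x) \<le> 1"
    \<comment> \<open>If \<open>f x\<close> is 0 or infinite, then \<open>t x = 0\<close> and the
      totalised quotient \<open>1 / t x\<close> is 0, so the product is 0 instead of 1.\<close>
    proof (cases "f x")
      case (real r)
      then show ?thesis by (cases "r = 0") (auto simp: t_def ennreal_mult'[symmetric])
    qed (simp add: t_def)
  qed
  also have "\<dots> = 1" by (simp add: K.emeasure_space_1)
  finally have t1: "(\<integral>\<^sup>+x. ennreal (1 / t x) \<partial>density K f) \<le> 1" .
  have int_t: "integrable (density K f) (\<lambda>x. 1 / t x)"
    using t1 by (intro integrableI_nonneg) (auto simp: t_def intro: le_less_trans)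
  have t_le: "(\<integral>x. 1 / t x \<partial>density K f) \<le> 1"
    using t1 by (subst integral_eq_nn_integral) (auto simp: t_def intro!: enn2real_leI)
  have int_e: "integrable (density K f) (\<lambda>x. entropy_defect (t x))"
    using entropy_defect_range by (intro B.integrable_const_bound[where B=1]) auto
  have int_w: "integrable (density K f) (\<lambda>x. ln (w x))"
    using w1 by (intro B.integrable_const_bound[where B="ln W"]) (auto, force)
  define g where "g x = entropy_defect (t x) + 1 - 1 / t x + ln (w x)" for x
  have int_g: "integrable (density K f) g"
    unfolding g_def[abs_def] using int_t int_e int_w by simp
  define m where "m = (\<integral>x. g x \<partial>density K f)"
  have m_ge: "(\<integral>x. entropy_defect (t x) \<partial>density K f) + (\<integral>x. ln (w x) \<partial>density K f) \<le> m"
    unfolding m_def g_def using int_t int_e int_w t_le by (simp add: B.prob_space[simplified])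
  \<comment> \<open>Truncation only lowers the defect, so \<open>g\<close> is at most the logarithm
    of \<open>t * w\<close>.\<close>
  have g_le: "exp (g x) \<le> t x * w x" if "0 < t x" "x \<in> space K" for x
  proof -
    have "g x \<le> ln (t x) + ln (w x)" using that by (simp add: g_def entropy_defect_def)
    also have "\<dots> = ln (t x * w x)" using that w1[of x] by (simp add: ln_mult)
    finally have "exp (g x) \<le> exp (ln (t x * w x))" by simp
    also have "\<dots> = t x * w x" using that w1[of x] by (subst exp_ln) auto
    finally show ?thesis .
  qed
  have eq: "(\<integral>\<^sup>+x. (f x)\<^sup>2 * ennreal (w x) \<partial>K) = (\<integral>\<^sup>+x. f x * ennreal (w x) \<partial>density K f)"
    by (simp add: nn_integral_density power2_eq_square mult_ac)
  also have "\<dots> = (\<integral>\<^sup>+x. ennreal (t x * w x) \<partial>density K f)"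
    using t by (intro nn_integral_cong_AE, eventually_elim) (simp add: ennreal_mult')
  finally have eq: "(\<integral>\<^sup>+x. (f x)\<^sup>2 * ennreal (w x) \<partial>K) = (\<integral>\<^sup>+x. ennreal (t x * w x) \<partial>density K f)" .
  have "ennreal (exp m) \<le> (\<integral>\<^sup>+x. ennreal (t x * w x) \<partial>density K f)"
  proof (cases "(\<integral>\<^sup>+x. ennreal (t x * w x) \<partial>density K f) = \<infinity>")
    case False
    have nn: "x \<in> space K \<Longrightarrow> 0 \<le> t x * w x" for x using w1[of x] by (simp add: t_def)
    have int: "integrable (density K f) (\<lambda>x. t x * w x)"
      using False nn by (intro integrableI_nonneg) (auto simp: less_top intro!: AE_I2)
    \<comment> \<open>Jensen's inequality by the tangent to \<open>exp\<close> at the mean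
      \<open>m\<close> of \<open>g\<close>: the linear minorant integrates to exactly
      \<open>exp m\<close>.\<close>
    have "exp m = (\<integral>x. exp m * (1 + g x - m) \<partial>density K f)"
      using int_g by (simp add: B.prob_space[simplified] m_def[symmetric])
    also have "\<dots> \<le> (\<integral>x. t x * w x \<partial>density K f)"
    proof (rule integral_mono_AE)
      show "AE x in density K f. exp m * (1 + g x - m) \<le> t x * w x"
        using t AE_space
      proof eventually_elim
        case (elim x)
        have "exp m * (1 + (g x - m)) \<le> exp m * exp (g x - m)"
          by (intro mult_left_mono exp_ge_add_one_self) auto
        also have "\<dots> = exp (g x)" by (simp add: exp_add[symmetric])
        also have "\<dots> \<le> t x * w x" using elim by (intro g_le) auto
        finally show ?case by (simp add: algebra_simps)
      qed
    qed (use int_g int in auto)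
    finally have "ennreal (exp m) \<le> ennreal (\<integral>x. t x * w x \<partial>density K f)" by (rule ennreal_leI)
    also have "\<dots> = (\<integral>\<^sup>+x. ennreal (t x * w x) \<partial>density K f)"
      using int nn by (intro nn_integral_eq_integral[symmetric]) auto
    finally show ?thesis .
  qed simp
  moreover have "ennreal (exp ((\<integral>x. entropy_defect (t x) \<partial>density K f) + (\<integral>x. ln (w x) \<partial>density K f))) \<le> ennreal (exp m)"
    using m_ge by (intro ennreal_leI) simp
  ultimately show ?thesis unfolding eq t_def by (rule order.trans[rotated])
qed

text \<open>A vanishing defect forces the density to be 1 wherever it is positive. As it is then
  nowhere above 1 and still integrates to 1 over a probability measure, the value 0 is excluded
  too.\<close>

lemma density_eq_of_entropy_defect_0:
  assumes f[measurable]: "f \<in> borel_measurable K"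
    and K: "prob_space K" and B: "prob_space (density K f)"
    and 0: "(\<integral>x. entropy_defect (enn2real (f x)) \<partial>density K f) = 0"
  shows "density K f = K"
proof -
  interpret K: prob_space K by fact
  interpret B: prob_space "density K f" by fact
  have "integrable (density K f) (\<lambda>x. entropy_defect (enn2real (f x)))"
    using entropy_defect_range by (intro B.integrable_const_bound[where B=1]) auto
  with 0 have "AE x in density K f. entropy_defect (enn2real (f x)) = 0"
    by (subst (asm) integral_nonneg_eq_0_iff_AE) (auto simp: entropy_defect_range)
  with AE_density_pos_finite[OF f B] have "AE x in density K f. f x = 1"
  proof eventually_elim
    case (elim x)
    then have "enn2real (f x) = 1" by (intro entropy_defect_eq_0) auto
    with elim show ?case by simp
  qed
  then have AE1: "AE x in K. 0 < f x \<longrightarrow> f x = 1" by (simp add: AE_density)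
  have "(\<integral>\<^sup>+x. f x \<partial>K) = 1"
    using B.emeasure_space_1 by (simp add: emeasure_density cong: nn_integral_cong)
  have "AE x in K. f x \<le> 1"
    using AE1 by eventually_elim (auto simp: zero_less_iff_neq_zero)
  then have "(\<integral>\<^sup>+x. 1 - f x \<partial>K) = (\<integral>\<^sup>+x. 1 \<partial>K) - (\<integral>\<^sup>+x. f x \<partial>K)"
    using \<open>(\<integral>\<^sup>+x. f x \<partial>K) = 1\<close> by (intro nn_integral_diff) auto
  also have "\<dots> = 0" using \<open>(\<integral>\<^sup>+x. f x \<partial>K) = 1\<close> by (simp add: K.emeasure_space_1)
  finally have "AE x in K. 1 - f x = 0" by (subst (asm) nn_integral_0_iff_AE) auto
  with \<open>AE x in K. f x \<le> 1\<close> have "AE x in K. f x = 1"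
    by eventually_elim (auto simp: diff_eq_0_iff_ennreal)
  then have "density K f = density K (\<lambda>_. 1)" by (intro density_cong) auto
  then show ?thesis by (simp add: density_1)
qed

lemma AE_eq_1_of_density_eq:
  assumes f[measurable]: "f \<in> borel_measurable K" and K: "prob_space K" and eq: "density K f = K"
  shows "AE x in K. f x = 1"
proof -
  interpret K: prob_space K by fact
  have "density K f = density K (\<lambda>_. 1)" using eq by (simp add: density_1)
  then show ?thesis by (subst (asm) K.density_unique_iff) auto
qed

section \<open>The unnormalised semigroup\<close>

text \<open>Pushing \<open>L a\<close> forward to the product space along \<open>y\<close> to
  \<open>(a, y)\<close> moves the parameter from the integrand into the measure, so one fixed
  function is integrated against a measurable family.\<close>

lemma integral_measurable_kernel:
  fixes f :: "'a \<Rightarrow> 'b \<Rightarrow> real"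
  assumes f[measurable]: "(\<lambda>(a, y). f a y) \<in> borel_measurable (A \<Otimes>\<^sub>M N)"
    and L[measurable]: "L \<in> measurable A (subprob_algebra N)"
  shows "(\<lambda>a. \<integral>y. f a y \<partial>(L a)) \<in> borel_measurable A"
proof -
  note measurable_distr2[measurable]
  have "(\<lambda>a. integral\<^sup>L (distr (L a) (A \<Otimes>\<^sub>M N) (\<lambda>y. (a, y))) (\<lambda>(a, y). f a y)) \<in> borel_measurable A"
    by measurable
  then show ?thesis
  proof (rule measurable_cong[THEN iffD1, rotated])
    fix a assume a: "a \<in> space A"
    then have [measurable_cong]: "sets (L a) = sets N" using L by (rule subprob_measurableD(2)[rotated])
    show "integral\<^sup>L (distr (L a) (A \<Otimes>\<^sub>M N) (\<lambda>y. (a, y))) (\<lambda>(a, y). f a y) = (\<integral>y. f a y \<partial>(L a))"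
      using a by (subst integral_distr) auto
  qed
qed

lemma sets_kernel_left: "sets (kernel_left \<mu> K) = sets \<mu>"
  by (simp add: kernel_left_def)

lemma shift_pow_0[simp]: "shift_pow 0 \<omega> = \<omega>"
  by (simp add: shift_pow_def)

lemma shift_pow_seq_shift: "shift_pow k (seq_shift \<omega>) = shift_pow (1 + k) \<omega>"
  by (simp add: shift_pow_def seq_shift_def fun_eq_iff ac_simps)

lemma seq_shift_shift_pow: "seq_shift (shift_pow k \<omega>) = shift_pow (1 + k) \<omega>"
  by (simp add: shift_pow_def seq_shift_def fun_eq_iff ac_simps)

lemma shift_pow_shift_pow[simp]: "shift_pow k (shift_pow l \<omega>) = shift_pow (k + l) \<omega>"
  by (simp add: shift_pow_add)

text \<open>This is Q_n applied to the constant 1, expanded at the first step. \<open>Q_iter\<close>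
  grows at the last step instead; \<open>Q_iter_mass\<close> reconciles the two.\<close>

primrec mass ::
  "((int \<Rightarrow> 'y) \<Rightarrow> 'x \<Rightarrow> real) \<Rightarrow> ((int \<Rightarrow> 'y) \<Rightarrow> 'x \<Rightarrow> 'x measure) \<Rightarrow>
   nat \<Rightarrow> (int \<Rightarrow> 'y) \<Rightarrow> 'x \<Rightarrow> real" where
  "mass G M 0 \<omega> x = 1"
| "mass G M (Suc n) \<omega> x = G \<omega> x * (\<integral>y. mass G M n (seq_shift \<omega>) y \<partial>(M \<omega> x))"

locale feynman_kac = ergodic_system P seq_shift
  for P :: "(int \<Rightarrow> 'y) measure" +
  fixes X :: "'x measure" and Y :: "'y measure" and \<nu> :: "'x measure"
    and G :: "(int \<Rightarrow> 'y) \<Rightarrow> 'x \<Rightarrow> real" and M :: "(int \<Rightarrow> 'y) \<Rightarrow> 'x \<Rightarrow> 'x measure"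
    and \<beta> \<epsilon>m \<epsilon>p :: real
  assumes sets_P: "sets P = sets (PiM UNIV (\<lambda>_. Y))"
    and M_kernel: "random_markov_kernel P X M"
    and G_meas[measurable]: "(\<lambda>(\<omega>, x). G \<omega> x) \<in> borel_measurable (P \<Otimes>\<^sub>M X)"
    and G_pos: "\<And>\<omega> x. \<omega> \<in> space P \<Longrightarrow> x \<in> space X \<Longrightarrow> 0 < G \<omega> x"
    and G_ratio: "\<And>\<omega> \<omega>' x x'. \<omega> \<in> space P \<Longrightarrow> \<omega>' \<in> space P \<Longrightarrow> x \<in> space X \<Longrightarrow> x' \<in> space X
      \<Longrightarrow> G \<omega> x / G \<omega>' x' \<le> \<beta>"
    and beta: "1 \<le> \<beta>"
    and nu: "prob_space \<nu>" "sets \<nu> = sets X"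
    and eps_pos: "0 < \<epsilon>m" "0 < \<epsilon>p" and M_bound: "two_sided_bound P X M \<nu> \<epsilon>m \<epsilon>p"
begin

abbreviation "q \<equiv> mass G M"

text \<open>The Doeblin constant: by the two-sided bound, \<open>M \<omega> x\<close> is at least
  \<delta> times \<open>M \<omega> y\<close> for all points x and y.\<close>

definition "\<delta> = \<epsilon>m / \<epsilon>p"

text \<open>Bounds \<open>q n \<omega> x / q n \<omega> y\<close> uniformly in n: \<beta> compares
  the first potentials, the quotient compares the first kernels.\<close>

definition "R = \<beta> * (\<epsilon>p / \<epsilon>m)"

sublocale nu: prob_space \<nu> by (rule nu)

lemma measurable_shift_pow[measurable]: "shift_pow k \<in> measurable P P"
proof -
  have "shift_pow k \<in> measurable (PiM UNIV (\<lambda>_. Y)) (PiM UNIV (\<lambda>_. Y))"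
    unfolding shift_pow_def[abs_def] by (rule measurable_PiM_single') (auto simp: space_PiM PiE_iff)
  then show ?thesis using sets_P by (simp cong: measurable_cong_sets)
qed

lemma shift_pow_space: "\<omega> \<in> space P \<Longrightarrow> shift_pow k \<omega> \<in> space P"
  using measurable_space[OF measurable_shift_pow] .

lemma M_measurable[measurable]: "(\<lambda>(\<omega>, x). M \<omega> x) \<in> measurable (P \<Otimes>\<^sub>M X) (prob_algebra X)"
  using M_kernel by (simp add: random_markov_kernel_def)

lemma M_measurable_section: "\<omega> \<in> space P \<Longrightarrow> M \<omega> \<in> measurable X (prob_algebra X)"
  using measurable_compose[OF measurable_Pair1' M_measurable] by simp

lemma G_measurable_section: "\<omega> \<in> space P \<Longrightarrow> G \<omega> \<in> borel_measurable X"
  using measurable_compose[OF measurable_Pair1' G_meas] by simp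

lemma M_prob: "\<omega> \<in> space P \<Longrightarrow> x \<in> space X \<Longrightarrow> prob_space (M \<omega> x)"
  and M_sets: "\<omega> \<in> space P \<Longrightarrow> x \<in> space X \<Longrightarrow> sets (M \<omega> x) = sets X"
  using measurable_space[OF M_measurable_section] by (auto simp: space_prob_algebra)

lemma M_space: "\<omega> \<in> space P \<Longrightarrow> x \<in> space X \<Longrightarrow> space (M \<omega> x) = space X"
  by (rule sets_eq_imp_space_eq[OF M_sets])

lemma nu_space: "space \<nu> = space X"
  by (rule sets_eq_imp_space_eq[OF nu(2)])

lemma X_nonempty: "space X \<noteq> {}"
  using nu.not_empty nu_space by simp

lemma M_le: "\<omega> \<in> space P \<Longrightarrow> x \<in> space X \<Longrightarrow> A \<in> sets X \<Longrightarrow> measure (M \<omega> x) A \<le> \<epsilon>p * measure \<nu> A"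
  and M_ge: "\<omega> \<in> space P \<Longrightarrow> x \<in> space X \<Longrightarrow> A \<in> sets X \<Longrightarrow> \<epsilon>m * measure \<nu> A \<le> measure (M \<omega> x) A"
  using M_bound by (auto simp: two_sided_bound_def)

lemma eps_1: "\<epsilon>m \<le> 1" "1 \<le> \<epsilon>p"
proof -
  obtain \<omega> x where *: "\<omega> \<in> space P" "x \<in> space X" using not_empty X_nonempty by blast
  interpret Mx: prob_space "M \<omega> x" using * by (rule M_prob)
  show "\<epsilon>m \<le> 1" "1 \<le> \<epsilon>p"
    using M_le[OF * sets.top] M_ge[OF * sets.top] Mx.prob_space nu.prob_space
    by (simp_all add: M_space[OF *] nu_space)
qed

lemma delta: "0 < \<delta>" "\<delta> \<le> 1"
  using eps_pos eps_1 by (auto simp: \<delta>_def)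

lemma R_ge_1: "1 \<le> R"
proof -
  have "1 \<le> \<epsilon>p / \<epsilon>m" using eps_pos eps_1 by simp
  then show ?thesis unfolding R_def using beta mult_mono[of 1 \<beta> 1 "\<epsilon>p / \<epsilon>m"] by simp
qed

text \<open>The ratio bound is read against one reference value of \<open>G\<close>. Placing 1
  between the two bounds keeps their powers monotone.\<close>

lemma G_bounds: obtains g g' where "0 < g" "g \<le> 1" "1 \<le> g'"
  "\<And>\<omega> x. \<omega> \<in> space P \<Longrightarrow> x \<in> space X \<Longrightarrow> g \<le> G \<omega> x \<and> G \<omega> x \<le> g'"
proof -
  obtain \<omega>1 x1 where *: "\<omega>1 \<in> space P" "x1 \<in> space X" using not_empty X_nonempty by blast
  define a where "a = G \<omega>1 x1"
  have a: "0 < a" using * by (simp add: a_def G_pos)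
  show thesis
  proof
    show "0 < min 1 (a / \<beta>)" using a beta by simp
    fix \<omega> x assume "\<omega> \<in> space P" "x \<in> space X"
    then have "G \<omega> x / a \<le> \<beta>" "a / G \<omega> x \<le> \<beta>" "0 < G \<omega> x"
      unfolding a_def using * G_ratio G_pos by auto
    then show "min 1 (a / \<beta>) \<le> G \<omega> x \<and> G \<omega> x \<le> max 1 (\<beta> * a)"
      using a beta by (auto simp: field_simps min_le_iff_disj le_max_iff_disj)
  qed auto
qed

lemma integral_M_bounds:
  assumes \<omega>: "\<omega> \<in> space P" and x: "x \<in> space X" and f: "f \<in> borel_measurable X"
    and B: "\<And>y. y \<in> space X \<Longrightarrow> 0 \<le> f y \<and> f y \<le> (B::real)"
  shows "\<epsilon>m * (\<integral>y. f y \<partial>\<nu>) \<le> (\<integral>y. f y \<partial>(M \<omega> x))" "(\<integral>y. f y \<partial>(M \<omega> x)) \<le> \<epsilon>p * (\<integral>y. f y \<partial>\<nu>)"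
proof -
  interpret Mx: prob_space "M \<omega> x" using \<omega> x by (rule M_prob)
  have f\<nu>[measurable]: "f \<in> borel_measurable \<nu>" using f nu(2) by (simp cong: measurable_cong_sets)
  have fM[measurable]: "f \<in> borel_measurable (M \<omega> x)" using f M_sets[OF \<omega> x] by (simp cong: measurable_cong_sets)
  have i: "integrable \<nu> f" using B by (intro nu.integrable_const_bound[of _ B]) (auto simp: nu_space)
  have iM: "integrable (M \<omega> x) f" using B by (intro Mx.integrable_const_bound[of _ B]) (auto simp: M_space[OF \<omega> x])
  have e: "(\<integral>\<^sup>+y. ennreal (f y) \<partial>\<nu>) = ennreal (\<integral>y. f y \<partial>\<nu>)"
    using i B by (intro nn_integral_eq_integral) (auto simp: nu_space)
  have eM: "(\<integral>\<^sup>+y. ennreal (f y) \<partial>(M \<omega> x)) = ennreal (\<integral>y. f y \<partial>(M \<omega> x))"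
    using iM B by (intro nn_integral_eq_integral) (auto simp: M_space[OF \<omega> x])
  have n: "0 \<le> (\<integral>y. f y \<partial>\<nu>)" "0 \<le> (\<integral>y. f y \<partial>(M \<omega> x))"
    using B by (auto intro!: integral_nonneg_AE simp: nu_space M_space[OF \<omega> x])
  have fin: "finite_measure (M \<omega> x)" "finite_measure \<nu>" by unfold_locales
  have sets: "sets (M \<omega> x) = sets \<nu>" using M_sets[OF \<omega> x] nu(2) by simp
  have "ennreal \<epsilon>m * (\<integral>\<^sup>+y. ennreal (f y) \<partial>\<nu>) \<le> (\<integral>\<^sup>+y. ennreal (f y) \<partial>(M \<omega> x))"
    using M_ge[OF \<omega> x] eps_pos by (intro nn_integral_ge_scaled fin sets) (auto simp: nu(2))
  then show "\<epsilon>m * (\<integral>y. f y \<partial>\<nu>) \<le> (\<integral>y. f y \<partial>(M \<omega> x))"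
    unfolding e eM using eps_pos n by (simp add: ennreal_mult'[symmetric])
  have "(\<integral>\<^sup>+y. ennreal (f y) \<partial>(M \<omega> x)) \<le> ennreal \<epsilon>p * (\<integral>\<^sup>+y. ennreal (f y) \<partial>\<nu>)"
    using M_le[OF \<omega> x] eps_pos by (intro nn_integral_le_scaled fin sets) (auto simp: nu(2))
  then show "(\<integral>y. f y \<partial>(M \<omega> x)) \<le> \<epsilon>p * (\<integral>y. f y \<partial>\<nu>)"
    unfolding e eM using eps_pos n by (simp add: ennreal_mult'[symmetric])
qed

lemma measurable_q[measurable]: "(\<lambda>(\<omega>, x). q n \<omega> x) \<in> borel_measurable (P \<Otimes>\<^sub>M X)"
proof (induction n)
  case (Suc n)
  note [measurable] = this
  have "(\<lambda>(z, y). (\<lambda>(\<omega>, x). q n \<omega> x) (seq_shift (fst z), y)) \<in> borel_measurable ((P \<Otimes>\<^sub>M X) \<Otimes>\<^sub>M X)"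
    by measurable
  then have "(\<lambda>(z, y). q n (seq_shift (fst z)) y) \<in> borel_measurable ((P \<Otimes>\<^sub>M X) \<Otimes>\<^sub>M X)" by simp
  from integral_measurable_kernel[OF this measurable_prob_algebraD[OF M_measurable]]
  have [measurable]: "(\<lambda>(\<omega>, x). \<integral>y. q n (seq_shift \<omega>) y \<partial>(M \<omega> x)) \<in> borel_measurable (P \<Otimes>\<^sub>M X)"
    by (simp add: split_beta')
  have "(\<lambda>z. (\<lambda>(\<omega>, x). G \<omega> x) z * (\<lambda>(\<omega>, x). \<integral>y. q n (seq_shift \<omega>) y \<partial>(M \<omega> x)) z) \<in> borel_measurable (P \<Otimes>\<^sub>M X)"
    by measurable
  then show ?case by (simp add: split_beta')
qed simp

lemma measurable_q_section: "\<omega> \<in> space P \<Longrightarrow> q n \<omega> \<in> borel_measurable X"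
  using measurable_compose[OF measurable_Pair1' measurable_q] by simp

text \<open>Crude bounds that deteriorate with n; they serve positivity and integrability, while the
  uniform control is in \<open>q_ratio\<close>.\<close>

lemma q_bounds: obtains l u where "\<And>n. 0 < l n" "\<And>n \<omega> x. \<omega> \<in> space P \<Longrightarrow> x \<in> space X \<Longrightarrow> l n \<le> q n \<omega> x \<and> q n \<omega> x \<le> u n"
proof -
  obtain g g' where g: "0 < g" "g \<le> 1" "1 \<le> g'"
    and G: "\<And>\<omega> x. \<omega> \<in> space P \<Longrightarrow> x \<in> space X \<Longrightarrow> g \<le> G \<omega> x \<and> G \<omega> x \<le> g'" using G_bounds by blast
  have "g ^ n \<le> q n \<omega> x \<and> q n \<omega> x \<le> g' ^ n" if "\<omega> \<in> space P" "x \<in> space X" for n \<omega> x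
    using that
  proof (induction n arbitrary: \<omega> x)
    case (Suc n)
    interpret Mx: prob_space "M \<omega> x" using Suc.prems by (rule M_prob)
    have IH: "g ^ n \<le> q n (seq_shift \<omega>) y \<and> q n (seq_shift \<omega>) y \<le> g' ^ n" if "y \<in> space (M \<omega> x)" for y
      using Suc.IH[OF T_space] Suc.prems that by (simp add: M_space)
    have [measurable]: "q n (seq_shift \<omega>) \<in> borel_measurable (M \<omega> x)"
      using measurable_q_section[OF T_space[OF Suc.prems(1)]] M_sets[OF Suc.prems] by (simp cong: measurable_cong_sets)
    have int: "integrable (M \<omega> x) (q n (seq_shift \<omega>))"
    proof (rule Mx.integrable_const_bound[where B="g' ^ n"])
      show "AE y in M \<omega> x. norm (q n (seq_shift \<omega>) y) \<le> g' ^ n"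
      proof (rule AE_I2)
        fix y assume "y \<in> space (M \<omega> x)"
        then show "norm (q n (seq_shift \<omega>) y) \<le> g' ^ n" using IH[of y] zero_less_power[OF g(1), of n] by simp
      qed
    qed simp
    have 1: "g ^ n \<le> (\<integral>y. q n (seq_shift \<omega>) y \<partial>(M \<omega> x))"
      using int IH by (intro Mx.integral_ge_const) auto
    have 2: "(\<integral>y. q n (seq_shift \<omega>) y \<partial>(M \<omega> x)) \<le> g' ^ n"
      using int IH by (intro Mx.integral_le_const) auto
    have p: "0 < g ^ n" using g by simp
    show ?case using G[OF Suc.prems] g 1 2 order.trans[OF less_imp_le[OF p] 1] by (auto intro!: mult_mono)
  qed simp
  then show thesis using that[of "\<lambda>n. g ^ n" "\<lambda>n. g' ^ n"] g by auto
qed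

lemma q_pos: "\<omega> \<in> space P \<Longrightarrow> x \<in> space X \<Longrightarrow> 0 < q n \<omega> x"
  using q_bounds by (metis less_le_trans)

lemma q_integrable:
  assumes "\<omega> \<in> space P" "prob_space \<mu>" "sets \<mu> = sets X"
  shows "integrable \<mu> (q n \<omega>)" "0 < (\<integral>x. q n \<omega> x \<partial>\<mu>)"
proof -
  interpret \<mu>: prob_space \<mu> by fact
  have sp: "space \<mu> = space X" using assms by (intro sets_eq_imp_space_eq)
  obtain l u where lu: "\<And>n. 0 < l n" "\<And>n \<omega> x. \<omega> \<in> space P \<Longrightarrow> x \<in> space X \<Longrightarrow> l n \<le> q n \<omega> x \<and> q n \<omega> x \<le> u n"
    using q_bounds by blast
  have bound: "\<bar>q n \<omega> x\<bar> \<le> u n" if "x \<in> space X" for x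
    using lu(2)[OF assms(1) that, of n] q_pos[OF assms(1) that, of n] by simp
  have "q n \<omega> \<in> borel_measurable \<mu>" using measurable_q_section[OF assms(1)] assms(3) by (simp cong: measurable_cong_sets)
  then show int: "integrable \<mu> (q n \<omega>)"
    using bound by (intro \<mu>.integrable_const_bound[where B="u n"]) (auto simp: sp intro!: AE_I2)
  have "l n \<le> (\<integral>x. q n \<omega> x \<partial>\<mu>)"
    using int lu(2)[OF assms(1)] by (intro \<mu>.integral_ge_const) (auto simp: sp intro!: AE_I2)
  then show "0 < (\<integral>x. q n \<omega> x \<partial>\<mu>)" using lu(1)[of n] by linarith
qed

lemma q_integrable_M:
  assumes "\<omega> \<in> space P" "x \<in> space X"
  shows "integrable (M \<omega> x) (q n (seq_shift \<omega>))" "0 < (\<integral>y. q n (seq_shift \<omega>) y \<partial>(M \<omega> x))"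
  using q_integrable[OF T_space M_prob M_sets] assms by blast+
lemmas q_integrable_nu = q_integrable[OF _ nu]

text \<open>Only the first potential and the first kernel see the starting point. Whatever follows
  is one function of the next state, whose integral is compared with its integral under
  \<nu>.\<close>

lemma q_ratio:
  assumes "\<omega> \<in> space P" "x \<in> space X" "y \<in> space X"
  shows "q n \<omega> x \<le> R * q n \<omega> y"
proof (cases n)
  case 0
  then show ?thesis using R_ge_1 by simp
next
  case (Suc k)
  obtain l u where lu: "\<And>n. 0 < l n" "\<And>n \<omega> x. \<omega> \<in> space P \<Longrightarrow> x \<in> space X \<Longrightarrow> l n \<le> q n \<omega> x \<and> q n \<omega> x \<le> u n"
    using q_bounds by blast
  let ?q = "q k (seq_shift \<omega>)"
  have m: "?q \<in> borel_measurable X" by (rule measurable_q_section[OF T_space[OF assms(1)]])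
  have b: "0 \<le> ?q z \<and> ?q z \<le> u k" if "z \<in> space X" for z
    using lu(2)[OF T_space[OF assms(1)] that] q_pos[OF T_space[OF assms(1)] that, of k] by auto
  have "G \<omega> x \<le> \<beta> * G \<omega> y" using G_ratio[OF assms(1,1,2,3)] G_pos[OF assms(1,3)] by (simp add: field_simps)
  then have "G \<omega> x * (\<integral>z. ?q z \<partial>(M \<omega> x)) \<le> (\<beta> * G \<omega> y) * (\<epsilon>p * (\<integral>z. ?q z \<partial>\<nu>))"
    using integral_M_bounds(2)[OF assms(1,2) m b] q_integrable_M[OF assms(1,2), of k] G_pos[OF assms(1,2)] assms
    by (intro mult_mono) (auto intro: less_imp_le)
  also have "\<dots> = (\<beta> * (\<epsilon>p / \<epsilon>m) * G \<omega> y) * (\<epsilon>m * (\<integral>z. ?q z \<partial>\<nu>))" using eps_pos by simp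
  also have "\<dots> \<le> (\<beta> * (\<epsilon>p / \<epsilon>m) * G \<omega> y) * (\<integral>z. ?q z \<partial>(M \<omega> y))"
    using integral_M_bounds(1)[OF assms(1,3) m b] beta eps_pos G_pos[OF assms(1,3)]
    by (intro mult_left_mono) auto
  finally show ?thesis by (simp add: Suc R_def mult.assoc)
qed

text \<open>The ratio of \<open>q (m + k)\<close> to \<open>q m\<close> takes values between a and
  b. Prepending a step averages this ratio over a law that, by the two-sided bound, puts weight at
  least \<delta> on one common average r; the interval thus shrinks towards r by the factor 1 -
  \<delta>. The new step is the first one in time, so the induction runs over all \<omega>.\<close>

lemma q_contraction:
  assumes "\<omega> \<in> space P"
  shows "\<exists>a b. 0 < a \<and> a \<le> b \<and> b - a \<le> (1 - \<delta>) ^ m * R\<^sup>2 * a \<and>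
    (\<forall>x\<in>space X. a * q m \<omega> x \<le> q (m + k) \<omega> x \<and> q (m + k) \<omega> x \<le> b * q m \<omega> x)"
  using assms
proof (induction m arbitrary: \<omega>)
  case 0
  obtain x1 where x1: "x1 \<in> space X" using X_nonempty by blast
  \<comment> \<open>At m = 0 the ratio is \<open>q k\<close> itself, and \<open>q_ratio\<close> on
    both sides of a reference point confines it to the interval from a to
    \<open>R\<^sup>2 * a\<close>.\<close>
  define a where "a = q k \<omega> x1 / R"
  have a: "0 < a" using q_pos[OF 0 x1] R_ge_1 by (simp add: a_def)
  have "a \<le> R\<^sup>2 * a" using mult_right_mono[of 1 "R\<^sup>2" a] one_le_power[OF R_ge_1, of 2] a by simp
  moreover have "a \<le> q k \<omega> x \<and> q k \<omega> x \<le> R\<^sup>2 * a" if "x \<in> space X" for x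
    using q_ratio[OF 0 x1 that, of k] q_ratio[OF 0 that x1, of k] R_ge_1
    by (auto simp: a_def field_simps power2_eq_square)
  ultimately show ?case using a by (intro exI[of _ a] exI[of _ "R\<^sup>2 * a"]) auto
next
  case (Suc m)
  obtain l u where lu: "\<And>n. 0 < l n" "\<And>n \<omega> x. \<omega> \<in> space P \<Longrightarrow> x \<in> space X \<Longrightarrow> l n \<le> q n \<omega> x \<and> q n \<omega> x \<le> u n"
    using q_bounds by blast
  define \<omega>' where "\<omega>' = seq_shift \<omega>"
  have \<omega>': "\<omega>' \<in> space P" unfolding \<omega>'_def using Suc.prems by (rule T_space)
  obtain a b where ab: "0 < a" "a \<le> b" "b - a \<le> (1 - \<delta>) ^ m * R\<^sup>2 * a"
    and le: "\<And>x. x \<in> space X \<Longrightarrow> a * q m \<omega>' x \<le> q (m + k) \<omega>' x \<and> q (m + k) \<omega>' x \<le> b * q m \<omega>' x"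
    using Suc.IH[OF \<omega>'] by blast
  define U V r where "U = (\<integral>y. q m \<omega>' y \<partial>\<nu>)" and "V = (\<integral>y. q (m + k) \<omega>' y \<partial>\<nu>)" and "r = V / U"
  have U: "0 < U" unfolding U_def using q_integrable_nu[OF \<omega>'] by auto
  note int = q_integrable_nu(1)[OF \<omega>']
  have "a * U \<le> V" "V \<le> b * U"
    using integral_mono[of \<nu> "\<lambda>y. a * q m \<omega>' y" "q (m + k) \<omega>'"]
      integral_mono[of \<nu> "q (m + k) \<omega>'" "\<lambda>y. b * q m \<omega>' y"] int le
    by (auto simp: U_def V_def nu_space)
  then have r: "a \<le> r" "r \<le> b" using U by (auto simp: r_def field_simps)
  have V: "V = r * U" using U by (simp add: r_def)
  \<comment> \<open>Both endpoints move towards the average ratio \<open>r\<close> by the share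
    \<delta>. Since a grows, the width relative to the left endpoint contracts as well.\<close>
  define a' b' where "a' = a + \<delta> * (r - a)" and "b' = b - \<delta> * (b - r)"
  have aa: "a \<le> a'" using delta r by (simp add: a'_def)
  have ba: "b' - a' = (1 - \<delta>) * (b - a)" by (simp add: a'_def b'_def algebra_simps)
  have "b' - a' \<le> (1 - \<delta>) * ((1 - \<delta>) ^ m * R\<^sup>2 * a)"
    unfolding ba using ab delta by (intro mult_left_mono) auto
  also have "\<dots> \<le> (1 - \<delta>) * ((1 - \<delta>) ^ m * R\<^sup>2 * a')"
    using aa delta by (intro mult_left_mono) auto
  finally have 1: "b' - a' \<le> (1 - \<delta>) ^ Suc m * R\<^sup>2 * a'" by (simp add: mult.assoc)
  have 2: "a' \<le> b'" using ba delta ab by (metis diff_ge_0_iff_ge mult_nonneg_nonneg)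
  have 3: "a' * q (Suc m) \<omega> x \<le> q (Suc m + k) \<omega> x \<and> q (Suc m + k) \<omega> x \<le> b' * q (Suc m) \<omega> x"
    if x: "x \<in> space X" for x
  proof -
    define U' V' where "U' = (\<integral>y. q m \<omega>' y \<partial>(M \<omega> x))" and "V' = (\<integral>y. q (m + k) \<omega>' y \<partial>(M \<omega> x))"
    note intM = q_integrable_M(1)[OF Suc.prems x, folded \<omega>'_def]
    have m: "q n \<omega>' \<in> borel_measurable X" for n using measurable_q_section[OF \<omega>'] .
    have bd: "0 \<le> q n \<omega>' y" "q n \<omega>' y \<le> u n" if "y \<in> space X" for y n
      using lu(2)[OF \<omega>' that, of n] q_pos[OF \<omega>' that, of n] by auto
    have bb: "0 < b" using ab by simp
    have U': "U' \<le> \<epsilon>p * U" unfolding U_def U'_def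
      using integral_M_bounds(2)[OF Suc.prems x m] bd by blast
    \<comment> \<open>Minorisation needs a nonnegative integrand, so it is applied to the excess
      over the left endpoint and, below, to the deficit from the right one.\<close>
    have "\<epsilon>m * (\<integral>y. q (m + k) \<omega>' y - a * q m \<omega>' y \<partial>\<nu>) \<le> (\<integral>y. q (m + k) \<omega>' y - a * q m \<omega>' y \<partial>(M \<omega> x))"
    proof (rule integral_M_bounds(1)[OF Suc.prems x, where B="u (m + k)"])
      fix y assume y: "y \<in> space X"
      show "0 \<le> q (m + k) \<omega>' y - a * q m \<omega>' y \<and> q (m + k) \<omega>' y - a * q m \<omega>' y \<le> u (m + k)"
        using le[OF y] bd(2)[OF y, of "m + k"] mult_nonneg_nonneg[OF less_imp_le[OF ab(1)] bd(1)[OF y, of m]] by linarith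
    qed (use m in measurable)
    moreover have "(\<integral>y. q (m + k) \<omega>' y - a * q m \<omega>' y \<partial>\<nu>) = (r - a) * U"
      using int V by (simp add: U_def V_def left_diff_distrib)
    ultimately have lo: "\<epsilon>m * ((r - a) * U) \<le> V' - a * U'"
      using intM by (simp add: U'_def V'_def)
    have "\<epsilon>m * (\<integral>y. b * q m \<omega>' y - q (m + k) \<omega>' y \<partial>\<nu>) \<le> (\<integral>y. b * q m \<omega>' y - q (m + k) \<omega>' y \<partial>(M \<omega> x))"
    proof (rule integral_M_bounds(1)[OF Suc.prems x, where B="b * u m"])
      fix y assume y: "y \<in> space X"
      show "0 \<le> b * q m \<omega>' y - q (m + k) \<omega>' y \<and> b * q m \<omega>' y - q (m + k) \<omega>' y \<le> b * u m"
        using le[OF y] bd(1)[OF y, of "m + k"] mult_left_mono[OF bd(2)[OF y, of m] less_imp_le[OF bb]] by linarith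
    qed (use m in measurable)
    moreover have "(\<integral>y. b * q m \<omega>' y - q (m + k) \<omega>' y \<partial>\<nu>) = (b - r) * U"
      using int V by (simp add: U_def V_def left_diff_distrib)
    ultimately have hi: "\<epsilon>m * ((b - r) * U) \<le> b * U' - V'"
      using intM by (simp add: U'_def V'_def)
    \<comment> \<open>Normalising by the mass \<open>U'\<close> under the actual kernel instead of
      \<open>U\<close> costs a factor \<epsilon>p, which turns \<epsilon>m into \<delta>.\<close>
    have "\<delta> * s * U' \<le> \<epsilon>m * (s * U)" if "0 \<le> s" for s
    proof -
      have "\<delta> * s * U' \<le> \<delta> * s * (\<epsilon>p * U)" using U' that delta by (intro mult_left_mono) auto
      also have "\<dots> = \<epsilon>m * (s * U)" using eps_pos by (simp add: \<delta>_def)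
      finally show ?thesis .
    qed
    from this[of "r - a"] this[of "b - r"] lo hi r
    have "a' * U' \<le> V'" "V' \<le> b' * U'" by (auto simp: a'_def b'_def algebra_simps)
    then have "G \<omega> x * (a' * U') \<le> G \<omega> x * V'" "G \<omega> x * V' \<le> G \<omega> x * (b' * U')"
      using G_pos[OF Suc.prems x] by (auto intro!: mult_left_mono)
    then show ?thesis by (simp add: \<omega>'_def[symmetric] U'_def V'_def mult_ac)
  qed
  show ?case using 1 2 3 aa ab(1) by (intro exI[of _ a'] exI[of _ b']) auto
qed

text \<open>The semigroup preserves order: an inequality between mass functions of the environment
  at time j is pulled back through the first j steps.\<close>

lemma q_mono:
  assumes "\<omega> \<in> space P" and "x \<in> space X"
    and "\<And>y. y \<in> space X \<Longrightarrow> a * q m (shift_pow (int j) \<omega>) y \<le> b * q n (shift_pow (int j) \<omega>) y"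
  shows "a * q (j + m) \<omega> x \<le> b * q (j + n) \<omega> x"
  using assms
proof (induction j arbitrary: \<omega> x)
  case (Suc j)
  have le: "a * q (j + m) (seq_shift \<omega>) y \<le> b * q (j + n) (seq_shift \<omega>) y" if y: "y \<in> space X" for y
    using Suc.prems(3) by (intro Suc.IH T_space Suc.prems(1) y) (simp add: shift_pow_seq_shift)
  have "(\<integral>y. a * q (j + m) (seq_shift \<omega>) y \<partial>(M \<omega> x)) \<le> (\<integral>y. b * q (j + n) (seq_shift \<omega>) y \<partial>(M \<omega> x))"
    using q_integrable_M(1)[OF Suc.prems(1,2)] le
    by (intro integral_mono) (auto simp: M_space[OF Suc.prems(1,2)])
  then have "G \<omega> x * (\<integral>y. a * q (j + m) (seq_shift \<omega>) y \<partial>(M \<omega> x)) \<le> G \<omega> x * (\<integral>y. b * q (j + n) (seq_shift \<omega>) y \<partial>(M \<omega> x))"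
    using G_pos[OF Suc.prems(1,2)] by (intro mult_left_mono) auto
  then show ?case by (simp add: mult_ac)
qed simp

section \<open>The limit defining \<open>h\<close>\<close>

text \<open>With the constant 1 as integrand the induction would not close, because
  \<open>Q_iter\<close> appends steps while \<open>mass\<close> prepends them. The integrand
  \<open>q m\<close> of the environment at time n lets a step pass from one to the other; m = 0 is
  the case of interest.\<close>

lemma Q_iter_mass:
  assumes \<omega>: "\<omega> \<in> space P"
  shows "(\<forall>x\<in>space X. sets (Q_iter X G M n \<omega> x) = sets X) \<and>
    (\<forall>f\<in>borel_measurable X. (\<lambda>x. \<integral>\<^sup>+y. f y \<partial>(Q_iter X G M n \<omega> x)) \<in> borel_measurable X) \<and>
    (\<forall>x\<in>space X. \<forall>m. (\<integral>\<^sup>+y. ennreal (q m (shift_pow (int n) \<omega>) y) \<partial>(Q_iter X G M n \<omega> x)) = ennreal (q (n + m) \<omega> x))"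
proof (induction n)
  case 0
  have "(\<lambda>x. \<integral>\<^sup>+y. f y \<partial>(return X x)) \<in> borel_measurable X" if "f \<in> borel_measurable X" for f :: "'x \<Rightarrow> ennreal"
  proof -
    have "(\<integral>\<^sup>+y. f y \<partial>(return X x)) = f x" if "x \<in> space X" for x
      using \<open>f \<in> borel_measurable X\<close> that by (rule nn_integral_return[rotated])
    with that show ?thesis by (simp cong: measurable_cong)
  qed
  moreover have "(\<lambda>y. ennreal (q m \<omega> y)) \<in> borel_measurable X" for m
    using measurable_q_section[OF \<omega>] by simp
  ultimately show ?case by (auto simp: nn_integral_return)
next
  case (Suc n)
  let ?\<omega> = "shift_pow (int n) \<omega>"
  have \<omega>': "?\<omega> \<in> space P" using \<omega> by (rule shift_pow_space)
  note [measurable] = G_measurable_section[OF \<omega>'] measurable_prob_algebraD[OF M_measurable_section[OF \<omega>']]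
  have Q: "(\<integral>\<^sup>+y. f y \<partial>(Q_iter X G M (Suc n) \<omega> x))
      = (\<integral>\<^sup>+y. ennreal (G ?\<omega> y) * (\<integral>\<^sup>+z. f z \<partial>(M ?\<omega> y)) \<partial>(Q_iter X G M n \<omega> x))"
    if x: "x \<in> space X" and f[measurable]: "f \<in> borel_measurable X" for f :: "'x \<Rightarrow> ennreal" and x
  proof -
    have s[measurable_cong]: "sets (Q_iter X G M n \<omega> x) = sets X" using Suc x by blast
    have sp: "space (Q_iter X G M n \<omega> x) = space X" using s by (rule sets_eq_imp_space_eq)
    have "(\<integral>\<^sup>+y. f y \<partial>(Q_iter X G M (Suc n) \<omega> x))
        = (\<integral>\<^sup>+y. \<integral>\<^sup>+z. f z \<partial>(Q_kernel G M ?\<omega> y) \<partial>(Q_iter X G M n \<omega> x))"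
      unfolding Q_iter.simps
    proof (rule nn_integral_kernel_left)
      fix A assume "A \<in> sets (Q_iter X G M n \<omega> x)"
      then have [measurable]: "A \<in> sets X" by (simp add: s)
      have [measurable]: "(\<lambda>y. emeasure (M ?\<omega> y) A) \<in> borel_measurable X" by measurable
      show "(\<lambda>y. emeasure (Q_kernel G M ?\<omega> y) A) \<in> borel_measurable (Q_iter X G M n \<omega> x)"
        by (simp add: Q_kernel_def)
    qed (auto simp: s sp Q_kernel_def M_sets[OF \<omega>'])
    also have "\<dots> = (\<integral>\<^sup>+y. ennreal (G ?\<omega> y) * (\<integral>\<^sup>+z. f z \<partial>(M ?\<omega> y)) \<partial>(Q_iter X G M n \<omega> x))"
      unfolding Q_kernel_def
      by (intro nn_integral_cong nn_integral_scale_measure) (simp add: sp M_sets[OF \<omega>'] cong: measurable_cong_sets)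
    finally show ?thesis .
  qed
  show ?case
  proof (intro conjI ballI allI)
    fix x assume "x \<in> space X"
    then show "sets (Q_iter X G M (Suc n) \<omega> x) = sets X" using Suc by (simp add: sets_kernel_left)
  next
    fix f :: "'x \<Rightarrow> ennreal" assume [measurable]: "f \<in> borel_measurable X"
    have "(\<lambda>y. ennreal (G ?\<omega> y) * (\<integral>\<^sup>+z. f z \<partial>(M ?\<omega> y))) \<in> borel_measurable X" by measurable
    then show "(\<lambda>x. \<integral>\<^sup>+y. f y \<partial>(Q_iter X G M (Suc n) \<omega> x)) \<in> borel_measurable X"
      using Suc Q[of _ f] by (simp cong: measurable_cong del: Q_iter.simps)
  next
    fix x m assume x: "x \<in> space X"
    let ?f = "\<lambda>y. ennreal (q m (shift_pow (int (Suc n)) \<omega>) y)"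
    have sp: "space (Q_iter X G M n \<omega> x) = space X" using Suc x by (intro sets_eq_imp_space_eq) blast
    have sh: "shift_pow (int (Suc n)) \<omega> = seq_shift ?\<omega>" by (simp add: seq_shift_shift_pow)
    have "?f \<in> borel_measurable X" using measurable_q_section[OF shift_pow_space[OF \<omega>]] by simp
    then have "(\<integral>\<^sup>+y. ?f y \<partial>(Q_iter X G M (Suc n) \<omega> x))
        = (\<integral>\<^sup>+y. ennreal (G ?\<omega> y) * (\<integral>\<^sup>+z. ?f z \<partial>(M ?\<omega> y)) \<partial>(Q_iter X G M n \<omega> x))"
      by (rule Q[OF x])
    also have "\<dots> = (\<integral>\<^sup>+y. ennreal (q (Suc m) ?\<omega> y) \<partial>(Q_iter X G M n \<omega> x))"
    proof (rule nn_integral_cong)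
      fix y assume "y \<in> space (Q_iter X G M n \<omega> x)"
      then have y: "y \<in> space X" by (simp add: sp)
      have "(\<integral>\<^sup>+z. ?f z \<partial>(M ?\<omega> y)) = ennreal (\<integral>z. q m (seq_shift ?\<omega>) z \<partial>(M ?\<omega> y))"
        unfolding sh using q_integrable_M(1)[OF \<omega>' y] q_pos[OF T_space[OF \<omega>']]
        by (intro nn_integral_eq_integral) (auto simp: M_space[OF \<omega>' y] less_imp_le)
      then show "ennreal (G ?\<omega> y) * (\<integral>\<^sup>+z. ?f z \<partial>(M ?\<omega> y)) = ennreal (q (Suc m) ?\<omega> y)"
        using G_pos[OF \<omega>' y] by (simp add: ennreal_mult'[symmetric])
    qed
    also have "\<dots> = ennreal (q (n + Suc m) \<omega> x)" using Suc x by blast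
    finally show "(\<integral>\<^sup>+y. ?f y \<partial>(Q_iter X G M (Suc n) \<omega> x)) = ennreal (q (Suc n + m) \<omega> x)" by simp
  qed
qed

lemma nn_integral_kernel_left_Q_iter:
  assumes \<omega>: "\<omega> \<in> space P" and s: "sets \<mu> = sets X"
  shows "(\<integral>\<^sup>+y. ennreal (q m (shift_pow (int n) \<omega>) y) \<partial>(kernel_left \<mu> (Q_iter X G M n \<omega>))) = (\<integral>\<^sup>+x. ennreal (q (n + m) \<omega> x) \<partial>\<mu>)"
proof -
  note Q = Q_iter_mass[OF \<omega>, of n]
  have sp: "space \<mu> = space X" using s by (rule sets_eq_imp_space_eq)
  have "(\<integral>\<^sup>+y. ennreal (q m (shift_pow (int n) \<omega>) y) \<partial>(kernel_left \<mu> (Q_iter X G M n \<omega>)))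
      = (\<integral>\<^sup>+x. \<integral>\<^sup>+y. ennreal (q m (shift_pow (int n) \<omega>) y) \<partial>(Q_iter X G M n \<omega> x) \<partial>\<mu>)"
  proof (rule nn_integral_kernel_left)
    fix A assume A: "A \<in> sets \<mu>"
    then have "(\<lambda>x. \<integral>\<^sup>+y. indicator A y \<partial>(Q_iter X G M n \<omega> x)) \<in> borel_measurable X" using Q s by auto
    moreover have "(\<integral>\<^sup>+y. indicator A y \<partial>(Q_iter X G M n \<omega> x)) = emeasure (Q_iter X G M n \<omega> x) A" if "x \<in> space X" for x
      using Q that A s by (intro nn_integral_indicator) auto
    ultimately show "(\<lambda>x. emeasure (Q_iter X G M n \<omega> x) A) \<in> borel_measurable \<mu>"
      using s by (simp cong: measurable_cong measurable_cong_sets)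
  next
    show "sets (Q_iter X G M n \<omega> x) = sets \<mu>" if "x \<in> space \<mu>" for x using Q s sp that by auto
    show "(\<lambda>y. ennreal (q m (shift_pow (int n) \<omega>) y)) \<in> borel_measurable \<mu>"
      using measurable_q_section[OF shift_pow_space[OF \<omega>]] s by (simp cong: measurable_cong_sets)
  qed
  also have "\<dots> = (\<integral>\<^sup>+x. ennreal (q (n + m) \<omega> x) \<partial>\<mu>)"
    using Q by (intro nn_integral_cong) (simp add: sp)
  finally show ?thesis .
qed

lemma nn_integral_q:
  assumes "\<omega> \<in> space P" and "prob_space \<mu>" "sets \<mu> = sets X"
  shows "(\<integral>\<^sup>+x. ennreal (q n \<omega> x) \<partial>\<mu>) = ennreal (\<integral>x. q n \<omega> x \<partial>\<mu>)"
  using q_integrable(1)[OF assms] q_pos[OF assms(1)] sets_eq_imp_space_eq[OF assms(3)]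
  by (intro nn_integral_eq_integral) (auto simp: less_imp_le)

text \<open>By the semigroup property the denominator in the definition of h is the 2n-step mass
  divided by the n-step mass, both started from \<mu> in the environment shifted back by n. The
  ratio is thus expressed by \<open>mass\<close> functions alone.\<close>

lemma h_ratio_eq:
  assumes \<omega>: "\<omega> \<in> space P" and x: "x \<in> space X" and \<mu>: "prob_space \<mu>" "sets \<mu> = sets X"
  shows "h_ratio X G M \<mu> \<omega> x n = q n \<omega> x * (\<integral>x. q n (shift_pow (- int n) \<omega>) x \<partial>\<mu>)
    / (\<integral>x. q (n + n) (shift_pow (- int n) \<omega>) x \<partial>\<mu>)"
proof -
  define \<omega>' where "\<omega>' = shift_pow (- int n) \<omega>"
  have \<omega>': "\<omega>' \<in> space P" unfolding \<omega>'_def using \<omega> by (rule shift_pow_space)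
  have sh: "shift_pow (int n) \<omega>' = \<omega>" by (simp add: \<omega>'_def)
  define \<mu>Q where "\<mu>Q = kernel_left \<mu> (Q_iter X G M n \<omega>')"
  have sp: "space \<mu> = space X" using \<mu>(2) by (rule sets_eq_imp_space_eq)
  have s\<mu>Q: "sets \<mu>Q = sets X" by (simp add: \<mu>Q_def sets_kernel_left \<mu>)
  have sp\<mu>Q: "space \<mu>Q = space X" using s\<mu>Q by (rule sets_eq_imp_space_eq)
  have num: "kernel_right (Q_iter X G M n \<omega>) (\<lambda>_. 1) x = q n \<omega> x"
  proof -
    have "(\<integral>\<^sup>+y. ennreal (q 0 (shift_pow (int n) \<omega>) y) \<partial>(Q_iter X G M n \<omega> x)) = ennreal (q (n + 0) \<omega> x)"
      using Q_iter_mass[OF \<omega>, of n] x by blast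
    then have "emeasure (Q_iter X G M n \<omega> x) (space (Q_iter X G M n \<omega> x)) = ennreal (q n \<omega> x)" by simp
    then show ?thesis unfolding kernel_right_def using q_pos[OF \<omega> x, of n]
      by (simp add: measure_def)
  qed
  have "(\<integral>\<^sup>+y. ennreal (q 0 (shift_pow (int n) \<omega>') y) \<partial>\<mu>Q) = (\<integral>\<^sup>+x. ennreal (q (n + 0) \<omega>' x) \<partial>\<mu>)"
    unfolding \<mu>Q_def by (rule nn_integral_kernel_left_Q_iter[OF \<omega>' \<mu>(2)])
  then have mass: "emeasure \<mu>Q (space X) = ennreal (\<integral>x. q n \<omega>' x \<partial>\<mu>)"
    by (simp add: sp\<mu>Q nn_integral_q[OF \<omega>' \<mu>])
  define \<eta> where "\<eta> = Phi X G M n \<omega>' \<mu>"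
  have \<eta>: "\<eta> = scale_measure (1 / emeasure \<mu>Q (space X)) \<mu>Q"
    by (simp add: \<eta>_def Phi_def Let_def \<mu>Q_def)
  have s\<eta>: "sets \<eta> = sets X" by (simp add: \<eta> s\<mu>Q)
  let ?L = "kernel_left \<eta> (Q_iter X G M n \<omega>)"
  have "(\<integral>\<^sup>+y. ennreal (q 0 (shift_pow (int n) \<omega>) y) \<partial>?L) = (\<integral>\<^sup>+x. ennreal (q (n + 0) \<omega> x) \<partial>\<eta>)"
    by (rule nn_integral_kernel_left_Q_iter[OF \<omega> s\<eta>])
  then have "emeasure ?L (space ?L) = (\<integral>\<^sup>+x. ennreal (q n \<omega> x) \<partial>\<eta>)" by simp
  also have "\<dots> = 1 / ennreal (\<integral>x. q n \<omega>' x \<partial>\<mu>) * (\<integral>\<^sup>+x. ennreal (q n (shift_pow (int n) \<omega>') x) \<partial>\<mu>Q)"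
    unfolding \<eta> mass sh using measurable_q_section[OF \<omega>] s\<mu>Q
    by (intro nn_integral_scale_measure) (simp cong: measurable_cong_sets)
  also have "(\<integral>\<^sup>+x. ennreal (q n (shift_pow (int n) \<omega>') x) \<partial>\<mu>Q) = ennreal (\<integral>x. q (n + n) \<omega>' x \<partial>\<mu>)"
    unfolding \<mu>Q_def by (subst nn_integral_kernel_left_Q_iter[OF \<omega>' \<mu>(2)]) (rule nn_integral_q[OF \<omega>' \<mu>])
  also have "1 / ennreal (\<integral>x. q n \<omega>' x \<partial>\<mu>) * ennreal (\<integral>x. q (n + n) \<omega>' x \<partial>\<mu>)
      = ennreal ((\<integral>x. q (n + n) \<omega>' x \<partial>\<mu>) / (\<integral>x. q n \<omega>' x \<partial>\<mu>))"
    using q_integrable(2)[OF \<omega>' \<mu>, of n] q_integrable(2)[OF \<omega>' \<mu>, of "n + n"]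
    by (simp add: ennreal_1[symmetric] divide_ennreal ennreal_mult'[symmetric] del: ennreal_1)
  finally have "(\<integral>x'. 1 \<partial>?L) = (\<integral>x. q (n + n) \<omega>' x \<partial>\<mu>) / (\<integral>x. q n \<omega>' x \<partial>\<mu>)"
    using q_integrable(2)[OF \<omega>' \<mu>, of n] q_integrable(2)[OF \<omega>' \<mu>, of "n + n"]
    by (simp add: measure_def)
  then show ?thesis unfolding h_ratio_def num \<omega>'_def[symmetric] \<eta>_def[symmetric] by simp
qed

text \<open>The relative width (b - a) / a that \<open>q_contraction\<close> leaves after m
  steps.\<close>

definition "err m = (1 - \<delta>) ^ m * R\<^sup>2"

lemma err_nonneg: "0 \<le> err m" using delta by (simp add: err_def)

lemma err_tendsto: "err \<longlonglongrightarrow> 0"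
proof -
  have "(\<lambda>m. (1 - \<delta>) ^ m) \<longlonglongrightarrow> 0" using delta by (intro LIMSEQ_power_zero) auto
  then have "(\<lambda>m. (1 - \<delta>) ^ m * R\<^sup>2) \<longlonglongrightarrow> 0 * R\<^sup>2" by (rule tendsto_mult_right)
  then show ?thesis unfolding err_def[abs_def] by simp
qed

text \<open>With \<open>z = q\<^sub>m(\<omega>, x) / B\<close>, where \<open>q\<^sub>2\<^sub>m \<approx> B q\<^sub>m\<close> at \<open>\<theta>\<^sup>-\<^sup>m \<omega>\<close>, all ratios from time
  \<open>m\<close> on agree with \<open>z\<close> up to factors \<open>1 + err m\<close>, whatever the initial law.\<close>

lemma h_ratio_sandwich:
  assumes \<omega>: "\<omega> \<in> space P" and x: "x \<in> space X"
  shows "\<exists>z>0. \<forall>n\<ge>m. \<forall>\<mu>. prob_space \<mu> \<longrightarrow> sets \<mu> = sets X \<longrightarrow>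
    z / (1 + err m)\<^sup>2 \<le> h_ratio X G M \<mu> \<omega> x n \<and> h_ratio X G M \<mu> \<omega> x n \<le> z * (1 + err m)"
proof -
  let ?e = "1 + err m"
  define \<omega>m where "\<omega>m = shift_pow (- int m) \<omega>"
  have \<omega>m: "\<omega>m \<in> space P" unfolding \<omega>m_def using \<omega> by (rule shift_pow_space)
  obtain B B' where B: "0 < B" "B \<le> B'" "B' - B \<le> err m * B"
    and Bq: "\<And>x. x \<in> space X \<Longrightarrow> B * q m \<omega>m x \<le> q (m + m) \<omega>m x \<and> q (m + m) \<omega>m x \<le> B' * q m \<omega>m x"
    using q_contraction[OF \<omega>m, of m m] unfolding err_def by blast
  have B': "B' \<le> B * ?e" using B by (simp add: algebra_simps)
  define z where "z = q m \<omega> x / B"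
  have z: "0 < z" using q_pos[OF \<omega> x] B by (simp add: z_def)
  have "z / ?e\<^sup>2 \<le> h_ratio X G M \<mu> \<omega> x n \<and> h_ratio X G M \<mu> \<omega> x n \<le> z * ?e"
    if n: "n \<ge> m" and \<mu>: "prob_space \<mu>" "sets \<mu> = sets X" for n \<mu>
  proof -
    obtain k where k: "n = m + k" using n le_Suc_ex by blast
    obtain A A' where A: "0 < A" "A \<le> A'" "A' - A \<le> err m * A"
      and Aq: "\<And>x. x \<in> space X \<Longrightarrow> A * q m \<omega> x \<le> q n \<omega> x \<and> q n \<omega> x \<le> A' * q m \<omega> x"
      using q_contraction[OF \<omega>, of m k] unfolding err_def k by blast
    have A': "A' \<le> A * ?e" using A by (simp add: algebra_simps)
    define \<omega>n where "\<omega>n = shift_pow (- int n) \<omega>"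
    have \<omega>n: "\<omega>n \<in> space P" unfolding \<omega>n_def using \<omega> by (rule shift_pow_space)
    have sp: "space \<mu> = space X" using \<mu>(2) by (rule sets_eq_imp_space_eq)
    define I where "I j = (\<integral>x. q j \<omega>n x \<partial>\<mu>)" for j
    note int = q_integrable(1)[OF \<omega>n \<mu>]
    have Ipos: "0 < I j" for j unfolding I_def by (rule q_integrable(2)[OF \<omega>n \<mu>])
    have toI: "a * I i \<le> b * I j" if "\<And>y. y \<in> space X \<Longrightarrow> a * q i \<omega>n y \<le> b * q j \<omega>n y" for a b i j
    proof -
      have "(\<integral>y. a * q i \<omega>n y \<partial>\<mu>) \<le> (\<integral>y. b * q j \<omega>n y \<partial>\<mu>)"
        using int that by (intro integral_mono) (auto simp: sp)
      then show ?thesis by (simp add: I_def)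
    qed
    have sh: "shift_pow (int n) \<omega>n = \<omega>" "shift_pow (int k) \<omega>n = \<omega>m"
      by (simp_all add: \<omega>n_def \<omega>m_def k)
    \<comment> \<open>The comparison of \<open>q n\<close> with \<open>q m\<close> at \<omega> is
      pulled back through n steps to the environment \<open>\<omega>n\<close>, where \<mu>
      sits.\<close>
    have "A * q (n + m) \<omega>n y \<le> 1 * q (n + n) \<omega>n y" "1 * q (n + n) \<omega>n y \<le> A' * q (n + m) \<omega>n y"
      if "y \<in> space X" for y
      using Aq by (intro q_mono[OF \<omega>n that]; simp add: sh)+
    from toI[OF this(1)] toI[OF this(2)] have 1: "A * I (n + m) \<le> I (n + n)" "I (n + n) \<le> A' * I (n + m)" by auto
    \<comment> \<open>The comparison at \<open>\<omega>m\<close> is pulled back through the k = n -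
      m steps between \<open>\<omega>n\<close> and \<open>\<omega>m\<close>. Together,
      \<open>I (n + n)\<close> is A B \<open>I n\<close> up to error factors, and A cancels against
      \<open>q n \<omega> x\<close>.\<close>
    have "B * q (k + m) \<omega>n y \<le> 1 * q (k + (m + m)) \<omega>n y" "1 * q (k + (m + m)) \<omega>n y \<le> B' * q (k + m) \<omega>n y"
      if "y \<in> space X" for y
      using Bq by (intro q_mono[OF \<omega>n that]; simp add: sh)+
    from toI[OF this(1)] toI[OF this(2)] have 2: "B * I n \<le> I (n + m)" "I (n + m) \<le> B' * I n"
      by (auto simp: k ac_simps)
    have h: "h_ratio X G M \<mu> \<omega> x n = q n \<omega> x * I n / I (n + n)"
      unfolding h_ratio_eq[OF \<omega> x \<mu>] I_def \<omega>n_def by simp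
    have e: "1 \<le> ?e" using err_nonneg by simp
    have qm: "0 < q m \<omega> x" by (rule q_pos[OF \<omega> x])
    have up: "I (n + n) \<le> A * B * ?e\<^sup>2 * I n"
    proof -
      have "I (n + n) \<le> A' * I (n + m)" by fact
      also have "\<dots> \<le> (A * ?e) * (B' * I n)" using A' 2 A(1) e Ipos by (intro mult_mono) (auto intro: less_imp_le)
      also have "\<dots> \<le> (A * ?e) * ((B * ?e) * I n)" using B' A e Ipos[of n] by (intro mult_left_mono mult_right_mono) auto
      finally show ?thesis by (simp add: power2_eq_square mult_ac)
    qed
    have lo: "A * B * I n \<le> I (n + n)"
    proof -
      have "A * (B * I n) \<le> A * I (n + m)" using 2 A by (intro mult_left_mono) auto
      then show ?thesis using 1 by (simp add: mult.assoc)
    qed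
    have "h_ratio X G M \<mu> \<omega> x n \<le> z * ?e"
    proof -
      have "q n \<omega> x * I n \<le> (A * ?e * q m \<omega> x) * I n"
        using Aq[OF x] A' qm Ipos[of n] by (intro mult_right_mono) (auto intro: order.trans mult_right_mono)
      also have "\<dots> = z * ?e * (A * B * I n)" using B by (simp add: z_def)
      also have "\<dots> \<le> z * ?e * I (n + n)" using lo z e by (intro mult_left_mono) auto
      finally show ?thesis unfolding h using Ipos[of "n + n"] by (simp add: divide_le_eq)
    qed
    moreover have "z / ?e\<^sup>2 \<le> h_ratio X G M \<mu> \<omega> x n"
    proof -
      have "z / ?e\<^sup>2 * I (n + n) \<le> z / ?e\<^sup>2 * (A * B * ?e\<^sup>2 * I n)" using up z e by (intro mult_left_mono) auto
      also have "\<dots> = (A * q m \<omega> x) * I n" using B e by (simp add: z_def)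
      also have "\<dots> \<le> q n \<omega> x * I n" using Aq[OF x] Ipos[of n] by (intro mult_right_mono) auto
      finally show ?thesis unfolding h using Ipos[of "n + n"] by (simp add: le_divide_eq)
    qed
    ultimately show ?thesis by blast
  qed
  with z show ?thesis by blast
qed

text \<open>This is \<open>(1 + err 0) ^ 3\<close>, the factor between any two ratios when m = 0.
  The ratio at time 0 equals 1, so H and 1 / H bound all ratios and then h.\<close>

definition "H = (1 + R\<^sup>2) ^ 3"

lemma H_ge_1: "1 \<le> H"
  unfolding H_def by (intro one_le_power) simp

abbreviation "h \<equiv> h_fun X G M"

text \<open>The sandwich loses one factor \<open>1 + err m\<close> from above and two from
  below.\<close>

lemma h_ratio_close:
  assumes \<omega>: "\<omega> \<in> space P" and x: "x \<in> space X" and "n \<ge> m" "n' \<ge> m"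
    and \<mu>: "prob_space \<mu>" "sets \<mu> = sets X" and \<mu>': "prob_space \<mu>'" "sets \<mu>' = sets X"
  shows "h_ratio X G M \<mu> \<omega> x n \<le> (1 + err m) ^ 3 * h_ratio X G M \<mu>' \<omega> x n'"
proof -
  obtain z where z: "0 < z" and s: "\<And>n \<mu>. n \<ge> m \<Longrightarrow> prob_space \<mu> \<Longrightarrow> sets \<mu> = sets X \<Longrightarrow>
      z / (1 + err m)\<^sup>2 \<le> h_ratio X G M \<mu> \<omega> x n \<and> h_ratio X G M \<mu> \<omega> x n \<le> z * (1 + err m)"
    using h_ratio_sandwich[OF \<omega> x, of m] by blast
  have e: "1 \<le> 1 + err m" using err_nonneg by simp
  have "h_ratio X G M \<mu> \<omega> x n \<le> z * (1 + err m)" using s assms by blast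
  also have "\<dots> = (1 + err m) ^ 3 * (z / (1 + err m)\<^sup>2)"
    using e by (simp add: power2_eq_square power3_eq_cube)
  also have "\<dots> \<le> (1 + err m) ^ 3 * h_ratio X G M \<mu>' \<omega> x n'"
    using s[OF \<open>n' \<ge> m\<close> \<mu>'] e by (intro mult_left_mono) auto
  finally show ?thesis .
qed

lemma h_ratio_bounds:
  assumes \<omega>: "\<omega> \<in> space P" and x: "x \<in> space X" and \<mu>: "prob_space \<mu>" "sets \<mu> = sets X"
  shows "1 / H \<le> h_ratio X G M \<mu> \<omega> x n" "h_ratio X G M \<mu> \<omega> x n \<le> H"
proof -
  interpret \<mu>: prob_space \<mu> by fact
  have 0: "h_ratio X G M \<mu> \<omega> x 0 = 1" unfolding h_ratio_eq[OF assms] by (simp add: mass.simps(1)[abs_def] \<mu>.prob_space)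
  have e: "(1 + err 0) ^ 3 = H" by (simp add: H_def err_def)
  show "h_ratio X G M \<mu> \<omega> x n \<le> H" using h_ratio_close[OF \<omega> x _ _ \<mu> \<mu>, of 0 n 0] by (simp add: 0 e)
  show "1 / H \<le> h_ratio X G M \<mu> \<omega> x n"
    using h_ratio_close[OF \<omega> x _ _ \<mu> \<mu>, of 0 0 n] H_ge_1 by (simp add: 0 e field_simps)
qed

text \<open>The bound \<open>H\<close> turns the multiplicative closeness into an additive one.
  Applied to one law it gives the Cauchy property, applied to two laws it shows that the limit is
  common, so the description in \<open>h_fun\<close> has a unique solution.\<close>

lemma h_ratio_tendsto:
  assumes \<omega>: "\<omega> \<in> space P" and x: "x \<in> space X" and \<mu>: "prob_space \<mu>" "sets \<mu> = sets X"
  shows "h_ratio X G M \<mu> \<omega> x \<longlonglongrightarrow> h \<omega> x"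
proof -
  define c where "c m = ((1 + err m) ^ 3 - 1) * H" for m
  have c0: "c \<longlonglongrightarrow> 0"
  proof -
    have "c \<longlonglongrightarrow> ((1 + 0) ^ 3 - 1) * H" unfolding c_def[abs_def] by (intro tendsto_intros err_tendsto)
    then show ?thesis by simp
  qed
  have close: "\<bar>h_ratio X G M \<mu>1 \<omega> x n - h_ratio X G M \<mu>2 \<omega> x n'\<bar> \<le> c m"
    if "n \<ge> m" "n' \<ge> m" "prob_space \<mu>1" "sets \<mu>1 = sets X" "prob_space \<mu>2" "sets \<mu>2 = sets X" for n n' m \<mu>1 \<mu>2
  proof -
    have e: "0 \<le> (1 + err m) ^ 3 - 1" using one_le_power[of "1 + err m" 3] err_nonneg by simp
    have *: "a - b \<le> c m" if "a \<le> (1 + err m) ^ 3 * b" "b \<le> H" for a b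
    proof -
      have "a - b \<le> ((1 + err m) ^ 3 - 1) * b" using that by (simp add: algebra_simps)
      also have "\<dots> \<le> c m" unfolding c_def using e that by (intro mult_left_mono) auto
      finally show ?thesis .
    qed
    show ?thesis
      using *[OF h_ratio_close[OF \<omega> x that(1,2) that(3,4) that(5,6)] h_ratio_bounds(2)[OF \<omega> x that(5,6)]]
        *[OF h_ratio_close[OF \<omega> x that(2,1) that(5,6) that(3,4)] h_ratio_bounds(2)[OF \<omega> x that(3,4)]]
      by linarith
  qed
  have "Cauchy (h_ratio X G M \<mu> \<omega> x)"
  proof (rule metric_CauchyI)
    fix e :: real assume "0 < e"
    then obtain m where "c m < e"
      using order_tendstoD(2)[OF c0] by (auto simp: eventually_sequentially)
    then show "\<exists>m. \<forall>n\<ge>m. \<forall>n'\<ge>m. dist (h_ratio X G M \<mu> \<omega> x n) (h_ratio X G M \<mu> \<omega> x n') < e"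
      unfolding dist_real_def using close[OF _ _ \<mu> \<mu>] by (meson le_less_trans)
  qed
  then obtain l where l: "h_ratio X G M \<mu> \<omega> x \<longlonglongrightarrow> l" using Cauchy_convergent convergentD by blast
  have all: "h_ratio X G M \<mu>' \<omega> x \<longlonglongrightarrow> l" if \<mu>': "prob_space \<mu>'" "sets \<mu>' = sets X" for \<mu>'
  proof -
    have "(\<lambda>n. h_ratio X G M \<mu>' \<omega> x n - h_ratio X G M \<mu> \<omega> x n) \<longlonglongrightarrow> 0"
      by (rule Lim_null_comparison[OF _ c0]) (use close[OF _ _ \<mu>' \<mu>] in auto)
    from tendsto_add[OF this l] show ?thesis by simp
  qed
  have "h \<omega> x = l"
    unfolding h_fun_def
  proof (rule the_equality)
    show "\<forall>\<mu>\<in>space (prob_algebra X). h_ratio X G M \<mu> \<omega> x \<longlonglongrightarrow> l" using all by (auto simp: space_prob_algebra)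
    fix c assume "\<forall>\<mu>\<in>space (prob_algebra X). h_ratio X G M \<mu> \<omega> x \<longlonglongrightarrow> c"
    then have "h_ratio X G M \<mu> \<omega> x \<longlonglongrightarrow> c" using \<mu> by (auto simp: space_prob_algebra)
    then show "c = l" using l by (rule LIMSEQ_unique)
  qed
  with l show ?thesis by simp
qed

lemma h_bounds:
  assumes "\<omega> \<in> space P" "x \<in> space X"
  shows "1 / H \<le> h \<omega> x" "h \<omega> x \<le> H"
  using h_ratio_bounds[OF assms nu] h_ratio_tendsto[OF assms nu]
  by (auto intro: LIMSEQ_le_const LIMSEQ_le_const2)

lemma h_pos: "\<omega> \<in> space P \<Longrightarrow> x \<in> space X \<Longrightarrow> 0 < h \<omega> x"
  using h_bounds(1)[of \<omega> x] H_ge_1 by (smt (verit) divide_pos_pos)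

text \<open>\<open>h_fun\<close> is given pointwise by a unique description; measurability comes
  from the limit along the single law \<nu>, whose approximants are explicit.\<close>

lemma measurable_h[measurable]: "(\<lambda>(\<omega>, x). h \<omega> x) \<in> borel_measurable (P \<Otimes>\<^sub>M X)"
proof (rule borel_measurable_LIMSEQ_real)
  let ?f = "\<lambda>n z. q n (fst z) (snd z) * (\<integral>x. q n (shift_pow (- int n) (fst z)) x \<partial>\<nu>)
    / (\<integral>x. q (n + n) (shift_pow (- int n) (fst z)) x \<partial>\<nu>)"
  have m: "(\<lambda>z. q n (fst z) (snd z)) \<in> borel_measurable (P \<Otimes>\<^sub>M X)" for n
    using measurable_q by (simp add: split_beta')
  have i: "(\<lambda>z. \<integral>x. q k (shift_pow j (fst z)) x \<partial>\<nu>) \<in> borel_measurable (P \<Otimes>\<^sub>M X)" for k j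
  proof -
    have "(\<lambda>(z, x). q k (shift_pow j (fst z)) x) \<in> borel_measurable ((P \<Otimes>\<^sub>M X) \<Otimes>\<^sub>M \<nu>)"
      using measurable_compose[OF _ m[of k], of "\<lambda>y. (shift_pow j (fst (fst y)), snd y)" "(P \<Otimes>\<^sub>M X) \<Otimes>\<^sub>M \<nu>"] nu(2)
      by (simp add: split_beta' measurable_ident_sets cong: measurable_cong_sets)
    then show ?thesis by (rule nu.borel_measurable_lebesgue_integral)
  qed
  show "?f n \<in> borel_measurable (P \<Otimes>\<^sub>M X)" for n using m i by measurable
  fix z assume "z \<in> space (P \<Otimes>\<^sub>M X)"
  then have z: "fst z \<in> space P" "snd z \<in> space X" by (auto simp: space_pair_measure)
  show "(\<lambda>n. ?f n z) \<longlonglongrightarrow> (case z of (\<omega>, x) \<Rightarrow> h \<omega> x)"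
    using h_ratio_tendsto[OF z nu] unfolding h_ratio_eq[OF z nu] by (simp add: split_beta')
qed

lemma measurable_h_section: "\<omega> \<in> space P \<Longrightarrow> h \<omega> \<in> borel_measurable X"
  using measurable_compose[OF measurable_Pair1' measurable_h] by simp

text \<open>\<open>Q\<^sup>\<omega>\<close> maps the approximants of \<open>h\<^sup>\<theta>\<^sup>\<omega>\<close> to multiples of those of \<open>h\<^sup>\<omega>\<close>, so the factor
  converges to a number that does not depend on the point.\<close>

lemma h_eigen_exists:
  assumes \<omega>: "\<omega> \<in> space P"
  shows "\<exists>l. \<forall>x\<in>space X. G \<omega> x * (\<integral>y. h (seq_shift \<omega>) y \<partial>(M \<omega> x)) = l * h \<omega> x"
proof -
  define s where "s n \<omega> = (\<integral>x. q n (shift_pow (- int n) \<omega>) x \<partial>\<nu>) / (\<integral>x. q (n + n) (shift_pow (- int n) \<omega>) x \<partial>\<nu>)" for n \<omega>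
  have hs: "h_ratio X G M \<nu> \<omega> x n = q n \<omega> x * s n \<omega>" if "\<omega> \<in> space P" "x \<in> space X" for \<omega> x n
    unfolding h_ratio_eq[OF that nu] s_def by simp
  have spos: "0 < s n \<omega>" if "\<omega> \<in> space P" for n \<omega>
    unfolding s_def using q_integrable_nu(2)[OF shift_pow_space[OF that]] by simp
  \<comment> \<open>Integrating the n-th approximant at the shifted environment and multiplying by
    \<open>G\<close> gives \<open>q (Suc n) \<omega> x * s n (seq_shift \<omega>)\<close>, which is
    \<open>t n\<close> times the approximant of index n + 1 at \<omega>. The factor is free of x,
    hence so is its limit.\<close>
  define t where "t n = s n (seq_shift \<omega>) / s (Suc n) \<omega>" for n
  have lim: "t \<longlonglongrightarrow> G \<omega> x * (\<integral>y. h (seq_shift \<omega>) y \<partial>(M \<omega> x)) / h \<omega> x" if x: "x \<in> space X" for x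
  proof -
    interpret Mx: prob_space "M \<omega> x" using \<omega> x by (rule M_prob)
    note [measurable_cong] = M_sets[OF \<omega> x]
    note \<omega>' = T_space[OF \<omega>]
    note [measurable] = measurable_h_section[OF \<omega>'] measurable_q_section[OF \<omega>']
    have "(\<lambda>n. \<integral>y. q n (seq_shift \<omega>) y * s n (seq_shift \<omega>) \<partial>(M \<omega> x)) \<longlonglongrightarrow> (\<integral>y. h (seq_shift \<omega>) y \<partial>(M \<omega> x))"
    proof (rule integral_dominated_convergence[where w="\<lambda>_. H"])
      show "AE y in M \<omega> x. (\<lambda>n. q n (seq_shift \<omega>) y * s n (seq_shift \<omega>)) \<longlonglongrightarrow> h (seq_shift \<omega>) y"
        using h_ratio_tendsto[OF \<omega>' _ nu] by (intro AE_I2) (simp add: M_space[OF \<omega> x] hs[OF \<omega>', symmetric])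
      show "AE y in M \<omega> x. norm (q n (seq_shift \<omega>) y * s n (seq_shift \<omega>)) \<le> H" for n
      proof (rule AE_I2)
        fix y assume "y \<in> space (M \<omega> x)"
        then have y: "y \<in> space X" by (simp add: M_space[OF \<omega> x])
        show "norm (q n (seq_shift \<omega>) y * s n (seq_shift \<omega>)) \<le> H"
          using h_ratio_bounds(2)[OF \<omega>' y nu, of n] q_pos[OF \<omega>' y, of n] spos[OF \<omega>', of n] by (simp add: hs[OF \<omega>' y])
      qed
    qed simp_all
    then have "(\<lambda>n. G \<omega> x * (\<integral>y. q n (seq_shift \<omega>) y * s n (seq_shift \<omega>) \<partial>(M \<omega> x))) \<longlonglongrightarrow> G \<omega> x * (\<integral>y. h (seq_shift \<omega>) y \<partial>(M \<omega> x))"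
      by (rule tendsto_mult_left)
    moreover have "(\<lambda>n. h_ratio X G M \<nu> \<omega> x (Suc n)) \<longlonglongrightarrow> h \<omega> x"
      using h_ratio_tendsto[OF \<omega> x nu] by (rule LIMSEQ_Suc)
    ultimately have "(\<lambda>n. (G \<omega> x * (\<integral>y. q n (seq_shift \<omega>) y * s n (seq_shift \<omega>) \<partial>(M \<omega> x))) / h_ratio X G M \<nu> \<omega> x (Suc n))
        \<longlonglongrightarrow> G \<omega> x * (\<integral>y. h (seq_shift \<omega>) y \<partial>(M \<omega> x)) / h \<omega> x"
      using h_pos[OF \<omega> x] by (intro tendsto_divide) auto
    moreover have "(G \<omega> x * (\<integral>y. q n (seq_shift \<omega>) y * s n (seq_shift \<omega>) \<partial>(M \<omega> x))) / h_ratio X G M \<nu> \<omega> x (Suc n) = t n" for n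
      using q_integrable_M(2)[OF \<omega> x, of n] G_pos[OF \<omega> x] spos[OF \<omega>, of "Suc n"]
      by (simp add: hs[OF \<omega> x] t_def)
    ultimately show ?thesis by simp
  qed
  have "G \<omega> x * (\<integral>y. h (seq_shift \<omega>) y \<partial>(M \<omega> x)) / h \<omega> x = lim t" if "x \<in> space X" for x
    using limI[OF lim[OF that]] by simp
  then show ?thesis using h_pos[OF \<omega>] by (intro exI[of _ "lim t"]) (metis less_irrefl nonzero_divide_eq_eq)
qed

text \<open>The random eigenvalue of the unnormalised kernel. On \<open>space P\<close> the choice
  is unique, because h is positive and X is nonempty.\<close>

definition "eigval \<omega> = (SOME l. \<forall>x\<in>space X. G \<omega> x * (\<integral>y. h (seq_shift \<omega>) y \<partial>(M \<omega> x)) = l * h \<omega> x)"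

lemma h_eigen:
  "\<omega> \<in> space P \<Longrightarrow> x \<in> space X \<Longrightarrow> G \<omega> x * (\<integral>y. h (seq_shift \<omega>) y \<partial>(M \<omega> x)) = eigval \<omega> * h \<omega> x"
  using someI_ex[OF h_eigen_exists] unfolding eigval_def by blast

lemma h_integrable:
  assumes "\<omega> \<in> space P" "prob_space \<mu>" "sets \<mu> = sets X"
  shows "integrable \<mu> (h \<omega>)" "1 / H \<le> (\<integral>x. h \<omega> x \<partial>\<mu>)" "(\<integral>x. h \<omega> x \<partial>\<mu>) \<le> H"
proof -
  interpret \<mu>: prob_space \<mu> by fact
  have sp: "space \<mu> = space X" using assms by (intro sets_eq_imp_space_eq)
  have bound: "\<bar>h \<omega> x\<bar> \<le> H" if "x \<in> space X" for x
    using h_bounds(2)[OF assms(1) that] h_pos[OF assms(1) that] by simp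
  have "h \<omega> \<in> borel_measurable \<mu>" using measurable_h_section[OF assms(1)] assms(3) by (simp cong: measurable_cong_sets)
  then show int: "integrable \<mu> (h \<omega>)"
    using bound by (intro \<mu>.integrable_const_bound[where B=H]) (auto simp: sp intro!: AE_I2)
  show "1 / H \<le> (\<integral>x. h \<omega> x \<partial>\<mu>)"
    using int h_bounds(1)[OF assms(1)] by (intro \<mu>.integral_ge_const) (auto simp: sp intro!: AE_I2)
  show "(\<integral>x. h \<omega> x \<partial>\<mu>) \<le> H"
    using int h_bounds(2)[OF assms(1)] by (intro \<mu>.integral_le_const) (auto simp: sp intro!: AE_I2)
qed

lemma eigval_pos: assumes \<omega>: "\<omega> \<in> space P" shows "0 < eigval \<omega>"
proof -
  obtain x where x: "x \<in> space X" using X_nonempty by blast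
  have "0 < (\<integral>y. h (seq_shift \<omega>) y \<partial>(M \<omega> x))"
    using h_integrable(2)[OF T_space[OF \<omega>] M_prob[OF \<omega> x] M_sets[OF \<omega> x]] H_ge_1
    by (smt (verit) divide_pos_pos)
  then have "0 < eigval \<omega> * h \<omega> x" using h_eigen[OF \<omega> x] G_pos[OF \<omega> x] by (metis mult_pos_pos)
  then show ?thesis using h_pos[OF \<omega> x] by (simp add: zero_less_mult_iff)
qed

text \<open>The eigenvalue equation at one fixed point exhibits the chosen value as a quotient of
  measurable functions.\<close>

lemma measurable_eigval[measurable]: "eigval \<in> borel_measurable P"
proof -
  obtain x where x: "x \<in> space X" using X_nonempty by blast
  have "(\<lambda>(\<omega>, y). (\<lambda>(\<omega>, x). h \<omega> x) (seq_shift \<omega>, y)) \<in> borel_measurable (P \<Otimes>\<^sub>M X)" by measurable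
  then have 1: "(\<lambda>(\<omega>, y). h (seq_shift \<omega>) y) \<in> borel_measurable (P \<Otimes>\<^sub>M X)" by simp
  have "(\<lambda>\<omega>. M \<omega> x) \<in> measurable P (prob_algebra X)"
    using measurable_compose[OF measurable_Pair2'[OF x] M_measurable] by simp
  from integral_measurable_kernel[OF 1 measurable_prob_algebraD[OF this]]
  have [measurable]: "(\<lambda>\<omega>. \<integral>y. h (seq_shift \<omega>) y \<partial>(M \<omega> x)) \<in> borel_measurable P" .
  have [measurable]: "(\<lambda>\<omega>. G \<omega> x) \<in> borel_measurable P" "(\<lambda>\<omega>. h \<omega> x) \<in> borel_measurable P"
    using measurable_compose[OF measurable_Pair2'[OF x] G_meas] measurable_compose[OF measurable_Pair2'[OF x] measurable_h] by simp_all
  have "eigval \<omega> = G \<omega> x * (\<integral>y. h (seq_shift \<omega>) y \<partial>(M \<omega> x)) / h \<omega> x" if "\<omega> \<in> space P" for \<omega>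
    using h_eigen[OF that x] h_pos[OF that x] by (simp add: field_simps)
  then show ?thesis by (simp cong: measurable_cong)
qed

end

section \<open>The bold kernel\<close>

lemma nn_integral_mixture:
  fixes c :: "'b \<Rightarrow> ennreal"
  assumes J: "finite J" and sets: "\<And>j. j \<in> J \<Longrightarrow> sets (K j) = sets m"
    and m: "\<And>A. A \<in> sets m \<Longrightarrow> emeasure m A = (\<Sum>j\<in>J. c j * emeasure (K j) A)"
    and f: "f \<in> borel_measurable m"
  shows "(\<integral>\<^sup>+x. f x \<partial>m) = (\<Sum>j\<in>J. c j * (\<integral>\<^sup>+x. f x \<partial>(K j)))"
proof -
  have space: "j \<in> J \<Longrightarrow> space (K j) = space m" for j by (rule sets_eq_imp_space_eq[OF sets])
  have Km: "u \<in> borel_measurable (K j)" if "j \<in> J" "u \<in> borel_measurable m" for j and u :: "_ \<Rightarrow> ennreal"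
    using that sets by (simp cong: measurable_cong_sets)
  show ?thesis using f
  proof induction
    case (cong f g)
    have "(\<integral>\<^sup>+x. f x \<partial>(K j)) = (\<integral>\<^sup>+x. g x \<partial>(K j))" if "j \<in> J" for j
      using cong(3) that by (intro nn_integral_cong) (simp add: space)
    moreover have "(\<integral>\<^sup>+x. f x \<partial>m) = (\<integral>\<^sup>+x. g x \<partial>m)"
      using cong(3) by (intro nn_integral_cong) simp
    ultimately show ?case using cong(4) by simp
  next
    case (set A)
    then show ?case using sets m[OF set] by simp
  next
    case (mult u c')
    have "(\<integral>\<^sup>+x. c' * u x \<partial>(K j)) = c' * (\<integral>\<^sup>+x. u x \<partial>(K j))" if "j \<in> J" for j
      by (intro nn_integral_cmult Km[OF that]) fact
    then show ?case using mult.IH mult(2) by (simp add: nn_integral_cmult sum_distrib_left mult_ac)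
  next
    case (add u v)
    have [measurable]: "u \<in> borel_measurable m" "v \<in> borel_measurable m" by fact+
    have "(\<integral>\<^sup>+x. v x + u x \<partial>(K j)) = (\<integral>\<^sup>+x. v x \<partial>(K j)) + (\<integral>\<^sup>+x. u x \<partial>(K j))" if "j \<in> J" for j
      by (intro nn_integral_add Km[OF that]) fact+
    then show ?case using add.IH by (simp add: nn_integral_add distrib_left sum.distrib)
  next
    case (seq U)
    have 1: "(\<integral>\<^sup>+x. (SUP i. U i) x \<partial>(K j)) = (SUP i. \<integral>\<^sup>+x. U i x \<partial>(K j))" if "j \<in> J" for j
      unfolding SUP_apply by (intro nn_integral_monotone_convergence_SUP Km[OF that] seq)
    have 2: "(\<integral>\<^sup>+x. (SUP i. U i) x \<partial>m) = (SUP i. \<integral>\<^sup>+x. U i x \<partial>m)"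
      unfolding SUP_apply by (intro nn_integral_monotone_convergence_SUP seq)
    have inc: "incseq (\<lambda>i. \<integral>\<^sup>+x. U i x \<partial>(K j))" for j
      using \<open>incseq U\<close> by (auto simp: incseq_def le_fun_def intro!: nn_integral_mono)
    have "(SUP i. \<Sum>j\<in>J. c j * (\<integral>\<^sup>+x. U i x \<partial>(K j))) = (\<Sum>j\<in>J. SUP i. c j * (\<integral>\<^sup>+x. U i x \<partial>(K j)))"
      using inc by (intro ennreal_SUP_sum) (auto simp: incseq_def intro: mult_left_mono)
    then show ?case using 1 2 seq.IH by (simp add: SUP_mult_left_ennreal)
  qed
qed

lemma measurable_bold_avg:
  assumes f: "(\<lambda>(\<omega>, x). f \<omega> x) \<in> borel_measurable (P \<Otimes>\<^sub>M X)"
  shows "(\<lambda>(\<omega>, x). bold_avg f N \<omega> x) \<in> borel_measurable (P \<Otimes>\<^sub>M power_measure N X)"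
proof -
  have [measurable]: "(\<lambda>z. f (fst z) (snd z i)) \<in> borel_measurable (P \<Otimes>\<^sub>M power_measure N X)" if "i < N" for i
  proof -
    have [measurable]: "i \<in> {..<N}" using that by simp
    have "(\<lambda>z. (fst z, snd z i)) \<in> measurable (P \<Otimes>\<^sub>M power_measure N X) (P \<Otimes>\<^sub>M X)" by measurable
    from measurable_compose[OF this f] show ?thesis by simp
  qed
  show ?thesis unfolding bold_avg_def split_beta' by measurable
qed

locale importance_sampling = feynman_kac P X Y \<nu> G M \<beta> \<epsilon>m \<epsilon>p
  for P :: "(int \<Rightarrow> 'y) measure" and X :: "'x measure" and Y :: "'y measure" and \<nu> :: "'x measure"
    and G :: "(int \<Rightarrow> 'y) \<Rightarrow> 'x \<Rightarrow> real" and M :: "(int \<Rightarrow> 'y) \<Rightarrow> 'x \<Rightarrow> 'x measure"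
    and \<beta> \<epsilon>m \<epsilon>p :: real +
  fixes N :: nat
    and Mt :: "(int \<Rightarrow> 'y) \<Rightarrow> (nat \<Rightarrow> 'x) \<Rightarrow> (nat \<Rightarrow> 'x) measure"
    and \<phi> :: "(int \<Rightarrow> 'y) \<Rightarrow> (nat \<Rightarrow> 'x) \<Rightarrow> (nat \<Rightarrow> 'x) \<Rightarrow> ennreal"
  assumes N: "1 \<le> N"
    and Mt: "Mt \<in> kernel_class P X \<nu> N"
    and phi: "density_version P (power_measure N X) (bold_M X G M N) Mt \<phi>"
begin

abbreviation "XN \<equiv> power_measure N X"
abbreviation "nuN \<equiv> power_measure N \<nu>"
abbreviation "mix \<equiv> mixture_kernel X G M N"
abbreviation "bM \<equiv> bold_M X G M N"
abbreviation "bG \<equiv> bold_avg G N"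
abbreviation "bh \<equiv> bold_avg h N"

lemma coord_space: "x \<in> space XN \<Longrightarrow> i < N \<Longrightarrow> x i \<in> space X"
  by (auto simp: space_PiM PiE_iff)

lemma sets_nuN: "sets nuN = sets XN"
  using nu(2) by (intro sets_PiM_cong) auto

lemma space_nuN: "space nuN = space XN"
  using sets_nuN by (rule sets_eq_imp_space_eq)

sublocale nuN: prob_space nuN
  by (intro prob_space_PiM nu)

lemma Mt_measurable[measurable]: "(\<lambda>(\<omega>, x). Mt \<omega> x) \<in> measurable (P \<Otimes>\<^sub>M XN) (prob_algebra XN)"
  using Mt by (simp add: kernel_class_def random_markov_kernel_def)

lemma Mt_measurable_section: "\<omega> \<in> space P \<Longrightarrow> Mt \<omega> \<in> measurable XN (prob_algebra XN)"
  using measurable_compose[OF measurable_Pair1' Mt_measurable] by simp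

lemma Mt_prob: "\<omega> \<in> space P \<Longrightarrow> x \<in> space XN \<Longrightarrow> prob_space (Mt \<omega> x)"
  and Mt_sets: "\<omega> \<in> space P \<Longrightarrow> x \<in> space XN \<Longrightarrow> sets (Mt \<omega> x) = sets XN"
  using measurable_space[OF Mt_measurable_section] by (auto simp: space_prob_algebra)

lemma Mt_space: "\<omega> \<in> space P \<Longrightarrow> x \<in> space XN \<Longrightarrow> space (Mt \<omega> x) = space XN"
  by (rule sets_eq_imp_space_eq[OF Mt_sets])

lemma phi_measurable: "(\<lambda>(\<omega>, x, x'). \<phi> \<omega> x x') \<in> borel_measurable (P \<Otimes>\<^sub>M XN \<Otimes>\<^sub>M XN)"
  and density_phi: "\<omega> \<in> space P \<Longrightarrow> x \<in> space XN \<Longrightarrow> density (Mt \<omega> x) (\<phi> \<omega> x) = bM \<omega> x"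
  using phi by (auto simp: density_version_def)

lemma phi_measurable_section:
  assumes "\<omega> \<in> space P" "x \<in> space XN" shows "\<phi> \<omega> x \<in> borel_measurable XN"
proof -
  have "(\<lambda>x'. (\<omega>, x, x')) \<in> measurable XN (P \<Otimes>\<^sub>M XN \<Otimes>\<^sub>M XN)" using assms by measurable
  from measurable_compose[OF this phi_measurable] show ?thesis by simp
qed

lemma bold_avg_le:
  assumes "\<And>i. i < N \<Longrightarrow> f \<omega> (x i) \<le> c" shows "bold_avg f N \<omega> x \<le> c"
proof -
  have "(\<Sum>i<N. f \<omega> (x i)) \<le> (\<Sum>i<N. c)" using assms by (intro sum_mono) auto
  then show ?thesis using N by (simp add: bold_avg_def field_simps)
qed

lemma bold_avg_ge:
  assumes "\<And>i. i < N \<Longrightarrow> c \<le> f \<omega> (x i)" shows "c \<le> bold_avg f N \<omega> x"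
proof -
  have "(\<Sum>i<N. c) \<le> (\<Sum>i<N. f \<omega> (x i))" using assms by (intro sum_mono) auto
  then show ?thesis using N by (simp add: bold_avg_def field_simps)
qed

lemma bh_bounds:
  assumes "\<omega> \<in> space P" "x \<in> space XN"
  shows "1 / H \<le> bh \<omega> x" "bh \<omega> x \<le> H"
  using h_bounds[OF assms(1) coord_space[OF assms(2)]] by (auto intro!: bold_avg_le bold_avg_ge)

lemma inv_H_pos: "0 < 1 / H" using H_ge_1 by simp

lemma bh_pos: "\<omega> \<in> space P \<Longrightarrow> x \<in> space XN \<Longrightarrow> 0 < bh \<omega> x"
  using bh_bounds(1) inv_H_pos by (rule less_le_trans[rotated])

lemma sum_G_pos: assumes "\<omega> \<in> space P" "x \<in> space XN" shows "0 < (\<Sum>j<N. G \<omega> (x j))"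
  using N by (intro sum_pos G_pos assms coord_space) (auto simp: lessThan_empty_iff)

lemma bG_pos: assumes "\<omega> \<in> space P" "x \<in> space XN" shows "0 < bG \<omega> x"
  using sum_G_pos[OF assms] N by (simp add: bold_avg_def)

lemma mix_sets: "sets (mix \<omega> x) = sets X"
  by (simp add: mixture_kernel_def)

lemma mix_space: "space (mix \<omega> x) = space X"
  by (rule sets_eq_imp_space_eq[OF mix_sets])

lemma emeasure_mix:
  assumes \<omega>: "\<omega> \<in> space P" and x: "x \<in> space XN" and A: "A \<in> sets X"
  shows "emeasure (mix \<omega> x) A = (\<Sum>j<N. ennreal (G \<omega> (x j)) / (\<Sum>j<N. ennreal (G \<omega> (x j))) * emeasure (M \<omega> (x j)) A)"
proof -
  define S where "S = (\<Sum>j<N. ennreal (G \<omega> (x j)))"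
  define c where "c j = ennreal (G \<omega> (x j)) / S" for j
  have c: "(\<Sum>j<N. ennreal (G \<omega> (x j)) * emeasure (M \<omega> (x j)) B) / S = (\<Sum>j<N. c j * emeasure (M \<omega> (x j)) B)" for B
    by (simp add: c_def divide_ennreal_def sum_distrib_left mult_ac)
  have "emeasure (mix \<omega> x) A = (\<Sum>j<N. c j * emeasure (M \<omega> (x j)) A)"
  proof (rule emeasure_measure_of[where \<Omega>="space X" and A="sets X"])
    show "mix \<omega> x = measure_of (space X) (sets X) (\<lambda>A. \<Sum>j<N. c j * emeasure (M \<omega> (x j)) A)"
      by (simp add: mixture_kernel_def S_def[symmetric] c)
    show "sets X \<subseteq> Pow (space X)" by (rule sets.space_closed)
    show "A \<in> sets (mix \<omega> x)" using A by (simp add: mix_sets)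
    show "positive (sets (mix \<omega> x)) (\<lambda>A. \<Sum>j<N. c j * emeasure (M \<omega> (x j)) A)" by (simp add: positive_def)
    show "countably_additive (sets (mix \<omega> x)) (\<lambda>A. \<Sum>j<N. c j * emeasure (M \<omega> (x j)) A)"
    proof (rule countably_additiveI)
      fix B :: "nat \<Rightarrow> 'x set" assume B: "range B \<subseteq> sets (mix \<omega> x)" "disjoint_family B"
      have "(\<Sum>i. \<Sum>j<N. c j * emeasure (M \<omega> (x j)) (B i)) = (\<Sum>j<N. \<Sum>i. c j * emeasure (M \<omega> (x j)) (B i))"
        by (rule suminf_sum) simp
      also have "\<dots> = (\<Sum>j<N. c j * emeasure (M \<omega> (x j)) (\<Union>i. B i))"
        using B by (intro sum.cong refl) (subst ennreal_suminf_cmult, subst suminf_emeasure, auto simp: mix_sets M_sets[OF \<omega> coord_space[OF x]])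
      finally show "(\<Sum>i. \<Sum>j<N. c j * emeasure (M \<omega> (x j)) (B i)) = (\<Sum>j<N. c j * emeasure (M \<omega> (x j)) (\<Union>i. B i))" .
    qed
  qed
  then show ?thesis by (simp add: c_def S_def)
qed

lemma nn_integral_mix:
  assumes \<omega>: "\<omega> \<in> space P" and x: "x \<in> space XN" and f: "f \<in> borel_measurable X"
  shows "(\<integral>\<^sup>+y. f y \<partial>(mix \<omega> x)) = (\<Sum>j<N. ennreal (G \<omega> (x j)) / (\<Sum>j<N. ennreal (G \<omega> (x j))) * (\<integral>\<^sup>+y. f y \<partial>(M \<omega> (x j))))"
  using f M_sets[OF \<omega> coord_space[OF x]] emeasure_mix[OF \<omega> x]
  by (intro nn_integral_mixture) (auto simp: mix_sets cong: measurable_cong_sets)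

lemma sum_ennreal_G:
  assumes "\<omega> \<in> space P" "x \<in> space XN"
  shows "(\<Sum>j<N. ennreal (G \<omega> (x j))) = ennreal (\<Sum>j<N. G \<omega> (x j))"
  using G_pos[OF assms(1) coord_space[OF assms(2)]] by (intro sum_ennreal) (auto intro: less_imp_le)

lemma mix_weights:
  assumes "\<omega> \<in> space P" "x \<in> space XN"
  shows "(\<Sum>j<N. ennreal (G \<omega> (x j)) / (\<Sum>j<N. ennreal (G \<omega> (x j)))) = 1"
proof -
  have "(\<Sum>j<N. ennreal (G \<omega> (x j)) / (\<Sum>j<N. ennreal (G \<omega> (x j))))
      = (\<Sum>j<N. ennreal (G \<omega> (x j))) / (\<Sum>j<N. ennreal (G \<omega> (x j)))"
    unfolding divide_ennreal_def by (rule sum_distrib_right[symmetric])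
  also have "\<dots> = 1" unfolding sum_ennreal_G[OF assms] using sum_G_pos[OF assms] by (simp add: divide_ennreal)
  finally show ?thesis .
qed

lemma mix_prob: assumes "\<omega> \<in> space P" "x \<in> space XN" shows "prob_space (mix \<omega> x)"
proof
  have "emeasure (M \<omega> (x j)) (space X) = 1" if "j < N" for j
    using prob_space.emeasure_space_1[OF M_prob] M_space assms coord_space[OF assms(2) that] by simp
  then show "emeasure (mix \<omega> x) (space (mix \<omega> x)) = 1"
    using emeasure_mix[OF assms sets.top] mix_weights[OF assms] by (simp add: mix_space)
qed

lemma mix_bounds:
  assumes \<omega>: "\<omega> \<in> space P" and x: "x \<in> space XN" and A: "A \<in> sets X"
  shows "\<epsilon>m * measure \<nu> A \<le> measure (mix \<omega> x) A" "measure (mix \<omega> x) A \<le> \<epsilon>p * measure \<nu> A"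
proof -
  interpret mix: prob_space "mix \<omega> x" using \<omega> x by (rule mix_prob)
  define c where "c j = ennreal (G \<omega> (x j)) / (\<Sum>j<N. ennreal (G \<omega> (x j)))" for j
  have c: "(\<Sum>j<N. c j) = 1" unfolding c_def by (rule mix_weights[OF \<omega> x])
  have M: "ennreal (\<epsilon>m * measure \<nu> A) \<le> emeasure (M \<omega> (x j)) A \<and> emeasure (M \<omega> (x j)) A \<le> ennreal (\<epsilon>p * measure \<nu> A)"
    if "j < N" for j
  proof -
    interpret Mx: prob_space "M \<omega> (x j)" using M_prob[OF \<omega> coord_space[OF x that]] .
    show ?thesis using M_le[OF \<omega> coord_space[OF x that] A] M_ge[OF \<omega> coord_space[OF x that] A]
      by (simp add: Mx.emeasure_eq_measure ennreal_leI)
  qed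
  have e: "emeasure (mix \<omega> x) A = (\<Sum>j<N. c j * emeasure (M \<omega> (x j)) A)"
    unfolding c_def by (rule emeasure_mix[OF \<omega> x A])
  have "ennreal (\<epsilon>m * measure \<nu> A) = (\<Sum>j<N. c j * ennreal (\<epsilon>m * measure \<nu> A))"
    by (simp add: sum_distrib_right[symmetric] c)
  also have "\<dots> \<le> emeasure (mix \<omega> x) A"
    unfolding e using M by (intro sum_mono mult_left_mono) auto
  finally show "\<epsilon>m * measure \<nu> A \<le> measure (mix \<omega> x) A"
    by (simp add: mix.emeasure_eq_measure)
  have "emeasure (mix \<omega> x) A \<le> (\<Sum>j<N. c j * ennreal (\<epsilon>p * measure \<nu> A))"
    unfolding e using M by (intro sum_mono mult_left_mono) auto
  also have "\<dots> = ennreal (\<epsilon>p * measure \<nu> A)"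
    by (simp add: sum_distrib_right[symmetric] c)
  finally show "measure (mix \<omega> x) A \<le> \<epsilon>p * measure \<nu> A"
    using eps_pos by (simp add: mix.emeasure_eq_measure)
qed

lemma bM_sets: "sets (bM \<omega> x) = sets XN"
  unfolding bold_M_def using mix_sets by (intro sets_PiM_cong) auto

lemma bM_space: "space (bM \<omega> x) = space XN"
  by (rule sets_eq_imp_space_eq[OF bM_sets])

lemma bM_prob: "\<omega> \<in> space P \<Longrightarrow> x \<in> space XN \<Longrightarrow> prob_space (bM \<omega> x)"
  unfolding bold_M_def by (intro prob_space_PiM mix_prob)

lemma bM_le:
  assumes "\<omega> \<in> space P" "x \<in> space XN" "f \<in> borel_measurable XN"
  shows "(\<integral>\<^sup>+z. f z \<partial>(bM \<omega> x)) \<le> ennreal (\<epsilon>p ^ N) * (\<integral>\<^sup>+z. f z \<partial>nuN)"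
  using nn_integral_PiM_le_scaled[OF mix_prob[OF assms(1,2)] nu(1), of \<epsilon>p "{..<N}" f]
    mix_bounds(2)[OF assms(1,2)] eps_pos nu(2) mix_sets assms(3) sets_nuN
  by (simp add: bold_M_def cong: measurable_cong_sets)

lemma bM_ge:
  assumes "\<omega> \<in> space P" "x \<in> space XN" "f \<in> borel_measurable XN"
  shows "ennreal (\<epsilon>m ^ N) * (\<integral>\<^sup>+z. f z \<partial>nuN) \<le> (\<integral>\<^sup>+z. f z \<partial>(bM \<omega> x))"
  using nn_integral_PiM_ge_scaled[OF mix_prob[OF assms(1,2)] nu(1), of \<epsilon>m "{..<N}" f]
    mix_bounds(1)[OF assms(1,2)] eps_pos nu(2) mix_sets assms(3) sets_nuN
  by (simp add: bold_M_def cong: measurable_cong_sets)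

lemma nn_integral_power_component:
  assumes "prob_space \<mu>" and i: "i < N" and f: "f \<in> borel_measurable \<mu>"
  shows "(\<integral>\<^sup>+z. f (z i) \<partial>(power_measure N \<mu>)) = (\<integral>\<^sup>+y. f y \<partial>\<mu>)"
proof -
  have "(\<integral>\<^sup>+y. f y \<partial>\<mu>) = (\<integral>\<^sup>+y. f y \<partial>(distr (power_measure N \<mu>) \<mu> (\<lambda>z. z i)))"
    using distr_PiM_component[of "{..<N}" "\<lambda>_. \<mu>" i] assms by simp
  also have "\<dots> = (\<integral>\<^sup>+z. f (z i) \<partial>(power_measure N \<mu>))"
    using i f by (intro nn_integral_distr) auto
  finally show ?thesis by simp
qed

lemma bh_measurable[measurable]: "(\<lambda>(\<omega>, x). bh \<omega> x) \<in> borel_measurable (P \<Otimes>\<^sub>M XN)"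
  by (rule measurable_bold_avg[OF measurable_h])

lemma bG_measurable[measurable]: "(\<lambda>(\<omega>, x). bG \<omega> x) \<in> borel_measurable (P \<Otimes>\<^sub>M XN)"
  by (rule measurable_bold_avg[OF G_meas])

lemma bh_measurable_section: "\<omega> \<in> space P \<Longrightarrow> bh \<omega> \<in> borel_measurable XN"
  using measurable_compose[OF measurable_Pair1' bh_measurable] by simp

text \<open>Each coordinate under \<open>bM\<close> has law \<open>mix\<close>, so the mean of the
  average of h is the integral of h under the mixture, to which the eigenvalue equation applies term
  by term. Hence \<open>bh\<close> is an eigenfunction of the N-particle system with the same
  eigenvalue.\<close>

lemma nn_integral_bh:
  assumes \<omega>: "\<omega> \<in> space P" and x: "x \<in> space XN"
  shows "(\<integral>\<^sup>+z. ennreal (bh (seq_shift \<omega>) z) \<partial>(bM \<omega> x)) = ennreal (eigval \<omega> * bh \<omega> x / bG \<omega> x)"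
proof -
  let ?h = "h (seq_shift \<omega>)"
  note \<omega>' = T_space[OF \<omega>]
  have hm: "?h \<in> borel_measurable X" by (rule measurable_h_section[OF \<omega>'])
  then have hm': "?h \<in> borel_measurable (mix \<omega> x)" by (simp add: mix_sets cong: measurable_cong_sets)
  define S where "S = (\<Sum>j<N. G \<omega> (x j))"
  have S: "0 < S" unfolding S_def by (rule sum_G_pos[OF \<omega> x])
  have "(\<integral>\<^sup>+z. ennreal (bh (seq_shift \<omega>) z) \<partial>(bM \<omega> x)) = (\<integral>\<^sup>+z. ennreal (1 / N) * (\<Sum>i<N. ennreal (?h (z i))) \<partial>(bM \<omega> x))"
  proof (rule nn_integral_cong)
    fix z assume "z \<in> space (bM \<omega> x)"
    then have "?h (z i) \<ge> 0" if "i < N" for i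
      using h_pos[OF \<omega>' coord_space[OF _ that]] by (simp add: bM_space less_imp_le)
    then have "(\<Sum>i<N. ennreal (?h (z i))) = ennreal (\<Sum>i<N. ?h (z i))" by (intro sum_ennreal) auto
    then show "ennreal (bh (seq_shift \<omega>) z) = ennreal (1 / N) * (\<Sum>i<N. ennreal (?h (z i)))"
      by (simp add: bold_avg_def ennreal_mult'[symmetric])
  qed
  also have "\<dots> = ennreal (1 / N) * (\<Sum>i<N. \<integral>\<^sup>+z. ennreal (?h (z i)) \<partial>(bM \<omega> x))"
  proof -
    have m: "(\<lambda>z. ennreal (?h (z i))) \<in> borel_measurable (bM \<omega> x)" if "i < N" for i
    proof -
      have [measurable]: "i \<in> {..<N}" using that by simp
      show ?thesis unfolding bold_M_def using hm' by measurable
    qed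
    then have "(\<integral>\<^sup>+z. (\<Sum>i<N. ennreal (?h (z i))) \<partial>(bM \<omega> x)) = (\<Sum>i<N. \<integral>\<^sup>+z. ennreal (?h (z i)) \<partial>(bM \<omega> x))"
      by (intro nn_integral_sum) auto
    moreover have "(\<lambda>z. \<Sum>i<N. ennreal (?h (z i))) \<in> borel_measurable (bM \<omega> x)"
      using m by (intro borel_measurable_sum) auto
    ultimately show ?thesis by (simp add: nn_integral_cmult)
  qed
  also have "(\<Sum>i<N. \<integral>\<^sup>+z. ennreal (?h (z i)) \<partial>(bM \<omega> x)) = (\<Sum>i<N. \<integral>\<^sup>+y. ennreal (?h y) \<partial>(mix \<omega> x))"
    unfolding bold_M_def using hm' mix_prob[OF \<omega> x]
    by (intro sum.cong refl nn_integral_power_component[where f="\<lambda>y. ennreal (?h y)"]) auto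
  also have "\<dots> = of_nat N * (\<integral>\<^sup>+y. ennreal (?h y) \<partial>(mix \<omega> x))" by simp
  also have "ennreal (1 / N) * (of_nat N * (\<integral>\<^sup>+y. ennreal (?h y) \<partial>(mix \<omega> x))) = (\<integral>\<^sup>+y. ennreal (?h y) \<partial>(mix \<omega> x))"
    using N by (simp add: mult.assoc[symmetric] ennreal_of_nat_eq_real_of_nat ennreal_mult'[symmetric])
  also have "\<dots> = (\<Sum>j<N. ennreal (G \<omega> (x j)) / ennreal S * (\<integral>\<^sup>+y. ennreal (?h y) \<partial>(M \<omega> (x j))))"
    using hm by (subst nn_integral_mix[OF \<omega> x]) (simp_all add: sum_ennreal_G[OF \<omega> x] S_def)
  also have "\<dots> = (\<Sum>j<N. ennreal (eigval \<omega> * h \<omega> (x j) / S))"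
  proof (intro sum.cong refl)
    fix j assume "j \<in> {..<N}"
    then have xj: "x j \<in> space X" using coord_space[OF x] by simp
    have "(\<integral>\<^sup>+y. ennreal (?h y) \<partial>(M \<omega> (x j))) = ennreal (\<integral>y. ?h y \<partial>(M \<omega> (x j)))"
      using h_integrable(1)[OF \<omega>' M_prob[OF \<omega> xj] M_sets[OF \<omega> xj]] h_pos[OF \<omega>']
      by (intro nn_integral_eq_integral) (auto simp: M_space[OF \<omega> xj] less_imp_le)
    then show "ennreal (G \<omega> (x j)) / ennreal S * (\<integral>\<^sup>+y. ennreal (?h y) \<partial>(M \<omega> (x j))) = ennreal (eigval \<omega> * h \<omega> (x j) / S)"
      using S G_pos[OF \<omega> xj] by (simp add: divide_ennreal ennreal_mult'[symmetric] h_eigen[OF \<omega> xj, symmetric])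
  qed
  also have "\<dots> = ennreal (\<Sum>j<N. eigval \<omega> * h \<omega> (x j) / S)"
    using S eigval_pos[OF \<omega>] h_pos[OF \<omega> coord_space[OF x]] by (intro sum_ennreal) (auto intro!: less_imp_le)
  also have "(\<Sum>j<N. eigval \<omega> * h \<omega> (x j) / S) = eigval \<omega> * bh \<omega> x / bG \<omega> x"
  proof -
    have "(\<Sum>j<N. eigval \<omega> * h \<omega> (x j) / S) = eigval \<omega> * (\<Sum>j<N. h \<omega> (x j)) / S"
      by (simp add: sum_distrib_left sum_divide_distrib)
    also have "\<dots> = eigval \<omega> * bh \<omega> x / bG \<omega> x"
      using S N by (simp add: bold_avg_def S_def[symmetric])
    finally show ?thesis .
  qed
  finally show ?thesis .
qed

section \<open>The optimal kernel and its density\<close>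

text \<open>The density of the h-transformed kernel with respect to \<open>bM\<close>: by
  \<open>nn_integral_bh\<close>, the remaining factor is the reciprocal of the integral of
  \<open>bh\<close> under \<open>bM\<close>.\<close>

definition "cf \<omega> x x' = bG \<omega> x * bh (seq_shift \<omega>) x' / (eigval \<omega> * bh \<omega> x)"

definition "w \<omega> x x' = ennreal (cf \<omega> x x') * \<phi> \<omega> x x'"

text \<open>Based on \<open>Mt\<close>, so that \<open>w\<close> is its density by definition;
  \<open>nn_integral_bP\<close> gives the equivalent form with density \<open>cf\<close> with
  respect to \<open>bM\<close>.\<close>

definition "bP \<omega> x = density (Mt \<omega> x) (w \<omega> x)"

lemma nn_integral_bh_bounds:
  assumes \<omega>: "\<omega> \<in> space P" and x: "x \<in> space XN"
  shows "1 / H \<le> eigval \<omega> * bh \<omega> x / bG \<omega> x" "eigval \<omega> * bh \<omega> x / bG \<omega> x \<le> H"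
proof -
  interpret bM: prob_space "bM \<omega> x" by (rule bM_prob[OF \<omega> x])
  note b = bh_bounds[OF T_space[OF \<omega>]]
  have p: "0 < eigval \<omega> * bh \<omega> x / bG \<omega> x" using eigval_pos[OF \<omega>] bh_pos[OF \<omega> x] bG_pos[OF \<omega> x] by simp
  have "(\<integral>\<^sup>+z. ennreal (1 / H) \<partial>(bM \<omega> x)) \<le> (\<integral>\<^sup>+z. ennreal (bh (seq_shift \<omega>) z) \<partial>(bM \<omega> x))"
    using b by (intro nn_integral_mono ennreal_leI) (simp add: bM_space)
  then show "1 / H \<le> eigval \<omega> * bh \<omega> x / bG \<omega> x"
    using p by (simp add: nn_integral_bh[OF \<omega> x] bM.emeasure_space_1)
  have "(\<integral>\<^sup>+z. ennreal (bh (seq_shift \<omega>) z) \<partial>(bM \<omega> x)) \<le> (\<integral>\<^sup>+z. ennreal H \<partial>(bM \<omega> x))"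
    using b by (intro nn_integral_mono ennreal_leI) (simp add: bM_space)
  then show "eigval \<omega> * bh \<omega> x / bG \<omega> x \<le> H"
    using H_ge_1 by (simp add: nn_integral_bh[OF \<omega> x] bM.emeasure_space_1)
qed

lemma cf_eq: "cf \<omega> x x' = bh (seq_shift \<omega>) x' / (eigval \<omega> * bh \<omega> x / bG \<omega> x)"
  by (simp add: cf_def)

lemma cf_bounds:
  assumes \<omega>: "\<omega> \<in> space P" and x: "x \<in> space XN" and x': "x' \<in> space XN"
  shows "1 / H\<^sup>2 \<le> cf \<omega> x x'" "cf \<omega> x x' \<le> H\<^sup>2"
proof -
  define I where "I = eigval \<omega> * bh \<omega> x / bG \<omega> x"
  have I: "1 / H \<le> I" "I \<le> H" using nn_integral_bh_bounds[OF \<omega> x] by (auto simp: I_def)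
  have Ip: "0 < I" using I inv_H_pos by linarith
  note b = bh_bounds[OF T_space[OF \<omega>] x'] less_imp_le[OF bh_pos[OF T_space[OF \<omega>] x']]
  have H: "0 < H" using H_ge_1 by simp
  have "1 / H\<^sup>2 = (1 / H) / H" by (simp add: power2_eq_square)
  also have "\<dots> \<le> bh (seq_shift \<omega>) x' / I" using b I Ip H by (intro frac_le) auto
  finally show "1 / H\<^sup>2 \<le> cf \<omega> x x'" unfolding cf_eq I_def .
  have "bh (seq_shift \<omega>) x' / I \<le> H / (1 / H)" using b I Ip H by (intro frac_le) auto
  then show "cf \<omega> x x' \<le> H\<^sup>2" unfolding cf_eq I_def[symmetric] by (simp add: power2_eq_square)
qed

lemma cf_pos: "\<omega> \<in> space P \<Longrightarrow> x \<in> space XN \<Longrightarrow> x' \<in> space XN \<Longrightarrow> 0 < cf \<omega> x x'"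
  using bG_pos bh_pos T_space eigval_pos by (simp add: cf_def)

lemma cf_measurable: "(\<lambda>(\<omega>, x, x'). cf \<omega> x x') \<in> borel_measurable (P \<Otimes>\<^sub>M XN \<Otimes>\<^sub>M XN)"
proof -
  have 1: "(\<lambda>z. bh (fst z) (snd z)) \<in> borel_measurable (P \<Otimes>\<^sub>M XN)" "(\<lambda>z. bG (fst z) (snd z)) \<in> borel_measurable (P \<Otimes>\<^sub>M XN)"
    using bh_measurable bG_measurable by (simp_all add: split_beta')
  have [measurable]: "(\<lambda>z. bh (fst z) (fst (snd z))) \<in> borel_measurable (P \<Otimes>\<^sub>M XN \<Otimes>\<^sub>M XN)"
    using measurable_compose[OF _ 1(1), of "\<lambda>z. (fst z, fst (snd z))"] by simp
  have [measurable]: "(\<lambda>z. bG (fst z) (fst (snd z))) \<in> borel_measurable (P \<Otimes>\<^sub>M XN \<Otimes>\<^sub>M XN)"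
    using measurable_compose[OF _ 1(2), of "\<lambda>z. (fst z, fst (snd z))"] by simp
  have [measurable]: "(\<lambda>z. bh (seq_shift (fst z)) (snd (snd z))) \<in> borel_measurable (P \<Otimes>\<^sub>M XN \<Otimes>\<^sub>M XN)"
    using measurable_compose[OF _ 1(1), of "\<lambda>z. (seq_shift (fst z), snd (snd z))"] by simp
  show ?thesis unfolding cf_def split_beta' by measurable
qed

lemma w_measurable: "(\<lambda>(\<omega>, x, x'). w \<omega> x x') \<in> borel_measurable (P \<Otimes>\<^sub>M XN \<Otimes>\<^sub>M XN)"
proof -
  have [measurable]: "(\<lambda>z. cf (fst z) (fst (snd z)) (snd (snd z))) \<in> borel_measurable (P \<Otimes>\<^sub>M XN \<Otimes>\<^sub>M XN)"
    "(\<lambda>z. \<phi> (fst z) (fst (snd z)) (snd (snd z))) \<in> borel_measurable (P \<Otimes>\<^sub>M XN \<Otimes>\<^sub>M XN)"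
    using cf_measurable phi_measurable by (simp_all add: split_beta')
  show ?thesis unfolding w_def split_beta' by measurable
qed

lemma w_measurable_section:
  assumes "\<omega> \<in> space P" "x \<in> space XN" shows "w \<omega> x \<in> borel_measurable XN"
proof -
  have "(\<lambda>x'. (\<omega>, x, x')) \<in> measurable XN (P \<Otimes>\<^sub>M XN \<Otimes>\<^sub>M XN)" using assms by measurable
  from measurable_compose[OF this w_measurable] show ?thesis by simp
qed

lemma cf_measurable_section:
  assumes "\<omega> \<in> space P" "x \<in> space XN" shows "cf \<omega> x \<in> borel_measurable XN"
proof -
  have "(\<lambda>x'. (\<omega>, x, x')) \<in> measurable XN (P \<Otimes>\<^sub>M XN \<Otimes>\<^sub>M XN)" using assms by measurable
  from measurable_compose[OF this cf_measurable] show ?thesis by simp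
qed

lemma bP_sets: "\<omega> \<in> space P \<Longrightarrow> x \<in> space XN \<Longrightarrow> sets (bP \<omega> x) = sets XN"
  by (simp add: bP_def Mt_sets)

lemma bP_space: "\<omega> \<in> space P \<Longrightarrow> x \<in> space XN \<Longrightarrow> space (bP \<omega> x) = space XN"
  by (rule sets_eq_imp_space_eq[OF bP_sets])

lemma nn_integral_bP:
  assumes \<omega>: "\<omega> \<in> space P" and x: "x \<in> space XN" and f: "f \<in> borel_measurable XN"
  shows "(\<integral>\<^sup>+z. f z \<partial>(bP \<omega> x)) = (\<integral>\<^sup>+z. ennreal (cf \<omega> x z) * f z \<partial>(bM \<omega> x))"
proof -
  note [measurable_cong] = Mt_sets[OF \<omega> x]
  note [measurable] = f w_measurable_section[OF \<omega> x] cf_measurable_section[OF \<omega> x] phi_measurable_section[OF \<omega> x]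
  have "(\<integral>\<^sup>+z. f z \<partial>(bP \<omega> x)) = (\<integral>\<^sup>+z. w \<omega> x z * f z \<partial>(Mt \<omega> x))"
    unfolding bP_def by (rule nn_integral_density) measurable
  also have "\<dots> = (\<integral>\<^sup>+z. \<phi> \<omega> x z * (ennreal (cf \<omega> x z) * f z) \<partial>(Mt \<omega> x))"
    by (simp add: w_def mult_ac)
  also have "\<dots> = (\<integral>\<^sup>+z. ennreal (cf \<omega> x z) * f z \<partial>density (Mt \<omega> x) (\<phi> \<omega> x))"
    by (rule nn_integral_density[symmetric]) measurable
  finally show ?thesis by (simp add: density_phi[OF \<omega> x])
qed

lemma bP_prob: assumes \<omega>: "\<omega> \<in> space P" and x: "x \<in> space XN" shows "prob_space (bP \<omega> x)"
proof
  define I where "I = eigval \<omega> * bh \<omega> x / bG \<omega> x"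
  have I: "0 < I" using nn_integral_bh_bounds(1)[OF \<omega> x] inv_H_pos unfolding I_def by linarith
  have m: "(\<lambda>z. ennreal (bh (seq_shift \<omega>) z)) \<in> borel_measurable (bM \<omega> x)"
    using bh_measurable_section[OF T_space[OF \<omega>]] bM_sets by (simp cong: measurable_cong_sets)
  have "emeasure (bP \<omega> x) (space (bP \<omega> x)) = (\<integral>\<^sup>+z. 1 \<partial>(bP \<omega> x))" by simp
  also have "\<dots> = (\<integral>\<^sup>+z. ennreal (cf \<omega> x z) * 1 \<partial>(bM \<omega> x))"
    by (rule nn_integral_bP[OF \<omega> x]) simp
  also have "\<dots> = (\<integral>\<^sup>+z. ennreal (bh (seq_shift \<omega>) z) / ennreal I \<partial>(bM \<omega> x))"
    using bh_pos[OF T_space[OF \<omega>]] I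
    by (intro nn_integral_cong) (simp add: cf_eq I_def[symmetric] divide_ennreal less_imp_le bM_space)
  also have "\<dots> = (\<integral>\<^sup>+z. ennreal (bh (seq_shift \<omega>) z) \<partial>(bM \<omega> x)) / ennreal I"
    by (rule nn_integral_divide[OF m])
  also have "\<dots> = 1" using I by (simp add: nn_integral_bh[OF \<omega> x] I_def[symmetric] divide_ennreal)
  finally show "emeasure (bP \<omega> x) (space (bP \<omega> x)) = 1" .
qed

text \<open>Identifies \<open>bP\<close> with the right-hand side of (2), so that (2) says that
  \<open>Mt \<omega> x\<close> and \<open>bP \<omega> x\<close> agree.\<close>

lemma measure_bP:
  assumes \<omega>: "\<omega> \<in> space P" and x: "x \<in> space XN" and B: "B \<in> sets XN"
  shows "measure (bP \<omega> x) B =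
    (LINT x':B|bM \<omega> x. bh (seq_shift \<omega>) x') / (LINT z|bM \<omega> x. bh (seq_shift \<omega>) z)"
proof -
  interpret bM: prob_space "bM \<omega> x" by (rule bM_prob[OF \<omega> x])
  interpret bP: prob_space "bP \<omega> x" by (rule bP_prob[OF \<omega> x])
  note \<omega>' = T_space[OF \<omega>]
  define I where "I = eigval \<omega> * bh \<omega> x / bG \<omega> x"
  have I: "0 < I" using nn_integral_bh_bounds(1)[OF \<omega> x] inv_H_pos unfolding I_def by linarith
  have [measurable_cong]: "sets (bM \<omega> x) = sets XN" by (rule bM_sets)
  note [measurable] = bh_measurable_section[OF \<omega>'] B cf_measurable_section[OF \<omega> x]
  have bh: "\<bar>bh (seq_shift \<omega>) z\<bar> \<le> H" "0 \<le> bh (seq_shift \<omega>) z" if "z \<in> space XN" for z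
    using bh_bounds(2)[OF \<omega>' that] bh_pos[OF \<omega>' that] by auto
  have int: "integrable (bM \<omega> x) (bh (seq_shift \<omega>))"
    using bh by (intro bM.integrable_const_bound[where B=H]) (auto simp: bM_space intro!: AE_I2)
  have tot: "(LINT z|bM \<omega> x. bh (seq_shift \<omega>) z) = I"
  proof -
    have "ennreal (LINT z|bM \<omega> x. bh (seq_shift \<omega>) z) = (\<integral>\<^sup>+z. ennreal (bh (seq_shift \<omega>) z) \<partial>(bM \<omega> x))"
      using int bh by (intro nn_integral_eq_integral[symmetric]) (auto simp: bM_space intro!: AE_I2)
    also have "\<dots> = ennreal I" by (simp add: nn_integral_bh[OF \<omega> x] I_def)
    finally show ?thesis using bh I by (subst (asm) ennreal_inj) (auto simp: bM_space intro!: integral_nonneg_AE AE_I2)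
  qed
  have intB: "integrable (bM \<omega> x) (\<lambda>z. indicator B z * bh (seq_shift \<omega>) z)"
    using integrable_mult_indicator[OF _ int, of B] B by (simp add: bM_sets)
  have nnB: "0 \<le> (\<integral>z. indicator B z * bh (seq_shift \<omega>) z \<partial>(bM \<omega> x))"
    using bh by (intro integral_nonneg_AE AE_I2) (auto simp: bM_space)
  have "emeasure (bP \<omega> x) B = (\<integral>\<^sup>+z. indicator B z \<partial>(bP \<omega> x))" using B by (simp add: bP_sets[OF \<omega> x])
  also have "\<dots> = (\<integral>\<^sup>+z. ennreal (cf \<omega> x z) * indicator B z \<partial>(bM \<omega> x))"
    by (rule nn_integral_bP[OF \<omega> x]) measurable
  also have "\<dots> = (\<integral>\<^sup>+z. ennreal (indicator B z * bh (seq_shift \<omega>) z) / ennreal I \<partial>(bM \<omega> x))"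
    using bh I by (intro nn_integral_cong)
      (auto simp: cf_eq I_def[symmetric] divide_ennreal bM_space split: split_indicator)
  also have "\<dots> = (\<integral>\<^sup>+z. ennreal (indicator B z * bh (seq_shift \<omega>) z) \<partial>(bM \<omega> x)) / ennreal I"
    by (rule nn_integral_divide) measurable
  also have "\<dots> = ennreal (\<integral>z. indicator B z * bh (seq_shift \<omega>) z \<partial>(bM \<omega> x)) / ennreal I"
    using intB bh by (subst nn_integral_eq_integral) (auto simp: bM_space intro!: AE_I2)
  also have "\<dots> = ennreal ((\<integral>z. indicator B z * bh (seq_shift \<omega>) z \<partial>(bM \<omega> x)) / I)"
    using I nnB by (simp add: divide_ennreal)
  finally have "measure (bP \<omega> x) B = (\<integral>z. indicator B z * bh (seq_shift \<omega>) z \<partial>(bM \<omega> x)) / I"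
    using I nnB by (simp add: bP.emeasure_eq_measure)
  then show ?thesis unfolding tot by (simp add: set_lebesgue_integral_def)
qed

text \<open>The minorisation constant of \<open>bP\<close> against \<open>nuN\<close>: a factor
  \<epsilon>m per coordinate, and \<open>H\<^sup>2\<close> for the density
  \<open>cf\<close>.\<close>

definition "c0 = \<epsilon>m ^ N / H\<^sup>2"

lemma c0_pos: "0 < c0" using eps_pos H_ge_1 by (simp add: c0_def)

lemma bP_ge:
  assumes \<omega>: "\<omega> \<in> space P" and x: "x \<in> space XN" and f[measurable]: "f \<in> borel_measurable XN"
  shows "ennreal c0 * (\<integral>\<^sup>+z. f z \<partial>nuN) \<le> (\<integral>\<^sup>+z. f z \<partial>(bP \<omega> x))"
proof -
  have [measurable_cong]: "sets (bM \<omega> x) = sets XN" by (rule bM_sets)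
  have "ennreal c0 * (\<integral>\<^sup>+z. f z \<partial>nuN) = ennreal (1 / H\<^sup>2) * (ennreal (\<epsilon>m ^ N) * (\<integral>\<^sup>+z. f z \<partial>nuN))"
    using eps_pos by (simp add: c0_def mult.assoc[symmetric] ennreal_mult'[symmetric])
  also have "\<dots> \<le> ennreal (1 / H\<^sup>2) * (\<integral>\<^sup>+z. f z \<partial>(bM \<omega> x))"
    by (intro mult_left_mono bM_ge[OF \<omega> x] f) simp
  also have "\<dots> = (\<integral>\<^sup>+z. ennreal (1 / H\<^sup>2) * f z \<partial>(bM \<omega> x))"
    by (rule nn_integral_cmult[symmetric]) measurable
  also have "\<dots> \<le> (\<integral>\<^sup>+z. ennreal (cf \<omega> x z) * f z \<partial>(bM \<omega> x))"
    using cf_bounds(1)[OF \<omega> x] by (intro nn_integral_mono mult_right_mono ennreal_leI) (auto simp: bM_space)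
  also have "\<dots> = (\<integral>\<^sup>+z. f z \<partial>(bP \<omega> x))" by (rule nn_integral_bP[OF \<omega> x f, symmetric])
  finally show ?thesis .
qed

text \<open>\<open>bM\<close> is at most \<epsilon>p ^ N times \<open>nuN\<close>, and
  \<open>bP\<close> has a density with respect to it. Thus statements that hold
  \<open>nuN\<close>-almost everywhere survive a step from an arbitrary point.\<close>

lemma AE_bP:
  assumes \<omega>: "\<omega> \<in> space P" and x: "x \<in> space XN" and AE: "AE z in nuN. Q z"
  shows "AE z in bP \<omega> x. Q z"
proof -
  obtain B where B: "B \<in> null_sets nuN" "{z \<in> space nuN. \<not> Q z} \<subseteq> B"
    using AE by (auto elim!: AE_E3)
  have Bm[measurable]: "B \<in> sets XN" using B sets_nuN by auto
  have [measurable_cong]: "sets (bM \<omega> x) = sets XN" by (rule bM_sets)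
  have "(\<integral>\<^sup>+z. indicator B z \<partial>(bM \<omega> x)) \<le> ennreal (\<epsilon>p ^ N) * (\<integral>\<^sup>+z. indicator B z \<partial>nuN)"
    by (rule bM_le[OF \<omega> x]) measurable
  also have "\<dots> = 0" using B by (simp add: null_sets_def)
  finally have "AE z in bM \<omega> x. indicator B z = (0::ennreal)"
    by (subst nn_integral_0_iff_AE[symmetric]) auto
  then have "(\<integral>\<^sup>+z. ennreal (cf \<omega> x z) * indicator B z \<partial>(bM \<omega> x)) = (\<integral>\<^sup>+z. 0 \<partial>(bM \<omega> x))"
    by (intro nn_integral_cong_AE) (auto elim!: eventually_mono)
  then have "emeasure (bP \<omega> x) B = 0"
    using nn_integral_bP[OF \<omega> x, of "indicator B"] Bm by (simp add: bP_sets[OF \<omega> x])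
  then have "B \<in> null_sets (bP \<omega> x)" using Bm by (simp add: null_sets_def bP_sets[OF \<omega> x])
  then show ?thesis using B by (intro AE_I') (auto simp: bP_space[OF \<omega> x] space_nuN)
qed

text \<open>A predicate on the constant, since the bounds of \<open>Mt\<close> are given only
  existentially in \<open>kernel_class\<close>. One part compares starting points, the other bounds
  the total mass; neither depends on \<omega>.\<close>

definition "harnack C \<longleftrightarrow> 1 \<le> C
    \<and> (\<forall>\<omega>\<in>space P. \<forall>x\<in>space XN. \<forall>y\<in>space XN. \<forall>g\<in>borel_measurable XN.
      (\<integral>\<^sup>+z. (w \<omega> x z)\<^sup>2 * g z \<partial>(Mt \<omega> x)) \<le> ennreal C * (\<integral>\<^sup>+z. (w \<omega> y z)\<^sup>2 * g z \<partial>(Mt \<omega> y)))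
    \<and> (\<forall>\<omega>\<in>space P. \<forall>x\<in>space XN. (\<integral>\<^sup>+z. (w \<omega> x z)\<^sup>2 \<partial>(Mt \<omega> x)) \<le> ennreal C)"

text \<open>On the reference measure of the importance kernel, \<open>\<phi>\<close> is comparable to the density of
  \<open>\<nu>\<^sup>N\<close>, so all the measures with density \<open>w\<^sup>2\<close> are comparable to each other.\<close>

lemma harnack_exists: "\<exists>C. harnack C"
proof -
  obtain l u \<nu>t where \<nu>t: "prob_space \<nu>t" "sets \<nu>t = sets XN" and lu: "0 < l" "0 < u"
    and bd: "two_sided_bound P XN Mt \<nu>t l u" and ac: "absolutely_continuous \<nu>t nuN"
    and sq: "(\<integral>\<^sup>+x. (RN_deriv \<nu>t nuN x)\<^sup>2 \<partial>\<nu>t) < \<infinity>"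
    using Mt by (auto simp: kernel_class_def space_prob_algebra)
  interpret \<nu>t: prob_space \<nu>t by fact
  define f where "f = RN_deriv \<nu>t nuN"
  have f[measurable]: "f \<in> borel_measurable \<nu>t" unfolding f_def by simp
  have dens: "density \<nu>t f = nuN" unfolding f_def
    using ac by (intro \<nu>t.density_RN_deriv) (auto simp: sets_nuN \<nu>t)
  have f1: "(\<integral>\<^sup>+z. f z \<partial>\<nu>t) = 1"
    using nuN.emeasure_space_1 unfolding dens[symmetric] by (simp add: emeasure_density cong: nn_integral_cong)
  have fX[measurable]: "f \<in> borel_measurable XN" using f \<nu>t by (simp cong: measurable_cong_sets)
  note [measurable_cong] = \<nu>t(2)
  define e1 e2 where "e1 = \<epsilon>m ^ N" and "e2 = \<epsilon>p ^ N"
  have e: "0 < e1" "0 < e2" using eps_pos by (simp_all add: e1_def e2_def)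
  \<comment> \<open>With respect to \<open>\<nu>t\<close>, \<open>Mt\<close> has mass between the
    factors l and u, and \<open>w\<close> lies between \<open>e1 / u / H\<^sup>2\<close> and
    \<open>H\<^sup>2 * e2 / l\<close> times f; the latter factors enter squared.\<close>
  define a b where "a = l * (e1 / u / H\<^sup>2)\<^sup>2" and "b = u * (H\<^sup>2 * e2 / l)\<^sup>2"
  have ab: "0 < a" "0 < b" using lu e H_ge_1 by (simp_all add: a_def b_def)
  have main: "ennreal a * (\<integral>\<^sup>+z. (f z)\<^sup>2 * g z \<partial>\<nu>t) \<le> (\<integral>\<^sup>+z. (w \<omega> x z)\<^sup>2 * g z \<partial>(Mt \<omega> x))
      \<and> (\<integral>\<^sup>+z. (w \<omega> x z)\<^sup>2 * g z \<partial>(Mt \<omega> x)) \<le> ennreal b * (\<integral>\<^sup>+z. (f z)\<^sup>2 * g z \<partial>\<nu>t)"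
    if \<omega>: "\<omega> \<in> space P" and x: "x \<in> space XN" and g[measurable]: "g \<in> borel_measurable XN" for \<omega> x g
  proof -
    interpret Mtx: prob_space "Mt \<omega> x" by (rule Mt_prob[OF \<omega> x])
    note [measurable_cong] = Mt_sets[OF \<omega> x]
    note [measurable] = w_measurable_section[OF \<omega> x] cf_measurable_section[OF \<omega> x] phi_measurable_section[OF \<omega> x]
    have fin: "finite_measure (Mt \<omega> x)" "finite_measure \<nu>t" by unfold_locales
    have up: "(\<integral>\<^sup>+z. k z \<partial>(Mt \<omega> x)) \<le> ennreal u * (\<integral>\<^sup>+z. k z \<partial>\<nu>t)"
      and lo: "ennreal l * (\<integral>\<^sup>+z. k z \<partial>\<nu>t) \<le> (\<integral>\<^sup>+z. k z \<partial>(Mt \<omega> x))"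
      if "k \<in> borel_measurable XN" for k
      using bd lu \<omega> x \<nu>t Mt_sets[OF \<omega> x] that
      by (auto intro!: nn_integral_le_scaled nn_integral_ge_scaled fin simp: two_sided_bound_def cong: measurable_cong_sets)
    have bMe: "(\<integral>\<^sup>+z. \<phi> \<omega> x z * indicator A z \<partial>(Mt \<omega> x)) = (\<integral>\<^sup>+z. indicator A z \<partial>(bM \<omega> x))" if [measurable]: "A \<in> sets XN" for A
      unfolding density_phi[OF \<omega> x, symmetric] by (rule nn_integral_density[symmetric]) measurable
    have nuNe: "(\<integral>\<^sup>+z. f z * indicator A z \<partial>\<nu>t) = (\<integral>\<^sup>+z. indicator A z \<partial>nuN)" if [measurable]: "A \<in> sets XN" for A
      unfolding dens[symmetric] by (rule nn_integral_density[symmetric]) measurable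
    \<comment> \<open>In terms of measures: l \<phi> times \<open>\<nu>t\<close> is at most \<phi>
      times \<open>Mt\<close>, which is \<open>bM\<close>, hence at most e2 times
      \<open>nuN\<close>, which has density f. \<open>AE2\<close> runs through the same chain
      backwards.\<close>
    have AE1: "AE z in \<nu>t. ennreal l * \<phi> \<omega> x z \<le> ennreal e2 * f z"
    proof (rule AE_le_of_set_nn_integral_le)
      show "(\<integral>\<^sup>+z. ennreal e2 * f z \<partial>\<nu>t) < \<infinity>" using f1 by (simp add: nn_integral_cmult)
      fix A assume "A \<in> sets \<nu>t"
      then have A[measurable]: "A \<in> sets XN" by (simp add: \<nu>t)
      have "(\<integral>\<^sup>+z. ennreal l * \<phi> \<omega> x z * indicator A z \<partial>\<nu>t) = ennreal l * (\<integral>\<^sup>+z. \<phi> \<omega> x z * indicator A z \<partial>\<nu>t)"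
        by (simp add: nn_integral_cmult mult.assoc)
      also have "\<dots> \<le> (\<integral>\<^sup>+z. \<phi> \<omega> x z * indicator A z \<partial>(Mt \<omega> x))" by (rule lo) measurable
      also have "\<dots> = (\<integral>\<^sup>+z. indicator A z \<partial>(bM \<omega> x))" by (rule bMe[OF A])
      also have "\<dots> \<le> ennreal e2 * (\<integral>\<^sup>+z. indicator A z \<partial>nuN)"
        unfolding e2_def by (rule bM_le[OF \<omega> x]) measurable
      also have "\<dots> = (\<integral>\<^sup>+z. ennreal e2 * f z * indicator A z \<partial>\<nu>t)"
        unfolding nuNe[OF A, symmetric] by (simp add: nn_integral_cmult mult.assoc)
      finally show "(\<integral>\<^sup>+z. ennreal l * \<phi> \<omega> x z * indicator A z \<partial>\<nu>t) \<le> (\<integral>\<^sup>+z. ennreal e2 * f z * indicator A z \<partial>\<nu>t)" .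
    qed measurable
    have AE2: "AE z in \<nu>t. ennreal e1 * f z \<le> ennreal u * \<phi> \<omega> x z"
    proof (rule AE_le_of_set_nn_integral_le)
      have "ennreal l * (\<integral>\<^sup>+z. \<phi> \<omega> x z \<partial>\<nu>t) \<le> (\<integral>\<^sup>+z. \<phi> \<omega> x z \<partial>(Mt \<omega> x))" by (rule lo) measurable
      also have "\<dots> = (\<integral>\<^sup>+z. \<phi> \<omega> x z * indicator (space XN) z \<partial>(Mt \<omega> x))"
        by (intro nn_integral_cong) (simp add: Mt_space[OF \<omega> x])
      also have "\<dots> = emeasure (bM \<omega> x) (space (bM \<omega> x))"
        by (subst bMe) (simp_all add: bM_space bM_sets)
      also have "\<dots> < \<infinity>" using prob_space.emeasure_space_1[OF bM_prob[OF \<omega> x]] by simp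
      finally show "(\<integral>\<^sup>+z. ennreal u * \<phi> \<omega> x z \<partial>\<nu>t) < \<infinity>"
        using lu by (auto simp: nn_integral_cmult ennreal_mult_less_top)
      fix A assume "A \<in> sets \<nu>t"
      then have A[measurable]: "A \<in> sets XN" by (simp add: \<nu>t)
      have "(\<integral>\<^sup>+z. ennreal e1 * f z * indicator A z \<partial>\<nu>t) = ennreal e1 * (\<integral>\<^sup>+z. indicator A z \<partial>nuN)"
        unfolding nuNe[OF A, symmetric] by (simp add: nn_integral_cmult mult.assoc)
      also have "\<dots> \<le> (\<integral>\<^sup>+z. indicator A z \<partial>(bM \<omega> x))"
        unfolding e1_def by (rule bM_ge[OF \<omega> x]) measurable
      also have "\<dots> = (\<integral>\<^sup>+z. \<phi> \<omega> x z * indicator A z \<partial>(Mt \<omega> x))" by (rule bMe[OF A, symmetric])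
      also have "\<dots> \<le> ennreal u * (\<integral>\<^sup>+z. \<phi> \<omega> x z * indicator A z \<partial>\<nu>t)" by (rule up) measurable
      also have "\<dots> = (\<integral>\<^sup>+z. ennreal u * \<phi> \<omega> x z * indicator A z \<partial>\<nu>t)"
        by (simp add: nn_integral_cmult mult.assoc)
      finally show "(\<integral>\<^sup>+z. ennreal e1 * f z * indicator A z \<partial>\<nu>t) \<le> (\<integral>\<^sup>+z. ennreal u * \<phi> \<omega> x z * indicator A z \<partial>\<nu>t)" .
    qed measurable
    have AEw: "AE z in \<nu>t. ennreal (e1 / u / H\<^sup>2) * f z \<le> w \<omega> x z \<and> w \<omega> x z \<le> ennreal (H\<^sup>2 * e2 / l) * f z"
      using AE1 AE2 AE_space
    proof eventually_elim
      case (elim z)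
      then have z: "z \<in> space XN" using sets_eq_imp_space_eq[OF \<nu>t(2)] by simp
      have "ennreal (e1 / u / H\<^sup>2) * f z = ennreal (1 / H\<^sup>2) * (ennreal (1 / u) * (ennreal e1 * f z))"
        using e lu by (simp add: mult.assoc[symmetric] ennreal_mult'[symmetric]) (simp add: mult.commute)
      also have "\<dots> \<le> ennreal (1 / H\<^sup>2) * (ennreal (1 / u) * (ennreal u * \<phi> \<omega> x z))"
        using elim by (intro mult_left_mono) auto
      also have "\<dots> = ennreal (1 / H\<^sup>2) * \<phi> \<omega> x z"
        using lu by (simp add: mult.assoc[symmetric] ennreal_mult'[symmetric])
      also have "\<dots> \<le> w \<omega> x z"
        unfolding w_def using cf_bounds(1)[OF \<omega> x z] by (intro mult_right_mono ennreal_leI) auto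
      finally have 1: "ennreal (e1 / u / H\<^sup>2) * f z \<le> w \<omega> x z" .
      have "w \<omega> x z \<le> ennreal (H\<^sup>2) * \<phi> \<omega> x z"
        unfolding w_def using cf_bounds(2)[OF \<omega> x z] by (intro mult_right_mono ennreal_leI) auto
      also have "\<dots> = ennreal (H\<^sup>2 / l) * (ennreal l * \<phi> \<omega> x z)"
        using lu by (simp add: mult.assoc[symmetric] ennreal_mult'[symmetric])
      also have "\<dots> \<le> ennreal (H\<^sup>2 / l) * (ennreal e2 * f z)"
        using elim by (intro mult_left_mono) auto
      also have "\<dots> = ennreal (H\<^sup>2 * e2 / l) * f z"
        using lu e by (simp add: mult.assoc[symmetric] ennreal_mult'[symmetric])
      finally show ?case using 1 by simp
    qed
    have sq_mult: "(ennreal c * f z)\<^sup>2 = ennreal (c\<^sup>2) * (f z)\<^sup>2" if "0 \<le> c" for c z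
      using that by (simp add: power_mult_distrib ennreal_power)
    have c1: "0 \<le> e1 / u / H\<^sup>2" "0 \<le> H\<^sup>2 * e2 / l" using lu e H_ge_1 by simp_all
    have "ennreal a * (\<integral>\<^sup>+z. (f z)\<^sup>2 * g z \<partial>\<nu>t) = ennreal l * (\<integral>\<^sup>+z. (ennreal (e1 / u / H\<^sup>2) * f z)\<^sup>2 * g z \<partial>\<nu>t)"
      unfolding sq_mult[OF c1(1)] a_def using lu
      by (simp add: nn_integral_cmult mult.assoc ennreal_mult')
    also have "\<dots> \<le> ennreal l * (\<integral>\<^sup>+z. (w \<omega> x z)\<^sup>2 * g z \<partial>\<nu>t)"
      by (intro mult_left_mono nn_integral_mono_AE eventually_mono[OF AEw]) (auto intro!: mult_right_mono power_mono)
    also have "\<dots> \<le> (\<integral>\<^sup>+z. (w \<omega> x z)\<^sup>2 * g z \<partial>(Mt \<omega> x))" by (rule lo) measurable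
    finally have A: "ennreal a * (\<integral>\<^sup>+z. (f z)\<^sup>2 * g z \<partial>\<nu>t) \<le> (\<integral>\<^sup>+z. (w \<omega> x z)\<^sup>2 * g z \<partial>(Mt \<omega> x))" .
    have "(\<integral>\<^sup>+z. (w \<omega> x z)\<^sup>2 * g z \<partial>(Mt \<omega> x)) \<le> ennreal u * (\<integral>\<^sup>+z. (w \<omega> x z)\<^sup>2 * g z \<partial>\<nu>t)"
      by (rule up) measurable
    also have "\<dots> \<le> ennreal u * (\<integral>\<^sup>+z. (ennreal (H\<^sup>2 * e2 / l) * f z)\<^sup>2 * g z \<partial>\<nu>t)"
      by (intro mult_left_mono nn_integral_mono_AE eventually_mono[OF AEw]) (auto intro!: mult_right_mono power_mono)
    also have "\<dots> = ennreal b * (\<integral>\<^sup>+z. (f z)\<^sup>2 * g z \<partial>\<nu>t)"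
      unfolding sq_mult[OF c1(2)] b_def using lu
      by (simp add: nn_integral_cmult mult.assoc ennreal_mult')
    finally show ?thesis using A by blast
  qed
  \<comment> \<open>The square integrability demanded by \<open>kernel_class\<close> enters here: it
    makes the total mass of the measure with density \<open>w\<close> squared finite.\<close>
  define \<kappa> where "\<kappa> = enn2real (\<integral>\<^sup>+z. (f z)\<^sup>2 \<partial>\<nu>t)"
  have \<kappa>: "(\<integral>\<^sup>+z. (f z)\<^sup>2 \<partial>\<nu>t) = ennreal \<kappa>"
    using sq by (simp add: \<kappa>_def f_def less_top)
  define C where "C = max 1 (max (b / a) (b * \<kappa>))"
  have "(\<integral>\<^sup>+z. (w \<omega> x z)\<^sup>2 * g z \<partial>(Mt \<omega> x)) \<le> ennreal C * (\<integral>\<^sup>+z. (w \<omega> y z)\<^sup>2 * g z \<partial>(Mt \<omega> y))"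
    if "\<omega> \<in> space P" "x \<in> space XN" "y \<in> space XN" "g \<in> borel_measurable XN" for \<omega> x y g
  proof -
    have "(\<integral>\<^sup>+z. (w \<omega> x z)\<^sup>2 * g z \<partial>(Mt \<omega> x)) \<le> ennreal b * (\<integral>\<^sup>+z. (f z)\<^sup>2 * g z \<partial>\<nu>t)"
      using main that by blast
    also have "\<dots> = ennreal (b / a) * (ennreal a * (\<integral>\<^sup>+z. (f z)\<^sup>2 * g z \<partial>\<nu>t))"
      using ab by (simp add: mult.assoc[symmetric] ennreal_mult'[symmetric])
    also have "\<dots> \<le> ennreal C * (\<integral>\<^sup>+z. (w \<omega> y z)\<^sup>2 * g z \<partial>(Mt \<omega> y))"
      using main that by (intro mult_mono) (auto simp: C_def intro!: ennreal_leI)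
    finally show ?thesis .
  qed
  moreover have "(\<integral>\<^sup>+z. (w \<omega> x z)\<^sup>2 \<partial>(Mt \<omega> x)) \<le> ennreal C" if "\<omega> \<in> space P" "x \<in> space XN" for \<omega> x
  proof -
    have "(\<integral>\<^sup>+z. (w \<omega> x z)\<^sup>2 \<partial>(Mt \<omega> x)) \<le> ennreal b * ennreal \<kappa>"
      using main[OF that, of "\<lambda>_. 1"] by (simp add: \<kappa>)
    also have "\<dots> \<le> ennreal C" using ab by (simp add: C_def ennreal_mult'[symmetric] \<kappa>_def ennreal_leI)
    finally show ?thesis .
  qed
  ultimately show ?thesis by (intro exI[of _ C]) (simp add: harnack_def C_def)
qed

end

section \<open>The normalised second moments\<close>

lemma (in ergodic_system) integral_funpow:
  fixes f :: "'a \<Rightarrow> real"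
  assumes [measurable]: "f \<in> borel_measurable P"
  shows "(\<integral>\<omega>. f ((T ^^ n) \<omega>) \<partial>P) = (\<integral>\<omega>. f \<omega> \<partial>P)"
proof (induction n)
  case (Suc n)
  have "(\<integral>\<omega>. f ((T ^^ Suc n) \<omega>) \<partial>P) = (\<integral>\<omega>. (\<lambda>\<omega>. f ((T ^^ n) \<omega>)) (T \<omega>) \<partial>P)"
    by (simp add: funpow_swap1)
  also have "\<dots> = (\<integral>\<omega>. f ((T ^^ n) \<omega>) \<partial>P)" by (rule integral_T) measurable
  finally show ?case using Suc by simp
qed simp

context importance_sampling
begin

definition "harnack_const = (SOME C. harnack C)"

lemma harnack_harnack_const: "harnack harnack_const"
  unfolding harnack_const_def using harnack_exists by (rule someI_ex)

lemma harnack_const_ge_1: "1 \<le> harnack_const" using harnack_harnack_const by (simp add: harnack_def)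

lemma harnack_compare:
  "\<omega> \<in> space P \<Longrightarrow> x \<in> space XN \<Longrightarrow> y \<in> space XN \<Longrightarrow> g \<in> borel_measurable XN \<Longrightarrow>
    (\<integral>\<^sup>+z. (w \<omega> x z)\<^sup>2 * g z \<partial>(Mt \<omega> x)) \<le> ennreal harnack_const * (\<integral>\<^sup>+z. (w \<omega> y z)\<^sup>2 * g z \<partial>(Mt \<omega> y))"
  and harnack_bound:
  "\<omega> \<in> space P \<Longrightarrow> x \<in> space XN \<Longrightarrow> (\<integral>\<^sup>+z. (w \<omega> x z)\<^sup>2 \<partial>(Mt \<omega> x)) \<le> ennreal harnack_const"
  using harnack_harnack_const unfolding harnack_def by blast+

primrec U :: "nat \<Rightarrow> (int \<Rightarrow> 'y) \<Rightarrow> (nat \<Rightarrow> 'x) \<Rightarrow> ennreal" where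
  "U 0 \<omega> x = 1"
| "U (Suc n) \<omega> x = (\<integral>\<^sup>+z. (w \<omega> x z)\<^sup>2 * U n (seq_shift \<omega>) z \<partial>(Mt \<omega> x))"

lemma U_measurable[measurable]: "(\<lambda>(\<omega>, x). U n \<omega> x) \<in> borel_measurable (P \<Otimes>\<^sub>M XN)"
proof (induction n)
  case (Suc n)
  have [measurable]: "(\<lambda>v. w (fst (fst v)) (snd (fst v)) (snd v)) \<in> borel_measurable ((P \<Otimes>\<^sub>M XN) \<Otimes>\<^sub>M XN)"
    using measurable_compose[OF _ w_measurable, of "\<lambda>v. (fst (fst v), snd (fst v), snd v)" "(P \<Otimes>\<^sub>M XN) \<Otimes>\<^sub>M XN"]
    by (simp add: split_beta')
  have [measurable]: "(\<lambda>v. U n (seq_shift (fst (fst v))) (snd v)) \<in> borel_measurable ((P \<Otimes>\<^sub>M XN) \<Otimes>\<^sub>M XN)"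
    using measurable_compose[OF _ Suc, of "\<lambda>v. (seq_shift (fst (fst v)), snd v)" "(P \<Otimes>\<^sub>M XN) \<Otimes>\<^sub>M XN"]
    by (simp add: split_beta')
  have "(\<lambda>(v, z). (w (fst v) (snd v) z)\<^sup>2 * U n (seq_shift (fst v)) z) \<in> borel_measurable ((P \<Otimes>\<^sub>M XN) \<Otimes>\<^sub>M XN)"
    unfolding split_beta' by measurable
  from nn_integral_measurable_subprob_algebra2[OF this measurable_prob_algebraD[OF Mt_measurable]]
  show ?case by (simp add: split_beta')
qed simp

lemma U_measurable_section: "\<omega> \<in> space P \<Longrightarrow> U n \<omega> \<in> borel_measurable XN"
  using measurable_compose[OF measurable_Pair1' U_measurable] by simp

lemma XN_nonempty: "space XN \<noteq> {}"
  using nuN.not_empty space_nuN by simp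

text \<open>Only the first transition sees the starting point; the later ones form the test function
  in \<open>harnack_compare\<close>.\<close>

lemma U_harnack:
  assumes "\<omega> \<in> space P" "x \<in> space XN" "y \<in> space XN"
  shows "U n \<omega> x \<le> ennreal harnack_const * U n \<omega> y"
proof (cases n)
  case 0
  then show ?thesis using harnack_const_ge_1 by simp
next
  case (Suc k)
  then show ?thesis using harnack_compare[OF assms U_measurable_section[OF T_space[OF assms(1)]]] by simp
qed

lemma U_le:
  assumes "\<omega> \<in> space P" "x \<in> space XN"
  shows "U n \<omega> x \<le> ennreal (harnack_const ^ n)"
  using assms
proof (induction n arbitrary: \<omega> x)
  case (Suc n)
  note [measurable_cong] = Mt_sets[OF Suc.prems]
  note [measurable] = w_measurable_section[OF Suc.prems]
  have "U (Suc n) \<omega> x \<le> (\<integral>\<^sup>+z. (w \<omega> x z)\<^sup>2 * ennreal (harnack_const ^ n) \<partial>(Mt \<omega> x))"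
    unfolding U.simps using Suc.IH[OF T_space[OF Suc.prems(1)]]
    by (intro nn_integral_mono mult_left_mono) (auto simp: Mt_space[OF Suc.prems])
  also have "\<dots> = (\<integral>\<^sup>+z. (w \<omega> x z)\<^sup>2 \<partial>(Mt \<omega> x)) * ennreal (harnack_const ^ n)"
    by (rule nn_integral_multc) measurable
  also have "\<dots> \<le> ennreal harnack_const * ennreal (harnack_const ^ n)"
    by (intro mult_right_mono harnack_bound Suc.prems) simp
  also have "\<dots> = ennreal (harnack_const ^ Suc n)" using harnack_const_ge_1 by (simp add: ennreal_mult')
  finally show ?case .
qed simp

text \<open>The first n transitions are kept, while the value of \<open>U m\<close> at the random
  position at time n is replaced by its value at the fixed point \<open>x0\<close>. Together with
  \<open>U_mult_ge\<close> this makes the logarithm at a fixed point almost additive along the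
  shift, with error \<open>ln harnack_const\<close>.\<close>

lemma U_mult_le:
  assumes "\<omega> \<in> space P" "x \<in> space XN" and x0: "x0 \<in> space XN"
  shows "U (n + m) \<omega> x \<le> ennreal harnack_const * U m (shift_pow (int n) \<omega>) x0 * U n \<omega> x"
  using assms(1,2)
proof (induction n arbitrary: \<omega> x)
  case 0
  then show ?case using U_harnack[OF 0 x0] by simp
next
  case (Suc n)
  note \<omega>' = T_space[OF Suc.prems(1)]
  note [measurable_cong] = Mt_sets[OF Suc.prems]
  note [measurable] = w_measurable_section[OF Suc.prems] U_measurable_section[OF \<omega>']
  have sh: "shift_pow (int n) (seq_shift \<omega>) = shift_pow (int (Suc n)) \<omega>" by (simp add: shift_pow_seq_shift)
  let ?c = "ennreal harnack_const * U m (shift_pow (int (Suc n)) \<omega>) x0"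
  have "U (Suc n + m) \<omega> x \<le> (\<integral>\<^sup>+z. ?c * ((w \<omega> x z)\<^sup>2 * U n (seq_shift \<omega>) z) \<partial>(Mt \<omega> x))"
    unfolding add_Suc U.simps
  proof (rule nn_integral_mono)
    fix z assume "z \<in> space (Mt \<omega> x)"
    then have "U (n + m) (seq_shift \<omega>) z \<le> ?c * U n (seq_shift \<omega>) z"
      using Suc.IH[OF \<omega>', of z] by (simp add: Mt_space[OF Suc.prems] sh)
    then have "(w \<omega> x z)\<^sup>2 * U (n + m) (seq_shift \<omega>) z \<le> (w \<omega> x z)\<^sup>2 * (?c * U n (seq_shift \<omega>) z)"
      by (intro mult_left_mono) auto
    then show "(w \<omega> x z)\<^sup>2 * U (n + m) (seq_shift \<omega>) z \<le> ?c * ((w \<omega> x z)\<^sup>2 * U n (seq_shift \<omega>) z)"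
      by (simp add: mult_ac)
  qed
  also have "\<dots> = ?c * U (Suc n) \<omega> x"
    unfolding U.simps by (rule nn_integral_cmult) measurable
  finally show ?case .
qed

lemma U_mult_ge:
  assumes "\<omega> \<in> space P" "x \<in> space XN" and x0: "x0 \<in> space XN"
  shows "U m (shift_pow (int n) \<omega>) x0 * U n \<omega> x \<le> ennreal harnack_const * U (n + m) \<omega> x"
  using assms(1,2)
proof (induction n arbitrary: \<omega> x)
  case 0
  then show ?case using U_harnack[OF 0(1) x0 0(2)] by simp
next
  case (Suc n)
  note \<omega>' = T_space[OF Suc.prems(1)]
  note [measurable_cong] = Mt_sets[OF Suc.prems]
  note [measurable] = w_measurable_section[OF Suc.prems] U_measurable_section[OF \<omega>']
  have sh: "shift_pow (int n) (seq_shift \<omega>) = shift_pow (int (Suc n)) \<omega>" by (simp add: shift_pow_seq_shift)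
  let ?c = "U m (shift_pow (int (Suc n)) \<omega>) x0"
  have "?c * U (Suc n) \<omega> x = (\<integral>\<^sup>+z. ?c * ((w \<omega> x z)\<^sup>2 * U n (seq_shift \<omega>) z) \<partial>(Mt \<omega> x))"
    unfolding U.simps by (rule nn_integral_cmult[symmetric]) measurable
  also have "\<dots> \<le> (\<integral>\<^sup>+z. ennreal harnack_const * ((w \<omega> x z)\<^sup>2 * U (n + m) (seq_shift \<omega>) z) \<partial>(Mt \<omega> x))"
  proof (rule nn_integral_mono)
    fix z assume "z \<in> space (Mt \<omega> x)"
    then have "?c * U n (seq_shift \<omega>) z \<le> ennreal harnack_const * U (n + m) (seq_shift \<omega>) z"
      using Suc.IH[OF \<omega>', of z] by (simp add: Mt_space[OF Suc.prems] sh)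
    then have "(w \<omega> x z)\<^sup>2 * (?c * U n (seq_shift \<omega>) z) \<le> (w \<omega> x z)\<^sup>2 * (ennreal harnack_const * U (n + m) (seq_shift \<omega>) z)"
      by (intro mult_left_mono) auto
    then show "?c * ((w \<omega> x z)\<^sup>2 * U n (seq_shift \<omega>) z) \<le> ennreal harnack_const * ((w \<omega> x z)\<^sup>2 * U (n + m) (seq_shift \<omega>) z)"
      by (simp add: mult_ac)
  qed
  also have "\<dots> = ennreal harnack_const * U (Suc n + m) \<omega> x"
    unfolding add_Suc U.simps by (rule nn_integral_cmult) measurable
  finally show ?case .
qed

section \<open>Lower bound of the second moments by relative entropies\<close>

definition "Ur n \<omega> x = enn2real (U n \<omega> x)"

lemma U_eq_Ur: "\<omega> \<in> space P \<Longrightarrow> x \<in> space XN \<Longrightarrow> U n \<omega> x = ennreal (Ur n \<omega> x)"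
  unfolding Ur_def by (rule ennreal_enn2real[symmetric], rule le_less_trans[OF U_le]) auto

lemma Ur_le: "\<omega> \<in> space P \<Longrightarrow> x \<in> space XN \<Longrightarrow> Ur n \<omega> x \<le> harnack_const ^ n"
  using U_le[of \<omega> x n] harnack_const_ge_1 by (simp add: Ur_def enn2real_leI)

lemma Ur_measurable: "(\<lambda>(\<omega>, x). Ur n \<omega> x) \<in> borel_measurable (P \<Otimes>\<^sub>M XN)"
  using borel_measurable_enn2real[OF U_measurable[of n]] by (simp add: Ur_def split_beta')

lemma Ur_measurable_section: "\<omega> \<in> space P \<Longrightarrow> Ur n \<omega> \<in> borel_measurable XN"
  using measurable_compose[OF measurable_Pair1' Ur_measurable] by simp

text \<open>A bounded substitute for the relative entropy of \<open>bP \<omega> x\<close> with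
  respect to \<open>Mt \<omega> x\<close>; it vanishes only if the two measures agree.\<close>

definition "entropy_loss \<omega> x = (\<integral>z. entropy_defect (enn2real (w \<omega> x z)) \<partial>(bP \<omega> x))"

lemma entropy_loss_range:
  assumes "\<omega> \<in> space P" "x \<in> space XN" shows "0 \<le> entropy_loss \<omega> x" "entropy_loss \<omega> x \<le> 1"
proof -
  interpret bP: prob_space "bP \<omega> x" by (rule bP_prob[OF assms])
  note [measurable_cong] = bP_sets[OF assms]
  note [measurable] = w_measurable_section[OF assms]
  have "integrable (bP \<omega> x) (\<lambda>z. entropy_defect (enn2real (w \<omega> x z)))"
    using entropy_defect_range by (intro bP.integrable_const_bound[where B=1]) auto
  then show "0 \<le> entropy_loss \<omega> x" "entropy_loss \<omega> x \<le> 1"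
    unfolding entropy_loss_def using entropy_defect_range by (auto intro!: bP.integral_le_const)
qed

text \<open>The integral is rewritten over \<open>Mt\<close>, whose joint measurability is given,
  with \<open>w\<close> as a weight.\<close>

lemma entropy_loss_measurable: "(\<lambda>(\<omega>, x). entropy_loss \<omega> x) \<in> borel_measurable (P \<Otimes>\<^sub>M XN)"
proof -
  have [measurable]: "(\<lambda>v. w (fst (fst v)) (snd (fst v)) (snd v)) \<in> borel_measurable ((P \<Otimes>\<^sub>M XN) \<Otimes>\<^sub>M XN)"
    using measurable_compose[OF _ w_measurable, of "\<lambda>v. (fst (fst v), snd (fst v), snd v)" "(P \<Otimes>\<^sub>M XN) \<Otimes>\<^sub>M XN"]
    by (simp add: split_beta')
  have "(\<lambda>(v, z). w (fst v) (snd v) z * ennreal (entropy_defect (enn2real (w (fst v) (snd v) z)))) \<in> borel_measurable ((P \<Otimes>\<^sub>M XN) \<Otimes>\<^sub>M XN)"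
    unfolding split_beta' by measurable
  from nn_integral_measurable_subprob_algebra2[OF this measurable_prob_algebraD[OF Mt_measurable]]
  have m: "(\<lambda>v. enn2real (\<integral>\<^sup>+z. w (fst v) (snd v) z * ennreal (entropy_defect (enn2real (w (fst v) (snd v) z))) \<partial>(Mt (fst v) (snd v)))) \<in> borel_measurable (P \<Otimes>\<^sub>M XN)"
    by (simp add: split_beta')
  have e: "entropy_loss \<omega> x = enn2real (\<integral>\<^sup>+z. w \<omega> x z * ennreal (entropy_defect (enn2real (w \<omega> x z))) \<partial>(Mt \<omega> x))"
    if "\<omega> \<in> space P" "x \<in> space XN" for \<omega> x
  proof -
    note [measurable_cong] = Mt_sets[OF that]
    note [measurable] = w_measurable_section[OF that]
    have "entropy_loss \<omega> x = enn2real (\<integral>\<^sup>+z. ennreal (entropy_defect (enn2real (w \<omega> x z))) \<partial>(bP \<omega> x))"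
      unfolding entropy_loss_def by (rule integral_eq_nn_integral) (auto simp: bP_def entropy_defect_range)
    then show ?thesis unfolding bP_def by (simp add: nn_integral_density)
  qed
  show ?thesis
    by (rule measurable_cong[THEN iffD2, OF _ m]) (auto simp: space_pair_measure e)
qed

lemma entropy_loss_measurable_section: "\<omega> \<in> space P \<Longrightarrow> entropy_loss \<omega> \<in> borel_measurable XN"
  using measurable_compose[OF measurable_Pair1' entropy_loss_measurable] by simp

text \<open>One factor \<open>w\<close> turns \<open>Mt\<close> into \<open>bP\<close>, the other
  stays in the integrand, and Jensen's inequality for the logarithm applies. The lower bound 1 keeps
  the logarithm nonnegative, and the same estimate reproduces it for n + 1, which closes the
  induction in \<open>Ur_ge_1\<close>.\<close>

lemma ln_Ur_step:
  assumes \<omega>: "\<omega> \<in> space P" and x: "x \<in> space XN"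
    and ge1: "\<And>z. z \<in> space XN \<Longrightarrow> 1 \<le> Ur n (seq_shift \<omega>) z"
  shows "entropy_loss \<omega> x + (\<integral>z. ln (Ur n (seq_shift \<omega>) z) \<partial>(bP \<omega> x)) \<le> ln (Ur (Suc n) \<omega> x)" "1 \<le> Ur (Suc n) \<omega> x"
proof -
  note \<omega>' = T_space[OF \<omega>]
  note [measurable_cong] = Mt_sets[OF \<omega> x]
  note [measurable] = w_measurable_section[OF \<omega> x] Ur_measurable_section[OF \<omega>']
  let ?I = "entropy_loss \<omega> x + (\<integral>z. ln (Ur n (seq_shift \<omega>) z) \<partial>(bP \<omega> x))"
  have "ennreal (exp ?I) \<le> (\<integral>\<^sup>+z. (w \<omega> x z)\<^sup>2 * ennreal (Ur n (seq_shift \<omega>) z) \<partial>(Mt \<omega> x))"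
    unfolding entropy_loss_def bP_def
  proof (rule nn_integral_square_density_ge)
    show "prob_space (Mt \<omega> x)" by (rule Mt_prob[OF \<omega> x])
    show "prob_space (density (Mt \<omega> x) (w \<omega> x))" using bP_prob[OF \<omega> x] by (simp add: bP_def)
    fix z assume "z \<in> space (Mt \<omega> x)"
    then have z: "z \<in> space XN" by (simp add: Mt_space[OF \<omega> x])
    show "1 \<le> Ur n (seq_shift \<omega>) z \<and> Ur n (seq_shift \<omega>) z \<le> harnack_const ^ n" using ge1[OF z] Ur_le[OF \<omega>' z] by simp
  qed measurable
  also have "\<dots> = U (Suc n) \<omega> x"
    unfolding U.simps by (intro nn_integral_cong) (simp add: Mt_space[OF \<omega> x] U_eq_Ur[OF \<omega>'])
  also have "\<dots> = ennreal (Ur (Suc n) \<omega> x)" by (rule U_eq_Ur[OF \<omega> x])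
  finally have *: "exp ?I \<le> Ur (Suc n) \<omega> x" by (simp add: Ur_def)
  have "0 \<le> ?I"
    using entropy_loss_range(1)[OF \<omega> x] ge1 by (intro add_nonneg_nonneg integral_nonneg_AE AE_I2) (auto simp: bP_space[OF \<omega> x])
  then have "1 \<le> exp ?I" by simp
  with * show "1 \<le> Ur (Suc n) \<omega> x" by linarith
  then have "ln (exp ?I) \<le> ln (Ur (Suc n) \<omega> x)" using * by (intro ln_mono) auto
  then show "?I \<le> ln (Ur (Suc n) \<omega> x)" by simp
qed

lemma Ur_ge_1: "\<omega> \<in> space P \<Longrightarrow> x \<in> space XN \<Longrightarrow> 1 \<le> Ur n \<omega> x"
proof (induction n arbitrary: \<omega> x)
  case (Suc n)
  show ?case by (rule ln_Ur_step(2)[OF Suc.prems]) (rule Suc.IH[OF T_space[OF Suc.prems(1)]])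
qed (simp add: Ur_def)

lemma ln_Ur_range:
  assumes "\<omega> \<in> space P" "x \<in> space XN"
  shows "0 \<le> ln (Ur n \<omega> x)" "ln (Ur n \<omega> x) \<le> n * ln harnack_const"
proof -
  show "0 \<le> ln (Ur n \<omega> x)" using Ur_ge_1[OF assms, of n] by simp
  have "ln (Ur n \<omega> x) \<le> ln (harnack_const ^ n)" using Ur_ge_1[OF assms, of n] Ur_le[OF assms, of n] by (intro ln_mono) auto
  then show "ln (Ur n \<omega> x) \<le> n * ln harnack_const" using harnack_const_ge_1 by (simp add: ln_realpow)
qed

text \<open>Averaging over the fixed law \<open>nuN\<close> leaves a function of the environment
  alone, to which invariance under the shift applies.\<close>

definition "mean_entropy_loss \<omega> = (\<integral>x. entropy_loss \<omega> x \<partial>nuN)"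

lemma entropy_loss_integrable_nuN: "\<omega> \<in> space P \<Longrightarrow> integrable nuN (entropy_loss \<omega>)"
  using entropy_loss_measurable_section[of \<omega>] entropy_loss_range[of \<omega>] sets_nuN
  by (intro nuN.integrable_const_bound[where B=1]) (auto simp: space_nuN cong: measurable_cong_sets intro!: AE_I2)

lemma mean_entropy_loss_range: assumes "\<omega> \<in> space P" shows "0 \<le> mean_entropy_loss \<omega>" "mean_entropy_loss \<omega> \<le> 1"
  unfolding mean_entropy_loss_def using entropy_loss_range[OF assms] entropy_loss_integrable_nuN[OF assms]
  by (auto intro!: integral_nonneg_AE nuN.integral_le_const AE_I2 simp: space_nuN)

lemma mean_entropy_loss_measurable[measurable]: "mean_entropy_loss \<in> borel_measurable P"
proof -
  have "sets (P \<Otimes>\<^sub>M nuN) = sets (P \<Otimes>\<^sub>M XN)" using sets_nuN by (intro sets_pair_measure_cong) auto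
  then have "(\<lambda>(\<omega>, x). entropy_loss \<omega> x) \<in> borel_measurable (P \<Otimes>\<^sub>M nuN)"
    using entropy_loss_measurable by (simp cong: measurable_cong_sets)
  from nuN.borel_measurable_lebesgue_integral[OF this] show ?thesis by (simp add: mean_entropy_loss_def[abs_def])
qed

lemma bP_integral_entropy_loss_ge:
  assumes \<omega>: "\<omega> \<in> space P" and x: "x \<in> space XN" and \<omega>': "\<omega>' \<in> space P"
  shows "integrable (bP \<omega> x) (entropy_loss \<omega>')" "c0 * mean_entropy_loss \<omega>' \<le> (\<integral>z. entropy_loss \<omega>' z \<partial>(bP \<omega> x))"
proof -
  interpret bP: prob_space "bP \<omega> x" by (rule bP_prob[OF \<omega> x])
  note [measurable_cong] = bP_sets[OF \<omega> x]
  note m[measurable] = entropy_loss_measurable_section[OF \<omega>']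
  show int: "integrable (bP \<omega> x) (entropy_loss \<omega>')"
    using entropy_loss_range[OF \<omega>'] by (intro bP.integrable_const_bound[where B=1]) (auto simp: bP_space[OF \<omega> x] intro!: AE_I2)
  have "ennreal c0 * (\<integral>\<^sup>+z. ennreal (entropy_loss \<omega>' z) \<partial>nuN) \<le> (\<integral>\<^sup>+z. ennreal (entropy_loss \<omega>' z) \<partial>(bP \<omega> x))"
    by (rule bP_ge[OF \<omega> x]) measurable
  moreover have "(\<integral>\<^sup>+z. ennreal (entropy_loss \<omega>' z) \<partial>nuN) = ennreal (mean_entropy_loss \<omega>')"
    unfolding mean_entropy_loss_def using entropy_loss_range[OF \<omega>'] entropy_loss_integrable_nuN[OF \<omega>']
    by (intro nn_integral_eq_integral) (auto simp: space_nuN intro!: AE_I2)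
  moreover have "(\<integral>\<^sup>+z. ennreal (entropy_loss \<omega>' z) \<partial>(bP \<omega> x)) = ennreal (\<integral>z. entropy_loss \<omega>' z \<partial>(bP \<omega> x))"
    using int entropy_loss_range[OF \<omega>'] by (intro nn_integral_eq_integral) (auto simp: bP_space[OF \<omega> x] intro!: AE_I2)
  moreover have "0 \<le> (\<integral>z. entropy_loss \<omega>' z \<partial>(bP \<omega> x))"
    using entropy_loss_range[OF \<omega>'] by (intro integral_nonneg_AE AE_I2) (auto simp: bP_space[OF \<omega> x])
  ultimately show "c0 * mean_entropy_loss \<omega>' \<le> (\<integral>z. entropy_loss \<omega>' z \<partial>(bP \<omega> x))"
    using c0_pos by (simp add: ennreal_mult'[symmetric])
qed

text \<open>The loss at x itself stays in the statement because the induction integrates it over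
  \<open>bP\<close>; the minorisation of \<open>bP\<close> then turns it into \<open>c0\<close>
  times the mean loss of the next environment.\<close>

lemma ln_Ur_ge:
  assumes "\<omega> \<in> space P" "x \<in> space XN"
  shows "entropy_loss \<omega> x + c0 * (\<Sum>p<n. mean_entropy_loss ((seq_shift ^^ p) (seq_shift \<omega>))) \<le> ln (Ur (Suc n) \<omega> x)"
  using assms
proof (induction n arbitrary: \<omega> x)
  case 0
  have "Ur 0 (seq_shift \<omega>) z = 1" for z by (simp add: Ur_def)
  then show ?case using ln_Ur_step(1)[OF 0, of 0] by simp
next
  case (Suc n)
  note \<omega>' = T_space[OF Suc.prems(1)]
  interpret bP: prob_space "bP \<omega> x" by (rule bP_prob[OF Suc.prems])
  note [measurable_cong] = bP_sets[OF Suc.prems]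
  note [measurable] = Ur_measurable_section[OF \<omega>']
  define s where "s = c0 * (\<Sum>p<n. mean_entropy_loss ((seq_shift ^^ p) (seq_shift (seq_shift \<omega>))))"
  note k = bP_integral_entropy_loss_ge[OF Suc.prems \<omega>']
  have int: "integrable (bP \<omega> x) (\<lambda>z. ln (Ur (Suc n) (seq_shift \<omega>) z))"
    using ln_Ur_range[OF \<omega>', of _ "Suc n"]
    by (intro bP.integrable_const_bound[where B="Suc n * ln harnack_const"]) (auto simp: bP_space[OF Suc.prems] simp del: of_nat_Suc intro!: AE_I2)
  have "c0 * (\<Sum>p<Suc n. mean_entropy_loss ((seq_shift ^^ p) (seq_shift \<omega>))) = c0 * mean_entropy_loss (seq_shift \<omega>) + s"
    unfolding birkhoff_sum_Suc[of mean_entropy_loss] s_def by (simp add: distrib_left)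
  also have "\<dots> \<le> (\<integral>z. entropy_loss (seq_shift \<omega>) z \<partial>(bP \<omega> x)) + s" using k(2) by simp
  also have "\<dots> = (\<integral>z. entropy_loss (seq_shift \<omega>) z + s \<partial>(bP \<omega> x))" using k(1) by (simp add: bP.prob_space)
  also have "\<dots> \<le> (\<integral>z. ln (Ur (Suc n) (seq_shift \<omega>) z) \<partial>(bP \<omega> x))"
    using k(1) int Suc.IH[OF \<omega>'] unfolding s_def by (intro integral_mono) (auto simp: bP_space[OF Suc.prems])
  finally show ?case
    using ln_Ur_step(1)[OF Suc.prems Ur_ge_1[OF \<omega>'], of "Suc n"] by linarith
qed

section \<open>Comparison with the relative variances\<close>

text \<open>The numerator of the relative variance for a chain started in a point, before h and the
  eigenvalues are split off.\<close>

primrec Rn :: "nat \<Rightarrow> (int \<Rightarrow> 'y) \<Rightarrow> (nat \<Rightarrow> 'x) \<Rightarrow> ennreal" where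
  "Rn 0 \<omega> x = 1"
| "Rn (Suc n) \<omega> x = (\<integral>\<^sup>+z. (ennreal (bG \<omega> x))\<^sup>2 * (\<phi> \<omega> x z)\<^sup>2 * Rn n (seq_shift \<omega>) z \<partial>(Mt \<omega> x))"

primrec eigprod :: "nat \<Rightarrow> (int \<Rightarrow> 'y) \<Rightarrow> real" where
  "eigprod 0 \<omega> = 1"
| "eigprod (Suc n) \<omega> = eigval \<omega> * eigprod n (seq_shift \<omega>)"

lemma eigprod_pos: "\<omega> \<in> space P \<Longrightarrow> 0 < eigprod n \<omega>"
  by (induction n arbitrary: \<omega>) (auto intro: mult_pos_pos eigval_pos T_space)

text \<open>With terminal function h instead of 1, n steps multiply h by exactly
  \<open>eigprod n \<omega>\<close>. The two terminal functions differ by a factor at most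
  \<open>H\<close>, and this is lost once, not at every step.\<close>

lemma q_eigprod:
  assumes "\<omega> \<in> space P" "x \<in> space X"
  shows "eigprod n \<omega> * h \<omega> x \<le> H * q n \<omega> x \<and> q n \<omega> x \<le> H * (eigprod n \<omega> * h \<omega> x)"
  using assms
proof (induction n arbitrary: \<omega> x)
  case 0
  then show ?case using h_bounds[OF 0] H_ge_1 by (simp add: field_simps)
next
  case (Suc n)
  let ?\<omega> = "seq_shift \<omega>"
  note \<omega>' = T_space[OF Suc.prems(1)]
  have int: "integrable (M \<omega> x) (q n ?\<omega>)" "integrable (M \<omega> x) (h ?\<omega>)"
    using q_integrable_M(1)[OF Suc.prems] h_integrable(1)[OF \<omega>' M_prob M_sets] Suc.prems by auto
  note IH = Suc.IH[OF \<omega>']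
  have "(\<integral>y. eigprod n ?\<omega> * h ?\<omega> y \<partial>(M \<omega> x)) \<le> (\<integral>y. H * q n ?\<omega> y \<partial>(M \<omega> x))"
    using int IH by (intro integral_mono) (auto simp: M_space[OF Suc.prems])
  then have 1: "G \<omega> x * (eigprod n ?\<omega> * (\<integral>y. h ?\<omega> y \<partial>(M \<omega> x))) \<le> G \<omega> x * (H * (\<integral>y. q n ?\<omega> y \<partial>(M \<omega> x)))"
    using G_pos[OF Suc.prems] by simp
  have "(\<integral>y. q n ?\<omega> y \<partial>(M \<omega> x)) \<le> (\<integral>y. H * (eigprod n ?\<omega> * h ?\<omega> y) \<partial>(M \<omega> x))"
    using int IH by (intro integral_mono) (auto simp: M_space[OF Suc.prems])
  then have 2: "G \<omega> x * (\<integral>y. q n ?\<omega> y \<partial>(M \<omega> x)) \<le> G \<omega> x * (H * (eigprod n ?\<omega> * (\<integral>y. h ?\<omega> y \<partial>(M \<omega> x))))"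
    using G_pos[OF Suc.prems] by simp
  have e: "G \<omega> x * (eigprod n ?\<omega> * (\<integral>y. h ?\<omega> y \<partial>(M \<omega> x))) = eigprod (Suc n) \<omega> * h \<omega> x"
    using h_eigen[OF Suc.prems] by (simp add: mult_ac)
  have "G \<omega> x * (H * (eigprod n ?\<omega> * (\<integral>y. h ?\<omega> y \<partial>(M \<omega> x)))) = H * (eigprod (Suc n) \<omega> * h \<omega> x)"
    unfolding e[symmetric] by (simp add: mult_ac)
  with 1 2 e show ?case by (simp add: mult_ac)
qed

text \<open>By the definitions of \<open>cf\<close> and \<open>w\<close>, \<open>bG \<omega> x *
  \<phi> \<omega> x z * bh (seq_shift \<omega>) z\<close> equals
  \<open>eigval \<omega> * bh \<omega> x * w \<omega> x z\<close>: a transition moves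
  \<open>bh\<close> back by one time step. The parameter L collects the later eigenvalues and u the
  later second moments.\<close>

lemma Rn_identity:
  assumes \<omega>: "\<omega> \<in> space P" and x: "x \<in> space XN" and z: "z \<in> space XN" and c: "0 \<le> c" and L: "0 \<le> L"
  shows "(ennreal (bG \<omega> x))\<^sup>2 * (\<phi> \<omega> x z)\<^sup>2 * (ennreal (c * (L * bh (seq_shift \<omega>) z)\<^sup>2) * u)
    = ennreal (c * (eigval \<omega> * L * bh \<omega> x)\<^sup>2) * ((w \<omega> x z)\<^sup>2 * u)"
proof -
  have p: "0 < bG \<omega> x" "0 < bh (seq_shift \<omega>) z" "0 < eigval \<omega>" "0 < bh \<omega> x" "0 < cf \<omega> x z"
    using bG_pos[OF \<omega> x] bh_pos[OF T_space[OF \<omega>] z] eigval_pos[OF \<omega>] bh_pos[OF \<omega> x] cf_pos[OF \<omega> x z] by auto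
  have cf: "bG \<omega> x * bh (seq_shift \<omega>) z = cf \<omega> x z * (eigval \<omega> * bh \<omega> x)"
    using p by (simp add: cf_def)
  have "(bG \<omega> x)\<^sup>2 * (c * (L * bh (seq_shift \<omega>) z)\<^sup>2) = c * L\<^sup>2 * (bG \<omega> x * bh (seq_shift \<omega>) z)\<^sup>2"
    by (simp add: power_mult_distrib mult_ac)
  also have "\<dots> = c * (eigval \<omega> * L * bh \<omega> x)\<^sup>2 * (cf \<omega> x z)\<^sup>2"
    unfolding cf by (simp add: power_mult_distrib mult_ac)
  finally have e: "(bG \<omega> x)\<^sup>2 * (c * (L * bh (seq_shift \<omega>) z)\<^sup>2) = c * (eigval \<omega> * L * bh \<omega> x)\<^sup>2 * (cf \<omega> x z)\<^sup>2" .
  have "(ennreal (bG \<omega> x))\<^sup>2 * (\<phi> \<omega> x z)\<^sup>2 * (ennreal (c * (L * bh (seq_shift \<omega>) z)\<^sup>2) * u)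
      = ((ennreal (bG \<omega> x))\<^sup>2 * ennreal (c * (L * bh (seq_shift \<omega>) z)\<^sup>2)) * ((\<phi> \<omega> x z)\<^sup>2 * u)"
    by (simp add: mult_ac)
  also have "(ennreal (bG \<omega> x))\<^sup>2 * ennreal (c * (L * bh (seq_shift \<omega>) z)\<^sup>2) = ennreal ((bG \<omega> x)\<^sup>2 * (c * (L * bh (seq_shift \<omega>) z)\<^sup>2))"
    using p by (simp add: ennreal_power ennreal_mult')
  also have "\<dots> = ennreal (c * (eigval \<omega> * L * bh \<omega> x)\<^sup>2) * (ennreal (cf \<omega> x z))\<^sup>2"
    unfolding e using p c by (simp add: ennreal_power ennreal_mult')
  finally show ?thesis by (simp add: w_def power_mult_distrib mult_ac)
qed

lemma bh_sq_bounds: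
  assumes "\<omega> \<in> space P" "x \<in> space XN"
  shows "1 \<le> H\<^sup>2 * (bh \<omega> x)\<^sup>2" "1 / H\<^sup>2 * (bh \<omega> x)\<^sup>2 \<le> 1"
proof -
  have "1 \<le> H * bh \<omega> x" using bh_bounds(1)[OF assms] H_ge_1 by (simp add: field_simps)
  then have "1 \<le> (H * bh \<omega> x)\<^sup>2" by (rule one_le_power)
  then show "1 \<le> H\<^sup>2 * (bh \<omega> x)\<^sup>2" by (simp add: power_mult_distrib)
  have "(bh \<omega> x)\<^sup>2 \<le> H\<^sup>2" using bh_bounds(2)[OF assms] bh_pos[OF assms] by (intro power_mono) auto
  then show "1 / H\<^sup>2 * (bh \<omega> x)\<^sup>2 \<le> 1" using H_ge_1 by (simp add: field_simps)
qed

text \<open>The factors \<open>bh\<close> telescope, leaving the one at the starting point and one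
  at the terminal time. The latter is absorbed into \<open>H\<^sup>2\<close> in the base case;
  \<open>Rn_ge\<close> is the same with the reciprocal.\<close>

lemma Rn_le:
  assumes "\<omega> \<in> space P" "x \<in> space XN"
  shows "Rn n \<omega> x \<le> ennreal (H\<^sup>2 * (eigprod n \<omega> * bh \<omega> x)\<^sup>2) * U n \<omega> x"
  using assms
proof (induction n arbitrary: \<omega> x)
  case 0
  then show ?case using bh_sq_bounds(1)[OF 0] by simp
next
  case (Suc n)
  let ?\<omega> = "seq_shift \<omega>"
  note \<omega>' = T_space[OF Suc.prems(1)]
  note [measurable_cong] = Mt_sets[OF Suc.prems]
  note [measurable] = w_measurable_section[OF Suc.prems] U_measurable_section[OF \<omega>']
  have "Rn (Suc n) \<omega> x \<le> (\<integral>\<^sup>+z. (ennreal (bG \<omega> x))\<^sup>2 * (\<phi> \<omega> x z)\<^sup>2 * (ennreal (H\<^sup>2 * (eigprod n ?\<omega> * bh ?\<omega> z)\<^sup>2) * U n ?\<omega> z) \<partial>(Mt \<omega> x))"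
    unfolding Rn.simps using Suc.IH[OF \<omega>'] by (intro nn_integral_mono mult_left_mono) (auto simp: Mt_space[OF Suc.prems])
  also have "\<dots> = (\<integral>\<^sup>+z. ennreal (H\<^sup>2 * (eigval \<omega> * eigprod n ?\<omega> * bh \<omega> x)\<^sup>2) * ((w \<omega> x z)\<^sup>2 * U n ?\<omega> z) \<partial>(Mt \<omega> x))"
    using eigprod_pos[OF \<omega>', of n] by (intro nn_integral_cong Rn_identity Suc.prems) (auto simp: Mt_space[OF Suc.prems])
  also have "\<dots> = ennreal (H\<^sup>2 * (eigprod (Suc n) \<omega> * bh \<omega> x)\<^sup>2) * U (Suc n) \<omega> x"
    unfolding U.simps eigprod.simps by (rule nn_integral_cmult) measurable
  finally show ?case .
qed

lemma Rn_ge: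
  assumes "\<omega> \<in> space P" "x \<in> space XN"
  shows "ennreal (1 / H\<^sup>2 * (eigprod n \<omega> * bh \<omega> x)\<^sup>2) * U n \<omega> x \<le> Rn n \<omega> x"
  using assms
proof (induction n arbitrary: \<omega> x)
  case 0
  then show ?case using bh_sq_bounds(2)[OF 0] by simp
next
  case (Suc n)
  let ?\<omega> = "seq_shift \<omega>"
  note \<omega>' = T_space[OF Suc.prems(1)]
  note [measurable_cong] = Mt_sets[OF Suc.prems]
  note [measurable] = w_measurable_section[OF Suc.prems] U_measurable_section[OF \<omega>']
  have "ennreal (1 / H\<^sup>2 * (eigprod (Suc n) \<omega> * bh \<omega> x)\<^sup>2) * U (Suc n) \<omega> x
      = (\<integral>\<^sup>+z. ennreal (1 / H\<^sup>2 * (eigval \<omega> * eigprod n ?\<omega> * bh \<omega> x)\<^sup>2) * ((w \<omega> x z)\<^sup>2 * U n ?\<omega> z) \<partial>(Mt \<omega> x))"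
    unfolding U.simps eigprod.simps by (rule nn_integral_cmult[symmetric]) measurable
  also have "\<dots> = (\<integral>\<^sup>+z. (ennreal (bG \<omega> x))\<^sup>2 * (\<phi> \<omega> x z)\<^sup>2 * (ennreal (1 / H\<^sup>2 * (eigprod n ?\<omega> * bh ?\<omega> z)\<^sup>2) * U n ?\<omega> z) \<partial>(Mt \<omega> x))"
    using eigprod_pos[OF \<omega>', of n] by (intro nn_integral_cong Rn_identity[symmetric] Suc.prems) (auto simp: Mt_space[OF Suc.prems])
  also have "\<dots> \<le> Rn (Suc n) \<omega> x"
    unfolding Rn.simps using Suc.IH[OF \<omega>'] by (intro nn_integral_mono mult_left_mono) (auto simp: Mt_space[OF Suc.prems])
  finally show ?case .
qed

lemma V_tilde_eq:
  assumes \<omega>: "\<omega> \<in> space P" and \<mu>: "prob_space \<mu>" "sets \<mu> = sets X"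
  shows "V_tilde X G M N Mt \<phi> \<mu> \<omega> n = (\<integral>\<^sup>+x. Rn n \<omega> x \<partial>(power_measure N \<mu>)) / (ennreal (\<integral>x. q n \<omega> x \<partial>\<mu>))\<^sup>2"
proof -
  let ?\<omega> = "\<lambda>p. shift_pow (int p) \<omega>"
  have \<omega>p: "?\<omega> p \<in> space P" for p using \<omega> by (rule shift_pow_space)
  have sh: "?\<omega> (Suc p) = seq_shift (?\<omega> p)" for p by (simp add: seq_shift_shift_pow)
  have 1: "(\<integral>\<^sup>+\<zeta>. (\<Prod>p<n. (ennreal (bG (?\<omega> p) (\<zeta> p)))\<^sup>2 * (\<phi> (?\<omega> p) (\<zeta> p) (\<zeta> (Suc p)))\<^sup>2)
        \<partial>(markov_law XN (power_measure N \<mu>) (\<lambda>p. Mt (?\<omega> p)))) = (\<integral>\<^sup>+x. Rn n \<omega> x \<partial>(power_measure N \<mu>))"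
  proof -
    let ?F = "\<lambda>p x z. (ennreal (bG (?\<omega> p) x))\<^sup>2 * (\<phi> (?\<omega> p) x z)\<^sup>2"
    have "sets (power_measure N \<mu>) = sets XN" using \<mu>(2) by (intro sets_PiM_cong) auto
    then have \<mu>N: "power_measure N \<mu> \<in> space (prob_algebra XN)"
      using \<mu>(1) by (simp add: space_prob_algebra prob_space_PiM)
    have F: "(\<lambda>(x, y). ?F p x y) \<in> borel_measurable (XN \<Otimes>\<^sub>M XN)" for p
    proof -
      have [measurable]: "bG (?\<omega> p) \<in> borel_measurable XN"
        using measurable_compose[OF measurable_Pair1'[OF \<omega>p] bG_measurable] by simp
      have [measurable]: "(\<lambda>v. \<phi> (?\<omega> p) (fst v) (snd v)) \<in> borel_measurable (XN \<Otimes>\<^sub>M XN)"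
        using measurable_compose[OF measurable_Pair1'[OF \<omega>p] phi_measurable] by (simp add: split_beta')
      show ?thesis unfolding split_beta' by measurable
    qed
    have "path_integral (\<lambda>p. Mt (?\<omega> p)) ?F n p x = Rn n (?\<omega> p) x" for p x n
      by (induction n arbitrary: p x) (simp_all add: sh del: of_nat_Suc)
    then show ?thesis
      using nn_integral_markov_law[OF \<mu>N Mt_measurable_section[OF \<omega>p] F, where n=n] by simp
  qed
  have 2: "(\<integral>\<^sup>+x. (\<Prod>p<n. ennreal (G (?\<omega> p) (x p))) \<partial>(markov_law X \<mu> (\<lambda>p. M (?\<omega> p)))) = ennreal (\<integral>x. q n \<omega> x \<partial>\<mu>)"
  proof -
    let ?F = "\<lambda>p x z. ennreal (G (?\<omega> p) x)"
    have \<mu>': "\<mu> \<in> space (prob_algebra X)" using \<mu> by (simp add: space_prob_algebra)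
    have F: "(\<lambda>(x, y). ?F p x y) \<in> borel_measurable (X \<Otimes>\<^sub>M X)" for p
      using G_measurable_section[OF \<omega>p[of p]] unfolding split_beta' by measurable
    have pi: "path_integral (\<lambda>p. M (?\<omega> p)) ?F n p x = ennreal (q n (?\<omega> p) x)" if "x \<in> space X" for p x n
      using that
    proof (induction n arbitrary: p x)
      case (Suc n)
      note \<omega>' = T_space[OF \<omega>p[of p]]
      have m: "q n (seq_shift (?\<omega> p)) \<in> borel_measurable (M (?\<omega> p) x)"
        using measurable_q_section[OF \<omega>'] M_sets[OF \<omega>p Suc.prems] by (simp cong: measurable_cong_sets)
      have "path_integral (\<lambda>p. M (?\<omega> p)) ?F (Suc n) p x
          = (\<integral>\<^sup>+z. ennreal (G (?\<omega> p) x) * ennreal (q n (seq_shift (?\<omega> p)) z) \<partial>(M (?\<omega> p) x))"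
        unfolding path_integral.simps using Suc.IH[of _ "Suc p"]
        by (intro nn_integral_cong) (simp add: sh M_space[OF \<omega>p Suc.prems] del: of_nat_Suc)
      also have "\<dots> = ennreal (G (?\<omega> p) x) * (\<integral>\<^sup>+z. ennreal (q n (seq_shift (?\<omega> p)) z) \<partial>(M (?\<omega> p) x))"
        using m by (intro nn_integral_cmult) auto
      also have "\<dots> = ennreal (q (Suc n) (?\<omega> p) x)"
        unfolding nn_integral_q[OF \<omega>' M_prob[OF \<omega>p Suc.prems] M_sets[OF \<omega>p Suc.prems]] mass.simps
        using G_pos[OF \<omega>p[of p] Suc.prems] by (simp add: ennreal_mult')
      finally show ?case .
    qed simp
    have "(\<integral>\<^sup>+x. (\<Prod>p<n. ennreal (G (?\<omega> p) (x p))) \<partial>(markov_law X \<mu> (\<lambda>p. M (?\<omega> p))))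
        = (\<integral>\<^sup>+x. path_integral (\<lambda>p. M (?\<omega> p)) ?F n 0 x \<partial>\<mu>)"
      by (rule nn_integral_markov_law[OF \<mu>' M_measurable_section[OF \<omega>p] F])
    also have "\<dots> = (\<integral>\<^sup>+x. ennreal (q n \<omega> x) \<partial>\<mu>)"
      using pi[of _ n 0] by (intro nn_integral_cong) (simp add: sets_eq_imp_space_eq[OF \<mu>(2)])
    finally show ?thesis by (simp add: nn_integral_q[OF \<omega> \<mu>])
  qed
  show ?thesis unfolding V_tilde_def 1 2 ..
qed

text \<open>The numerator loses \<open>H ^ 4\<close>, half of it for each end of the telescoping
  product. The squared denominator, known up to \<open>H\<^sup>2\<close> before squaring, loses
  another \<open>H ^ 4\<close>. The change of starting point costs
  \<open>harnack_const\<close>.\<close>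

definition "variance_const = H ^ 8 * harnack_const"

lemma variance_const_ge_1: "1 \<le> variance_const"
  unfolding variance_const_def using one_le_power[OF H_ge_1, of 8] harnack_const_ge_1 mult_mono[of 1 "H ^ 8" 1 harnack_const] by simp

text \<open>The square of \<open>eigprod n \<omega>\<close> occurs in numerator and denominator and
  cancels. The constant is independent of n, \<omega> and the initial law, so relative variances and
  second moments share growth rate and boundedness.\<close>

lemma V_tilde_bounds:
  assumes \<omega>: "\<omega> \<in> space P" and \<mu>: "prob_space \<mu>" "sets \<mu> = sets X" and x0: "x0 \<in> space XN"
  obtains v where "V_tilde X G M N Mt \<phi> \<mu> \<omega> n = ennreal v" "Ur n \<omega> x0 \<le> variance_const * v" "v \<le> variance_const * Ur n \<omega> x0"
proof -
  interpret \<mu>: prob_space \<mu> by fact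
  define L where "L = eigprod n \<omega>"
  have L: "0 < L" unfolding L_def by (rule eigprod_pos[OF \<omega>])
  define u where "u = Ur n \<omega> x0"
  have u: "1 \<le> u" unfolding u_def by (rule Ur_ge_1[OF \<omega> x0])
  have H: "1 \<le> H" "0 < H" using H_ge_1 by auto
  define D where "D = (\<integral>x. q n \<omega> x \<partial>\<mu>)"
  have sp: "space \<mu> = space X" using \<mu>(2) by (rule sets_eq_imp_space_eq)
  have q: "L / H\<^sup>2 \<le> q n \<omega> x \<and> q n \<omega> x \<le> H\<^sup>2 * L" if x: "x \<in> space X" for x
  proof -
    have "L / H\<^sup>2 = L * (1 / H) / H" by (simp add: power2_eq_square)
    also have "\<dots> \<le> L * h \<omega> x / H" using h_bounds(1)[OF \<omega> x] L H by (intro divide_right_mono mult_left_mono) auto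
    also have "\<dots> \<le> q n \<omega> x" using q_eigprod[OF \<omega> x, of n] H by (simp add: L_def field_simps)
    finally have 1: "L / H\<^sup>2 \<le> q n \<omega> x" .
    have "q n \<omega> x \<le> H * (L * h \<omega> x)" using q_eigprod[OF \<omega> x, of n] by (simp add: L_def)
    also have "\<dots> \<le> H * (L * H)" using h_bounds(2)[OF \<omega> x] L H by (intro mult_left_mono) auto
    finally show ?thesis using 1 by (simp add: power2_eq_square mult_ac)
  qed
  have int: "integrable \<mu> (q n \<omega>)" by (rule q_integrable(1)[OF \<omega> \<mu>])
  have D: "L / H\<^sup>2 \<le> D" "D \<le> H\<^sup>2 * L" unfolding D_def
    using int q by (auto intro!: \<mu>.integral_ge_const \<mu>.integral_le_const AE_I2 simp: sp)
  have Dpos: "0 < D" unfolding D_def by (rule q_integrable(2)[OF \<omega> \<mu>])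
  interpret \<mu>N: prob_space "power_measure N \<mu>" by (intro prob_space_PiM \<mu>)
  have s\<mu>N: "sets (power_measure N \<mu>) = sets XN" using \<mu>(2) by (intro sets_PiM_cong) auto
  have sp\<mu>N: "space (power_measure N \<mu>) = space XN" using s\<mu>N by (rule sets_eq_imp_space_eq)
  define A where "A = (\<integral>\<^sup>+x. Rn n \<omega> x \<partial>(power_measure N \<mu>))"
  have "Rn n \<omega> x \<le> ennreal (H ^ 4 * L\<^sup>2 * harnack_const * u)" if x: "x \<in> space XN" for x
  proof -
    have "Rn n \<omega> x \<le> ennreal (H\<^sup>2 * (L * bh \<omega> x)\<^sup>2) * U n \<omega> x" unfolding L_def by (rule Rn_le[OF \<omega> x])
    also have "\<dots> \<le> ennreal (H\<^sup>2 * (L * H)\<^sup>2) * (ennreal harnack_const * U n \<omega> x0)"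
      using bh_bounds(2)[OF \<omega> x] bh_pos[OF \<omega> x] L H
      by (intro mult_mono ennreal_leI mult_left_mono power_mono U_harnack \<omega> x x0) auto
    also have "\<dots> = ennreal (H ^ 4 * L\<^sup>2 * harnack_const * u)"
      unfolding U_eq_Ur[OF \<omega> x0] u_def[symmetric] using harnack_const_ge_1 u
      by (simp add: ennreal_mult'[symmetric] power_mult_distrib power2_eq_square power4_eq_xxxx mult_ac)
    finally show ?thesis .
  qed
  then have "A \<le> (\<integral>\<^sup>+x. ennreal (H ^ 4 * L\<^sup>2 * harnack_const * u) \<partial>(power_measure N \<mu>))"
    unfolding A_def by (intro nn_integral_mono) (simp add: sp\<mu>N)
  then have A_le: "A \<le> ennreal (H ^ 4 * L\<^sup>2 * harnack_const * u)" by (simp add: \<mu>N.emeasure_space_1)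
  have "ennreal (L\<^sup>2 / (H ^ 4 * harnack_const) * u) \<le> Rn n \<omega> x" if x: "x \<in> space XN" for x
  proof -
    have "ennreal (L\<^sup>2 / (H ^ 4 * harnack_const) * u) = ennreal (1 / H\<^sup>2 * (L * (1 / H))\<^sup>2) * (ennreal (1 / harnack_const) * ennreal u)"
      using harnack_const_ge_1 u H L by (simp add: ennreal_mult'[symmetric] power_mult_distrib power2_eq_square power4_eq_xxxx field_simps)
    also have "\<dots> \<le> ennreal (1 / H\<^sup>2 * (L * bh \<omega> x)\<^sup>2) * (ennreal (1 / harnack_const) * (ennreal harnack_const * U n \<omega> x))"
      using U_harnack[OF \<omega> x0 x, of n] bh_bounds(1)[OF \<omega> x] L H
      by (intro mult_mono ennreal_leI mult_left_mono power_mono) (auto simp: U_eq_Ur[OF \<omega> x0] u_def)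
    also have "\<dots> = ennreal (1 / H\<^sup>2 * (L * bh \<omega> x)\<^sup>2) * U n \<omega> x"
      using harnack_const_ge_1 by (simp add: mult.assoc[symmetric] ennreal_mult'[symmetric])
    also have "\<dots> \<le> Rn n \<omega> x" unfolding L_def by (rule Rn_ge[OF \<omega> x])
    finally show ?thesis .
  qed
  then have "(\<integral>\<^sup>+x. ennreal (L\<^sup>2 / (H ^ 4 * harnack_const) * u) \<partial>(power_measure N \<mu>)) \<le> A"
    unfolding A_def by (intro nn_integral_mono) (simp add: sp\<mu>N)
  then have A_ge: "ennreal (L\<^sup>2 / (H ^ 4 * harnack_const) * u) \<le> A" by (simp add: \<mu>N.emeasure_space_1)
  obtain a where a: "A = ennreal a" "0 \<le> a"
    using A_le by (cases A) (auto simp: top_unique)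
  have nn: "0 \<le> H ^ 4 * L\<^sup>2 * harnack_const * u" "0 \<le> L\<^sup>2 / (H ^ 4 * harnack_const) * u" using H harnack_const_ge_1 u by auto
  have a_le: "a \<le> H ^ 4 * L\<^sup>2 * harnack_const * u" using A_le nn by (simp add: a)
  have a_ge: "L\<^sup>2 / (H ^ 4 * harnack_const) * u \<le> a" using A_ge a by (simp add: a)
  show thesis
  proof (rule that)
    show "V_tilde X G M N Mt \<phi> \<mu> \<omega> n = ennreal (a / D\<^sup>2)"
      unfolding V_tilde_eq[OF \<omega> \<mu>] A_def[symmetric] D_def[symmetric] a(1)
      using Dpos a(2) by (simp add: ennreal_power divide_ennreal)
    have D2: "L\<^sup>2 / H ^ 4 \<le> D\<^sup>2" "D\<^sup>2 \<le> H ^ 4 * L\<^sup>2"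
    proof -
      have "(L / H\<^sup>2)\<^sup>2 \<le> D\<^sup>2" "D\<^sup>2 \<le> (H\<^sup>2 * L)\<^sup>2" using D L H Dpos by (auto intro!: power_mono)
      then show "L\<^sup>2 / H ^ 4 \<le> D\<^sup>2" "D\<^sup>2 \<le> H ^ 4 * L\<^sup>2"
        by (simp_all add: power_mult_distrib power_divide flip: power_mult)
    qed
    define K where "K = H ^ 4"
    have K: "0 < K" "H ^ 4 = K" "H ^ 8 = K * K" using H by (simp_all add: K_def flip: power_add)
    have "a \<le> K * K * harnack_const * u * (L\<^sup>2 / K)"
      using a_le K(1) by (simp add: K(2) mult_ac)
    also have "\<dots> \<le> K * K * harnack_const * u * D\<^sup>2"
      using D2(1) K(1) harnack_const_ge_1 u unfolding K(2) by (intro mult_left_mono) auto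
    finally show "a / D\<^sup>2 \<le> variance_const * Ur n \<omega> x0"
      using Dpos by (simp add: variance_const_def K(3) u_def[symmetric] divide_le_eq)
    have "u * D\<^sup>2 \<le> u * (K * L\<^sup>2)" using D2(2) u unfolding K(2) by (intro mult_left_mono) auto
    also have "\<dots> = K * K * harnack_const * (L\<^sup>2 / (K * harnack_const) * u)" using K(1) harnack_const_ge_1 by simp
    also have "\<dots> \<le> K * K * harnack_const * a"
      using a_ge K(1) harnack_const_ge_1 unfolding K(2) by (intro mult_left_mono) auto
    finally show "Ur n \<omega> x0 \<le> variance_const * (a / D\<^sup>2)"
      using Dpos by (simp add: variance_const_def K(3) u_def[symmetric] le_divide_eq)
  qed
qed

section \<open>The growth rate\<close>

abbreviation "rate \<equiv> Upsilon P X G M N Mt \<phi>"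

text \<open>All three facts depend on evaluating the description in \<open>Upsilon\<close>, which is
  done once. The limit of the second moments at a fixed point comes from almost additivity, and
  \<open>V_tilde_bounds\<close> carries it over to every initial law.\<close>

lemma rate_nonneg: "0 \<le> rate"
  and V_tilde_rate: "prob_space \<mu> \<Longrightarrow> sets \<mu> = sets X \<Longrightarrow>
    AE \<omega> in P. (\<lambda>n. (1 / real n) * ln (enn2real (V_tilde X G M N Mt \<phi> \<mu> \<omega> n))) \<longlonglongrightarrow> rate"
  and integral_ln_Ur_le: "x \<in> space XN \<Longrightarrow> rate = 0 \<Longrightarrow> (\<integral>\<omega>. ln (Ur k \<omega> x) \<partial>P) \<le> 2 * ln harnack_const"
proof -
  have lim_x: "\<exists>c. (AE \<omega> in P. (\<lambda>n. ln (Ur n \<omega> x) / n) \<longlonglongrightarrow> c) \<and> (\<forall>k. \<bar>k * c - (\<integral>\<omega>. ln (Ur k \<omega> x) \<partial>P)\<bar> \<le> 2 * ln harnack_const)"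
    if x: "x \<in> space XN" for x
  proof -
    have m: "(\<lambda>\<omega>. ln (Ur n \<omega> x)) \<in> borel_measurable P" for n
    proof -
      have "(\<lambda>\<omega>. Ur n \<omega> x) \<in> borel_measurable P"
        using measurable_compose[OF measurable_Pair2'[OF x] Ur_measurable] by simp
      then show ?thesis by measurable
    qed
    have b: "\<bar>ln (Ur n \<omega> x)\<bar> \<le> n * ln harnack_const" if "\<omega> \<in> space P" for n \<omega>
      using ln_Ur_range[OF that x, of n] by simp
    have aa: "\<bar>ln (Ur (n + m) \<omega> x) - ln (Ur n \<omega> x) - ln (Ur m ((seq_shift ^^ n) \<omega>) x)\<bar> \<le> ln harnack_const"
      if \<omega>: "\<omega> \<in> space P" for n m \<omega>
    proof -
      have s: "(seq_shift ^^ n) \<omega> = shift_pow (int n) \<omega>" by (simp add: shift_pow_of_nat)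
      define a b c where "a = Ur (n + m) \<omega> x" and "b = Ur n \<omega> x" and "c = Ur m (shift_pow (int n) \<omega>) x"
      note \<omega>n = shift_pow_space[OF \<omega>, of "int n"]
      have p: "1 \<le> a" "1 \<le> b" "1 \<le> c" unfolding a_def b_def c_def using Ur_ge_1 \<omega> \<omega>n x by auto
      have "a \<le> harnack_const * c * b" "c * b \<le> harnack_const * a"
        using U_mult_le[OF \<omega> x x, of n m] U_mult_ge[OF \<omega> x x, of m n] p harnack_const_ge_1
        by (simp_all add: U_eq_Ur \<omega> \<omega>n x a_def b_def c_def ennreal_mult'[symmetric])
      then have "ln a \<le> ln (harnack_const * c * b)" "ln (c * b) \<le> ln (harnack_const * a)"
        using p harnack_const_ge_1 by (auto intro!: ln_mono mult_pos_pos)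
      then have "\<bar>ln a - ln b - ln c\<bar> \<le> ln harnack_const" using p harnack_const_ge_1 by (simp add: ln_mult)
      then show ?thesis unfolding s a_def b_def c_def .
    qed
    show ?thesis by (rule almost_additive_limit[OF m b aa]) blast+
  qed
  obtain x0 where x0: "x0 \<in> space XN" using XN_nonempty by blast
  obtain c where c: "AE \<omega> in P. (\<lambda>n. ln (Ur n \<omega> x0) / n) \<longlonglongrightarrow> c"
    using lim_x[OF x0] by blast
  have unique: "c1 = c2" if "AE \<omega> in P. (\<lambda>n. f \<omega> n) \<longlonglongrightarrow> c1" "AE \<omega> in P. (\<lambda>n. f \<omega> n) \<longlonglongrightarrow> c2" for f c1 and c2 :: real
  proof -
    have "AE \<omega> in P. c1 = c2" using that by eventually_elim (rule LIMSEQ_unique)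
    then show ?thesis by simp
  qed
  have V: "AE \<omega> in P. (\<lambda>n. (1 / real n) * ln (enn2real (V_tilde X G M N Mt \<phi> \<mu> \<omega> n))) \<longlonglongrightarrow> l"
    if \<mu>: "prob_space \<mu>" "sets \<mu> = sets X" and x: "x \<in> space XN" and l: "AE \<omega> in P. (\<lambda>n. ln (Ur n \<omega> x) / n) \<longlonglongrightarrow> l" for \<mu> x l
    using l AE_space
  proof eventually_elim
    case (elim \<omega>)
    define v where "v n = enn2real (V_tilde X G M N Mt \<phi> \<mu> \<omega> n)" for n
    have vb: "\<bar>ln (v n) - ln (Ur n \<omega> x)\<bar> \<le> ln variance_const" for n
    proof -
      obtain v' where v': "V_tilde X G M N Mt \<phi> \<mu> \<omega> n = ennreal v'" "Ur n \<omega> x \<le> variance_const * v'" "v' \<le> variance_const * Ur n \<omega> x"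
        using V_tilde_bounds[OF elim(2) \<mu> x] .
      have u: "1 \<le> Ur n \<omega> x" by (rule Ur_ge_1[OF elim(2) x])
      then have "0 < variance_const * v'" using v' by linarith
      then have vp: "0 < v'" using variance_const_ge_1 by (simp add: zero_less_mult_iff)
      then have vn: "v n = v'" by (simp add: v_def v')
      have "ln (Ur n \<omega> x) \<le> ln (variance_const * v')" "ln v' \<le> ln (variance_const * Ur n \<omega> x)"
        using v' u vp by (auto intro!: ln_mono)
      then show ?thesis using u vp variance_const_ge_1 by (simp add: vn ln_mult)
    qed
    have "(\<lambda>n. ln (v n) / n - ln (Ur n \<omega> x) / n) \<longlonglongrightarrow> 0"
    proof (rule Lim_null_comparison[OF _ lim_const_over_n[of "ln variance_const"]])
      show "\<forall>\<^sub>F n in sequentially. norm (ln (v n) / n - ln (Ur n \<omega> x) / n) \<le> ln variance_const / real n"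
        using vb by (intro always_eventually allI) (simp add: diff_divide_distrib[symmetric] divide_right_mono)
    qed
    from tendsto_add[OF this elim(1)] show ?case by (simp add: v_def)
  qed
  have Vc: "AE \<omega> in P. (\<lambda>n. (1 / real n) * ln (enn2real (V_tilde X G M N Mt \<phi> \<mu> \<omega> n))) \<longlonglongrightarrow> c"
    if "prob_space \<mu>" "sets \<mu> = sets X" for \<mu>
    using V[OF that x0 c] .
  have c0: "0 \<le> c"
  proof -
    have "AE \<omega> in P. 0 \<le> c"
      using c AE_space
    proof eventually_elim
      case (elim \<omega>)
      show ?case using ln_Ur_range(1)[OF elim(2) x0] by (intro LIMSEQ_le_const[OF elim(1)]) auto
    qed
    then show ?thesis by simp
  qed
  have Ups: "Upsilon P X G M N Mt \<phi> = c"
    unfolding Upsilon_def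
  proof (rule the_equality)
    show "0 \<le> c \<and> (\<forall>\<mu>0\<in>space (prob_algebra X). AE \<omega> in P.
        (\<lambda>n. (1 / real n) * ln (enn2real (V_tilde X G M N Mt \<phi> \<mu>0 \<omega> n))) \<longlonglongrightarrow> c)"
      using c0 Vc by (auto simp: space_prob_algebra)
    fix l assume l: "0 \<le> l \<and> (\<forall>\<mu>0\<in>space (prob_algebra X). AE \<omega> in P.
        (\<lambda>n. (1 / real n) * ln (enn2real (V_tilde X G M N Mt \<phi> \<mu>0 \<omega> n))) \<longlonglongrightarrow> l)"
    \<comment> \<open>Convergence for the single initial law \<nu> already determines any other
      candidate.\<close>
    have "\<nu> \<in> space (prob_algebra X)" using nu by (simp add: space_prob_algebra)
    with l have "AE \<omega> in P. (\<lambda>n. (1 / real n) * ln (enn2real (V_tilde X G M N Mt \<phi> \<nu> \<omega> n))) \<longlonglongrightarrow> l"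
      by blast
    then show "l = c" by (rule unique[OF _ Vc[OF nu]])
  qed
  have "(\<integral>\<omega>. ln (Ur k \<omega> x) \<partial>P) \<le> 2 * ln harnack_const" if x: "x \<in> space XN" and "c = 0" for x k
  proof -
    obtain c' where c': "AE \<omega> in P. (\<lambda>n. ln (Ur n \<omega> x) / n) \<longlonglongrightarrow> c'"
      "\<And>k. \<bar>k * c' - (\<integral>\<omega>. ln (Ur k \<omega> x) \<partial>P)\<bar> \<le> 2 * ln harnack_const"
      using lim_x[OF x] by blast
    \<comment> \<open>Different points could a priori have different limits; both numbers are the
      growth rate of the relative variance started from \<nu>.\<close>
    have "c' = c" by (rule unique[OF V[OF nu x c'(1)] Vc[OF nu]])
    then show ?thesis using c'(2)[of k] \<open>c = 0\<close> by simp
  qed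
  with c0 Vc show "0 \<le> rate"
    and "prob_space \<mu> \<Longrightarrow> sets \<mu> = sets X \<Longrightarrow>
      AE \<omega> in P. (\<lambda>n. (1 / real n) * ln (enn2real (V_tilde X G M N Mt \<phi> \<mu> \<omega> n))) \<longlonglongrightarrow> rate"
    and "x \<in> space XN \<Longrightarrow> rate = 0 \<Longrightarrow> (\<integral>\<omega>. ln (Ur k \<omega> x) \<partial>P) \<le> 2 * ln harnack_const"
    unfolding Ups by auto
qed

section \<open>The implications from (1) to (2), from (2) to (3) and from (3) to (1)\<close>

definition "optimal_at \<omega> \<longleftrightarrow> (\<exists>A\<in>sets XN. emeasure nuN (space XN - A) = 0 \<and>
  (\<forall>x\<in>A. \<forall>B\<in>sets XN. measure (Mt \<omega> x) B =
    (LINT x':B|bM \<omega> x. bh (seq_shift \<omega>) x') / (LINT z|bM \<omega> x. bh (seq_shift \<omega>) z)))"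

text \<open>At rate 0 the means of \<open>ln (Ur k \<omega> x0)\<close> stay bounded in k, whereas
  \<open>ln_Ur_ge\<close> and invariance make them grow at least like k times \<open>c0 * K\<close>.
  So the mean loss K is 0, and the loss vanishes for almost every environment at
  \<open>nuN\<close>-almost every point.\<close>

lemma optimal_of_growth_rate_0:
  assumes "rate = 0"
  shows "AE \<omega> in P. optimal_at \<omega>"
proof -
  obtain x0 where x0: "x0 \<in> space XN" using XN_nonempty by blast
  have ln_le: "(\<integral>\<omega>. ln (Ur k \<omega> x0) \<partial>P) \<le> 2 * ln harnack_const" for k
    by (rule integral_ln_Ur_le[OF x0 assms])
  define K where "K = (\<integral>\<omega>. mean_entropy_loss \<omega> \<partial>P)"
  have kint: "integrable P (\<lambda>\<omega>. mean_entropy_loss ((seq_shift ^^ p) (seq_shift \<omega>)))" for p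
    using mean_entropy_loss_range funpow_space T_space by (intro integrable_const_bound[where B=1]) (auto intro!: AE_I2)
  have K0: "0 \<le> K" unfolding K_def using mean_entropy_loss_range by (intro integral_nonneg_AE AE_I2) auto
  have step: "n * (c0 * K) \<le> 2 * ln harnack_const" for n :: nat
  proof -
    have Kp: "(\<integral>\<omega>. mean_entropy_loss ((seq_shift ^^ p) (seq_shift \<omega>)) \<partial>P) = K" for p
    proof -
      have "(\<integral>\<omega>. mean_entropy_loss ((seq_shift ^^ p) (seq_shift \<omega>)) \<partial>P) = (\<integral>\<omega>. mean_entropy_loss ((seq_shift ^^ Suc p) \<omega>) \<partial>P)"
        by (simp add: funpow_swap1)
      also have "\<dots> = K" unfolding K_def by (rule integral_funpow) measurable
      finally show ?thesis .
    qed
    have "n * (c0 * K) = c0 * (\<Sum>p<n. K)" by simp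
    also have "\<dots> = (\<integral>\<omega>. c0 * (\<Sum>p<n. mean_entropy_loss ((seq_shift ^^ p) (seq_shift \<omega>))) \<partial>P)"
      using kint by (simp add: Kp Bochner_Integration.integral_sum)
    also have "\<dots> \<le> (\<integral>\<omega>. ln (Ur (Suc n) \<omega> x0) \<partial>P)"
    proof (rule integral_mono)
      show "integrable P (\<lambda>\<omega>. c0 * (\<Sum>p<n. mean_entropy_loss ((seq_shift ^^ p) (seq_shift \<omega>))))"
        using kint by (intro integrable_mult_right Bochner_Integration.integrable_sum) auto
      have "(\<lambda>\<omega>. Ur (Suc n) \<omega> x0) \<in> borel_measurable P"
        using measurable_compose[OF measurable_Pair2'[OF x0] Ur_measurable] by simp
      then show "integrable P (\<lambda>\<omega>. ln (Ur (Suc n) \<omega> x0))"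
        using ln_Ur_range[OF _ x0, of _ "Suc n"]
        by (intro integrable_const_bound[where B="Suc n * ln harnack_const"]) (auto simp del: of_nat_Suc intro!: AE_I2)
      show "c0 * (\<Sum>p<n. mean_entropy_loss ((seq_shift ^^ p) (seq_shift \<omega>))) \<le> ln (Ur (Suc n) \<omega> x0)" if "\<omega> \<in> space P" for \<omega>
        using ln_Ur_ge[OF that x0, of n] entropy_loss_range(1)[OF that x0] by linarith
    qed
    also have "\<dots> \<le> 2 * ln harnack_const" by (rule ln_le)
    finally show ?thesis .
  qed
  have "K = 0"
  proof (rule ccontr)
    assume "K \<noteq> 0"
    then have p: "0 < c0 * K" using K0 c0_pos by simp
    obtain n :: nat where "2 * ln harnack_const < n * (c0 * K)" using reals_Archimedean3[OF p] by blast
    with step[of n] show False by simp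
  qed
  have "integrable P mean_entropy_loss"
    using mean_entropy_loss_range by (intro integrable_const_bound[where B=1]) (auto intro!: AE_I2)
  then have "AE \<omega> in P. mean_entropy_loss \<omega> = 0"
    using \<open>K = 0\<close> mean_entropy_loss_range unfolding K_def
    by (subst (asm) integral_nonneg_eq_0_iff_AE) (auto intro!: AE_I2)
  with AE_space show ?thesis
  proof eventually_elim
    case (elim \<omega>)
    then have \<omega>: "\<omega> \<in> space P" by simp
    note [measurable] = entropy_loss_measurable_section[OF \<omega>]
    define A where "A = {x \<in> space XN. entropy_loss \<omega> x = 0}"
    have A: "A \<in> sets XN" unfolding A_def by measurable
    have "AE x in nuN. entropy_loss \<omega> x = 0"
      using elim(2) entropy_loss_integrable_nuN[OF \<omega>] entropy_loss_range[OF \<omega>] unfolding mean_entropy_loss_def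
      by (subst (asm) integral_nonneg_eq_0_iff_AE) (auto simp: space_nuN intro!: AE_I2)
    moreover have "{x \<in> space nuN. \<not> entropy_loss \<omega> x = 0} = space XN - A" by (auto simp: A_def space_nuN)
    ultimately have "emeasure nuN (space XN - A) = 0"
      using A by (subst (asm) AE_iff_measurable) (auto simp: sets_nuN)
    moreover have "measure (Mt \<omega> x) B = (LINT x':B|bM \<omega> x. bh (seq_shift \<omega>) x') / (LINT z|bM \<omega> x. bh (seq_shift \<omega>) z)"
      if "x \<in> A" "B \<in> sets XN" for x B
    proof -
      have x: "x \<in> space XN" "entropy_loss \<omega> x = 0" using that by (auto simp: A_def)
      have "w \<omega> x \<in> borel_measurable (Mt \<omega> x)"
        using w_measurable_section[OF \<omega> x(1)] Mt_sets[OF \<omega> x(1)] by (simp cong: measurable_cong_sets)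
      then have "bP \<omega> x = Mt \<omega> x"
        unfolding bP_def using Mt_prob[OF \<omega> x(1)] bP_prob[OF \<omega> x(1)] x(2)
        by (intro density_eq_of_entropy_defect_0) (auto simp: entropy_loss_def bP_def)
      then show ?thesis using measure_bP[OF \<omega> x(1) that(2)] by simp
    qed
    ultimately show ?case unfolding optimal_at_def using A by blast
  qed
qed

lemma optimal_at_imp_AE:
  assumes \<omega>: "\<omega> \<in> space P" and opt: "optimal_at \<omega>"
  shows "AE x in nuN. bP \<omega> x = Mt \<omega> x"
proof -
  obtain A where A: "A \<in> sets XN" "emeasure nuN (space XN - A) = 0"
    and eq: "\<And>x B. x \<in> A \<Longrightarrow> B \<in> sets XN \<Longrightarrow> measure (Mt \<omega> x) B =
      (LINT x':B|bM \<omega> x. bh (seq_shift \<omega>) x') / (LINT z|bM \<omega> x. bh (seq_shift \<omega>) z)"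
    using opt unfolding optimal_at_def by blast
  have "space XN - A \<in> null_sets nuN" using A by (auto simp: null_sets_def sets_nuN)
  then show ?thesis
  proof (rule AE_I')
    have "bP \<omega> x = Mt \<omega> x" if "x \<in> A" for x
    proof -
      have x: "x \<in> space XN" using A sets.sets_into_space that by blast
      interpret Mtx: prob_space "Mt \<omega> x" by (rule Mt_prob[OF \<omega> x])
      interpret bPx: prob_space "bP \<omega> x" by (rule bP_prob[OF \<omega> x])
      show ?thesis
        using eq[OF that] measure_bP[OF \<omega> x]
        by (intro measure_eqI) (auto simp: bP_sets[OF \<omega> x] Mt_sets[OF \<omega> x] Mtx.emeasure_eq_measure bPx.emeasure_eq_measure)
    qed
    then show "{x \<in> space nuN. \<not> bP \<omega> x = Mt \<omega> x} \<subseteq> space XN - A" by (auto simp: space_nuN)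
  qed
qed

text \<open>From a good point \<open>w\<close> is 1 almost surely. The next position is drawn from
  \<open>Mt\<close>, which agrees with \<open>bP\<close> there and so charges no
  \<open>nuN\<close>-null set: it is again a good point for the shifted environment.\<close>

lemma AE_U_le_1:
  assumes "\<omega> \<in> space P" and "\<And>k. optimal_at ((seq_shift ^^ k) \<omega>)"
  shows "AE x in nuN. U n \<omega> x \<le> 1"
  using assms
proof (induction n arbitrary: \<omega>)
  case (Suc n)
  note \<omega>' = T_space[OF Suc.prems(1)]
  have "optimal_at ((seq_shift ^^ k) (seq_shift \<omega>))" for k
    using Suc.prems(2)[of "Suc k"] by (simp add: funpow_swap1)
  from Suc.IH[OF \<omega>' this] have IH: "AE z in nuN. U n (seq_shift \<omega>) z \<le> 1" .
  have "optimal_at \<omega>" using Suc.prems(2)[of 0] by simp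
  from optimal_at_imp_AE[OF Suc.prems(1) this] AE_space[of nuN] show ?case
  proof eventually_elim
    case (elim x)
    then have x: "x \<in> space XN" by (simp add: space_nuN)
    interpret Mtx: prob_space "Mt \<omega> x" by (rule Mt_prob[OF Suc.prems(1) x])
    have "w \<omega> x \<in> borel_measurable (Mt \<omega> x)"
      using w_measurable_section[OF Suc.prems(1) x] Mt_sets[OF Suc.prems(1) x] by (simp cong: measurable_cong_sets)
    then have w1: "AE z in Mt \<omega> x. w \<omega> x z = 1"
      using elim(1) Mtx.prob_space_axioms unfolding bP_def by (intro AE_eq_1_of_density_eq) auto
    have "AE z in Mt \<omega> x. U n (seq_shift \<omega>) z \<le> 1"
      using AE_bP[OF Suc.prems(1) x IH] unfolding elim(1) .
    with w1 have "AE z in Mt \<omega> x. (w \<omega> x z)\<^sup>2 * U n (seq_shift \<omega>) z \<le> 1"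
      by eventually_elim simp
    then have "U (Suc n) \<omega> x \<le> (\<integral>\<^sup>+z. 1 \<partial>(Mt \<omega> x))"
      unfolding U.simps by (rule nn_integral_mono_AE)
    then show ?case by (simp add: Mtx.emeasure_space_1)
  qed
qed simp

text \<open>From an arbitrary point the first weight need not be 1. Yet wherever it is positive the
  next position is good almost surely, so the later transitions contribute at most 1 and the first
  one at most \<open>harnack_const\<close>.\<close>

lemma U_le_harnack_const:
  assumes \<omega>: "\<omega> \<in> space P" and opt: "\<And>k. optimal_at ((seq_shift ^^ k) \<omega>)" and x: "x \<in> space XN"
  shows "U n \<omega> x \<le> ennreal harnack_const"
proof (cases n)
  case 0
  then show ?thesis using harnack_const_ge_1 by simp
next
  case (Suc m)
  have "optimal_at ((seq_shift ^^ k) (seq_shift \<omega>))" for k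
    using opt[of "Suc k"] by (simp add: funpow_swap1)
  from AE_bP[OF \<omega> x AE_U_le_1[OF T_space[OF \<omega>] this]]
  have "AE z in bP \<omega> x. U m (seq_shift \<omega>) z \<le> 1" .
  moreover have "w \<omega> x \<in> borel_measurable (Mt \<omega> x)"
    using w_measurable_section[OF \<omega> x] Mt_sets[OF \<omega> x] by (simp cong: measurable_cong_sets)
  ultimately have "AE z in Mt \<omega> x. 0 < w \<omega> x z \<longrightarrow> U m (seq_shift \<omega>) z \<le> 1"
    unfolding bP_def by (subst (asm) AE_density) auto
  then have "AE z in Mt \<omega> x. (w \<omega> x z)\<^sup>2 * U m (seq_shift \<omega>) z \<le> (w \<omega> x z)\<^sup>2"
  proof eventually_elim
    case (elim z)
    show ?case
    proof (cases "w \<omega> x z = 0")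
      case False
      then have "U m (seq_shift \<omega>) z \<le> 1" using elim by (simp add: zero_less_iff_neq_zero)
      from mult_left_mono[OF this, of "(w \<omega> x z)\<^sup>2"] show ?thesis by simp
    qed simp
  qed
  then have "U n \<omega> x \<le> (\<integral>\<^sup>+z. (w \<omega> x z)\<^sup>2 \<partial>(Mt \<omega> x))"
    unfolding Suc U.simps by (rule nn_integral_mono_AE)
  then show ?thesis using harnack_bound[OF \<omega> x] by (rule order.trans)
qed

lemma V_tilde_bounded_of_optimal:
  assumes opt: "AE \<omega> in P. optimal_at \<omega>" and \<mu>: "prob_space \<mu>" "sets \<mu> = sets X"
  shows "AE \<omega> in P. (SUP n. V_tilde X G M N Mt \<phi> \<mu> \<omega> n) < \<infinity>"
  using AE_funpow[OF opt] AE_space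
proof eventually_elim
  case (elim \<omega>)
  obtain x0 where x0: "x0 \<in> space XN" using XN_nonempty by blast
  have "V_tilde X G M N Mt \<phi> \<mu> \<omega> n \<le> ennreal (variance_const * harnack_const)" for n
  proof -
    obtain v where v: "V_tilde X G M N Mt \<phi> \<mu> \<omega> n = ennreal v" "Ur n \<omega> x0 \<le> variance_const * v" "v \<le> variance_const * Ur n \<omega> x0"
      using V_tilde_bounds[OF elim(2) \<mu> x0] .
    have "Ur n \<omega> x0 \<le> harnack_const" unfolding Ur_def
      using U_le_harnack_const[OF elim(2) _ x0] elim(1) harnack_const_ge_1 by (intro enn2real_leI) auto
    then have "v \<le> variance_const * harnack_const" using v(3) variance_const_ge_1 by (meson mult_left_mono order.trans zero_le_one)
    then show ?thesis by (simp add: v ennreal_leI)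
  qed
  then have "(SUP n. V_tilde X G M N Mt \<phi> \<mu> \<omega> n) \<le> ennreal (variance_const * harnack_const)" by (rule SUP_least)
  then show ?case by (rule le_less_trans) simp
qed

text \<open>A bounded logarithm divided by n tends to 0, and the rate is nonnegative. The comparison
  with \<open>Ur\<close>, which is at least 1, keeps the argument of the logarithm positive.\<close>

lemma growth_rate_0_of_bounded:
  assumes bdd: "AE \<omega> in P. (SUP n. V_tilde X G M N Mt \<phi> \<mu> \<omega> n) < \<infinity>" and \<mu>: "prob_space \<mu>" "sets \<mu> = sets X"
  shows "rate = 0"
proof -
  obtain x0 where x0: "x0 \<in> space XN" using XN_nonempty by blast
  have "AE \<omega> in P. rate \<le> 0"
    using V_tilde_rate[OF \<mu>] bdd AE_space
  proof eventually_elim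
    case (elim \<omega>)
    define S where "S = (SUP n. V_tilde X G M N Mt \<phi> \<mu> \<omega> n)"
    have S: "S < \<infinity>" using elim(2) by (simp add: S_def)
    define B where "B = enn2real S"
    have vB: "ln (enn2real (V_tilde X G M N Mt \<phi> \<mu> \<omega> n)) \<le> ln (max 1 B)" for n
    proof -
      obtain v where v: "V_tilde X G M N Mt \<phi> \<mu> \<omega> n = ennreal v" "Ur n \<omega> x0 \<le> variance_const * v" "v \<le> variance_const * Ur n \<omega> x0"
        using V_tilde_bounds[OF elim(3) \<mu> x0] .
      have "0 < variance_const * v" using v(2) Ur_ge_1[OF elim(3) x0, of n] by linarith
      then have vp: "0 < v" using variance_const_ge_1 by (simp add: zero_less_mult_iff)
      have "ennreal v \<le> S" unfolding S_def v(1)[symmetric] by (rule SUP_upper) simp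
      then have "enn2real (ennreal v) \<le> B" unfolding B_def using S by (intro enn2real_mono) auto
      then have "v \<le> B" using vp by simp
      then show ?thesis using vp by (simp add: v(1))
    qed
    show ?case
    proof (rule LIMSEQ_le[OF elim(1) lim_const_over_n[of "ln (max 1 B)"]])
      show "\<exists>N'. \<forall>n\<ge>N'. (1 / real n) * ln (enn2real (V_tilde X G M N Mt \<phi> \<mu> \<omega> n)) \<le> ln (max 1 B) / real n"
        using vB by (auto intro!: divide_right_mono)
    qed
  qed
  then show ?thesis using rate_nonneg by simp
qed

end

theorem theorem1:
  fixes X :: "'x measure" and Y :: "'y measure" and P :: "(int \<Rightarrow> 'y) measure"
    and \<mu>0 \<nu> :: "'x measure"
    and G :: "(int \<Rightarrow> 'y) \<Rightarrow> 'x \<Rightarrow> real" and M :: "(int \<Rightarrow> 'y) \<Rightarrow> 'x \<Rightarrow> 'x measure"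
    and \<beta> \<epsilon>m \<epsilon>p :: real and N :: nat
    and Mt :: "(int \<Rightarrow> 'y) \<Rightarrow> (nat \<Rightarrow> 'x) \<Rightarrow> (nat \<Rightarrow> 'x) measure"
    and \<phi> :: "(int \<Rightarrow> 'y) \<Rightarrow> (nat \<Rightarrow> 'x) \<Rightarrow> (nat \<Rightarrow> 'x) \<Rightarrow> ennreal"
  assumes P: "prob_space P" "sets P = sets (PiM UNIV (\<lambda>_. Y))"
    and \<mu>0: "prob_space \<mu>0" "sets \<mu>0 = sets X"
    and M: "random_markov_kernel P X M"
    and G: "(\<lambda>(\<omega>, x). G \<omega> x) \<in> borel_measurable (P \<Otimes>\<^sub>M X)"
      "\<forall>\<omega>\<in>space P. \<forall>x\<in>space X. 0 < G \<omega> x"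
      "\<exists>C. \<forall>\<omega>\<in>space P. \<forall>x\<in>space X. G \<omega> x \<le> C"
    and shift: "measure_preserving seq_shift P" "ergodic seq_shift P"
    and \<beta>: "1 \<le> \<beta>"
      "\<forall>\<omega>\<in>space P. \<forall>\<omega>'\<in>space P. \<forall>x\<in>space X. \<forall>x'\<in>space X. G \<omega> x / G \<omega>' x' \<le> \<beta>"
    and \<nu>: "prob_space \<nu>" "sets \<nu> = sets X"
    and \<epsilon>: "0 < \<epsilon>m" "0 < \<epsilon>p" "two_sided_bound P X M \<nu> \<epsilon>m \<epsilon>p"
    and N: "1 \<le> N"
    and Mt: "Mt \<in> kernel_class P X \<nu> N"
    and \<phi>: "density_version P (power_measure N X) (bold_M X G M N) Mt \<phi>"
  shows
    "(Upsilon P X G M N Mt \<phi> = 0 \<longleftrightarrow>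
      (AE \<omega> in P. \<exists>A\<in>sets (power_measure N X).
         emeasure (power_measure N \<nu>) (space (power_measure N X) - A) = 0 \<and>
         (\<forall>x\<in>A. \<forall>B\<in>sets (power_measure N X).
            measure (Mt \<omega> x) B =
              (LINT x':B|bold_M X G M N \<omega> x. bold_h X G M N (seq_shift \<omega>) x') /
              (LINT z|bold_M X G M N \<omega> x. bold_h X G M N (seq_shift \<omega>) z)))) \<and>
     (Upsilon P X G M N Mt \<phi> = 0 \<longleftrightarrow>
      (AE \<omega> in P. (SUP n. V_tilde X G M N Mt \<phi> \<mu>0 \<omega> n) < \<infinity>))"
proof -
  interpret P: prob_space P by fact
  interpret \<nu>: prob_space \<nu> by fact
  interpret importance_sampling P X Y \<nu> G M \<beta> \<epsilon>m \<epsilon>p N Mt \<phi>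
    by unfold_locales
      (fact | (rule G(2)[rule_format], assumption+) | (rule \<beta>(2)[rule_format], assumption+))+
  show ?thesis
    \<comment> \<open>Once (2) is folded into \<open>optimal_at\<close>, the cycle of three
      implications gives both equivalences.\<close>
    unfolding optimal_at_def[symmetric]
    using optimal_of_growth_rate_0 V_tilde_bounded_of_optimal[OF _ \<mu>0] growth_rate_0_of_bounded[OF _ \<mu>0]
    by blast
qed

end
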